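(* Let $m\in\mathbb{N}$ with $m\ge 1$ and let $p\in[1,\infty)$ be real. For $n \geq 2$, $k\geq 1$, $B>0$, $\ell \in \mathbb{N}$, there exist constants $c=c(m,n,B,\ell,p)>0$ and $s=s(m,n,B,\ell,p)>0$ such that for every $\Omega \in \mathcal{K}_{m,k+n}^{B,\ell}$, every $0<\varepsilon<1/2$ and every $a \in \mathbb{R}^k$, there is a ReLU neural network $\Phi_\varepsilon^a:\mathbb{R}^n \to [0,1]$ with \begin{itemize} \item $\|\Phi_\varepsilon^a\|_{\max} \leq \varepsilon^{-s}$, \item $\mathrm{depth}(\Phi_\varepsilon^a) \leq \lceil \log_2((\ell+1) n)\rceil+(3+\lceil \log_2(m)\rceil)(14+2m/n)$, \item $\mathrm{size}(\Phi_\varepsilon^a) \leq c\cdot\varepsilon^{-p(n-1)/m}$, \end{itemize} such that $$\|\Phi_\varepsilon^a-\chi_{\Omega(a)}\|_{L^p(Q_n)} < \varepsilon,$$ where $\Omega(a)=\{y\in\mathbb{R}^n:(a,y)\in\Omega\}$.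
   Context: Notation: $\mathbb{N}=\{0,1,\dots\}$, $[n]=\{1,\dots,n\}$, $Q_n=[-1/2,1/2]^n$; $\mathbb{R}^0=Q_0=\{*\}$ is a singleton and a map on $\mathbb{R}^0$ is identified with its value. $\pi_{i}:\mathbb{R}^{i}\to\mathbb{R}^{i-1}$ is the projection onto the first $i-1$ coordinates. $\chi$ denotes characteristic functions ($1$ on the set, $0$ off it). $L^p(Q_n)$ is with respect to Lebesgue measure. A function $g:A\to\mathbb{R}$ on an arbitrary set $A\subseteq\mathbb{R}^n$ is $C^m$ if it is the restriction of a $C^m$ function defined on an open set containing $A$; every function on $\mathbb{R}^0$ is $C^m$. For a $C^m$ function $F:\mathbb{R}^{i}\to\mathbb{R}$, $\|F\|_{W^{m,\infty}(Q_i)}:=\max_{|\alpha|\le m}\|\partial^\alpha F\|_{L^\infty(Q_i)}$. For $f,g:A\to\mathbb{R}$, write $f<g$ if $f(x)<g(x)$ for all $x\in A$; then $(f,g)_A:=\{(x,y): x\in A,\ f(x)<y<g(x)\}$, and $(f,f)_A$ is the graph of $f$. Traceable sets (for any dimension $n$): $A\subseteq\mathbb{R}^n$ is $m$-traceable if there exist sets $A_0,\dots,A_n$ and bounded $C^m$ maps $f_i,g_i:A_{i-1}\to\mathbb{R}$ such that for each $i\in[n]$: $A_i\subseteq\mathbb{R}^i$, $A_n=A$, $A_0=\{*\}$; $f_i<g_i$ or $f_i=g_i$; $\pi_i(A_i)=A_{i-1}$ and $A_i=(f_i,g_i)_{A_{i-1}}$. $\mathcal{K}_{m,n}^B$ ($B>0$)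 is the set of all $m$-traceable $A\subseteq Q_n$ (where $A_0,\dots,A_n$ and $f_i,g_i:A_{i-1}\to\mathbb{R}$, $i\in[n]$, are the sets and bounded $C^m$ maps witnessing that $A$ is $m$-traceable) such that for each $i\in[n]$ there are $C^m$ functions $F_i,G_i:\mathbb{R}^{i-1}\to\mathbb{R}$ with $F_i|_{A_{i-1}}=f_i$, $G_i|_{A_{i-1}}=g_i$, $\|F_i\|_{W^{m,\infty}(Q_{i-1})}\le B$ and $\|G_i\|_{W^{m,\infty}(Q_{i-1})}\le B$. $\mathcal{K}_{m,n}^{B,\ell}$ is the set of all $\Omega\subseteq Q_n$ of the form $\Omega=A^1\cup\dots\cup A^l$ with $l\le\ell$ and $A^1,\dots,A^l\in\mathcal{K}_{m,n}^B$ pairwise disjoint ($l=0$ gives $\emptyset$). $\mathcal{K}_{m,k+n}^{B,\ell}$ is the same class in dimension $k+n$. ReLU neural networks: a ReLU neural network $\Phi$ is a tuple $((W^{(0)},b^{(0)}),\ldots,(W^{(L)},b^{(L)}))$ with $L\ge1$, $W^{(i)}\in\mathbb{R}^{d_{i+1}\times d_i}$, $b^{(i)}\in\mathbb{R}^{d_{i+1}}$, all $d_i\ge 1$, identified with the function $\Phi:\mathbb{R}^{d_0}\to\mathbb{R}^{d_{L+1}}$ given by $x^{(0)}=x$, $x^{(i)}=\rho(W^{(i-1)}x^{(i-1)}+b^{(i-1)})$ for $i=1,\dots,L$, $\Phi(x)=W^{(L)}x^{(L)}+b^{(L)}$, where $\rho(t)=\max\{0,t\}$ acts componentwise. $\mathrm{depth}(\Phi)=L$,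 $\mathrm{size}(\Phi)$ is the number of non-zero entries of all $W^{(i)},b^{(i)}$, and $\|\Phi\|_{\max}$ is the maximal absolute value of these entries. *)

theory Defs
  imports "HOL-Probability.Essential_Supremum" "Jordan_Normal_Form.Matrix"
begin

text \<open>
  The dimension of the ambient space varies inside the statement, so points of
  \<open>\<real>\<^sup>n\<close> are extensional functions on \<open>{..<n}\<close>. Coordinates are
  numbered from 0: the \<open>i\<close>-th coordinate is \<open>x (i - 1)\<close>. In
  particular \<open>\<real>\<^sup>0\<close> is a singleton. The subspace topology inherited from
  \<open>nat \<Rightarrow> real\<close> and the completed product of the one-dimensional Borel-Lebesgue
  measures are the usual topology and Lebesgue measure.
\<close>

definition Rn :: "nat \<Rightarrow> (nat \<Rightarrow> real) set" where
  "Rn n = {..<n} \<rightarrow>\<^sub>E UNIV"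

definition Qn :: "nat \<Rightarrow> (nat \<Rightarrow> real) set" where
  "Qn n = {..<n} \<rightarrow>\<^sub>E {-1/2..1/2}"

definition leb_Qn :: "nat \<Rightarrow> (nat \<Rightarrow> real) measure" where
  "leb_Qn n = restrict_space (completion (Pi\<^sub>M {..<n} (\<lambda>_. lborel))) (Qn n)"

definition append_pt :: "nat \<Rightarrow> nat \<Rightarrow> (nat \<Rightarrow> real) \<Rightarrow> (nat \<Rightarrow> real) \<Rightarrow> nat \<Rightarrow> real" where
  "append_pt k n a y = (\<lambda>i\<in>{..<k + n}. if i < k then a i else y (i - k))"

definition slice :: "nat \<Rightarrow> nat \<Rightarrow> (nat \<Rightarrow> real) set \<Rightarrow> (nat \<Rightarrow> real) \<Rightarrow> (nat \<Rightarrow> real) set" where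
  "slice k n \<Omega> a = {y \<in> Rn n. append_pt k n a y \<in> \<Omega>}"

text \<open>The norm is infinite for functions outside \<open>L\<^sup>p\<close>.\<close>

definition Lp_norm :: "real \<Rightarrow> 'a measure \<Rightarrow> ('a \<Rightarrow> real) \<Rightarrow> ereal" where
  "Lp_norm p M h =
     (if h \<in> borel_measurable M \<and> integrable M (\<lambda>x. \<bar>h x\<bar> powr p)
      then ereal ((LINT x|M. \<bar>h x\<bar> powr p) powr (1 / p)) else \<infinity>)"

definition Linf_norm :: "'a measure \<Rightarrow> ('a \<Rightarrow> real) \<Rightarrow> ereal" where
  "Linf_norm M h = esssup M (\<lambda>x. ereal \<bar>h x\<bar>)"


definition coord_deriv :: "nat \<Rightarrow> ((nat \<Rightarrow> real) \<Rightarrow> real) \<Rightarrow> (nat \<Rightarrow> real) \<Rightarrow> real" where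
  "coord_deriv j F x = deriv (\<lambda>t. F (x(j := t))) (x j)"

definition multi_deriv ::
    "nat \<Rightarrow> (nat \<Rightarrow> nat) \<Rightarrow> ((nat \<Rightarrow> real) \<Rightarrow> real) \<Rightarrow> (nat \<Rightarrow> real) \<Rightarrow> real" where
  "multi_deriv n \<alpha> F = fold (\<lambda>j. coord_deriv j ^^ \<alpha> j) [0..<n] F"

text \<open>
  All iterated partial derivatives of order at most \<open>m\<close> exist and are continuous on \<open>U\<close>;
  meant for \<open>U\<close> open in \<open>Rn n\<close>. For \<open>n = 0\<close> every function qualifies.
\<close>

fun Cm_open :: "nat \<Rightarrow> nat \<Rightarrow> (nat \<Rightarrow> real) set \<Rightarrow> ((nat \<Rightarrow> real) \<Rightarrow> real) \<Rightarrow> bool" where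
  "Cm_open 0 n U F \<longleftrightarrow> continuous_on U F"
| "Cm_open (Suc m) n U F \<longleftrightarrow> continuous_on U F \<and>
     (\<forall>j<n. (\<forall>x\<in>U. (\<lambda>t. F (x(j := t))) field_differentiable at (x j)) \<and>
            Cm_open m n U (coord_deriv j F))"

definition Cm_on :: "nat \<Rightarrow> nat \<Rightarrow> (nat \<Rightarrow> real) set \<Rightarrow> ((nat \<Rightarrow> real) \<Rightarrow> real) \<Rightarrow> bool" where
  "Cm_on m n A h \<longleftrightarrow>
     (\<exists>U F. openin (top_of_set (Rn n)) U \<and> A \<subseteq> U \<and> Cm_open m n U F \<and> (\<forall>x\<in>A. F x = h x))"

definition Wm_inf_norm :: "nat \<Rightarrow> nat \<Rightarrow> ((nat \<Rightarrow> real) \<Rightarrow> real) \<Rightarrow> ereal" where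
  "Wm_inf_norm m n F =
     Max ((\<lambda>\<alpha>. Linf_norm (leb_Qn n) (multi_deriv n \<alpha> F)) `
          {\<alpha> \<in> {..<n} \<rightarrow>\<^sub>E UNIV. sum \<alpha> {..<n} \<le> m})"


text \<open>For \<open>A \<subseteq> \<real>\<^sup>j\<close>, the new coordinate of a point of \<open>\<real>\<^bsup>j+1\<^esup>\<close> has index \<open>j\<close>.\<close>

definition between ::
    "nat \<Rightarrow> (nat \<Rightarrow> real) set \<Rightarrow> ((nat \<Rightarrow> real) \<Rightarrow> real) \<Rightarrow> ((nat \<Rightarrow> real) \<Rightarrow> real) \<Rightarrow> (nat \<Rightarrow> real) set" where
  "between j A f g = {x(j := y) |x y. x \<in> A \<and> f x < y \<and> y < g x}"

definition graph_over ::
    "nat \<Rightarrow> (nat \<Rightarrow> real) set \<Rightarrow> ((nat \<Rightarrow> real) \<Rightarrow> real) \<Rightarrow> (nat \<Rightarrow> real) set" where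
  "graph_over j A f = {x(j := f x) |x. x \<in> A}"

text \<open>
  The sets \<open>As i\<close> for \<open>i \<le> n\<close> and the maps \<open>f i\<close>, \<open>g i\<close> for \<open>1 \<le> i \<le> n\<close>
  witness that \<open>A\<close> is \<open>m\<close>-traceable; the values of \<open>f i\<close> and \<open>g i\<close> off
  \<open>As (i - 1)\<close> are irrelevant.
\<close>

definition traceable_by ::
    "nat \<Rightarrow> nat \<Rightarrow> (nat \<Rightarrow> real) set \<Rightarrow> (nat \<Rightarrow> (nat \<Rightarrow> real) set) \<Rightarrow>
     (nat \<Rightarrow> (nat \<Rightarrow> real) \<Rightarrow> real) \<Rightarrow> (nat \<Rightarrow> (nat \<Rightarrow> real) \<Rightarrow> real) \<Rightarrow> bool" where
  "traceable_by m n A As f g \<longleftrightarrow>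
     As n = A \<and> As 0 = Rn 0 \<and>
     (\<forall>i\<in>{1..n}.
        bounded (f i ` As (i - 1)) \<and> Cm_on m (i - 1) (As (i - 1)) (f i) \<and>
        bounded (g i ` As (i - 1)) \<and> Cm_on m (i - 1) (As (i - 1)) (g i) \<and>
        As i \<subseteq> Rn i \<and>
        (\<lambda>x. restrict x {..<i - 1}) ` As i = As (i - 1) \<and>
        ((\<forall>x\<in>As (i - 1). f i x < g i x) \<and> As i = between (i - 1) (As (i - 1)) (f i) (g i) \<or>
         (\<forall>x\<in>As (i - 1). f i x = g i x) \<and> As i = graph_over (i - 1) (As (i - 1)) (f i)))"

definition K_class :: "nat \<Rightarrow> nat \<Rightarrow> real \<Rightarrow> (nat \<Rightarrow> real) set set" where
  "K_class m n B =
     {A. A \<subseteq> Qn n \<and>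
        (\<exists>As f g. traceable_by m n A As f g \<and>
          (\<forall>i\<in>{1..n}. \<exists>F G.
             Cm_open m (i - 1) (Rn (i - 1)) F \<and> Cm_open m (i - 1) (Rn (i - 1)) G \<and>
             (\<forall>x\<in>As (i - 1). F x = f i x) \<and> (\<forall>x\<in>As (i - 1). G x = g i x) \<and>
             Wm_inf_norm m (i - 1) F \<le> ereal B \<and> Wm_inf_norm m (i - 1) G \<le> ereal B))}"

definition K_union_class :: "nat \<Rightarrow> nat \<Rightarrow> real \<Rightarrow> nat \<Rightarrow> (nat \<Rightarrow> real) set set" where
  "K_union_class m n B r =
     {\<Omega>. \<Omega> \<subseteq> Qn n \<and>
        (\<exists>l A. l \<le> r \<and> (\<forall>i\<in>{1..l}. A i \<in> K_class m n B) \<and>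
               disjoint_family_on A {1..l} \<and> \<Omega> = (\<Union>i\<in>{1..l}. A i))}"


text \<open>
  A network of depth \<open>L\<close> is the list of its \<open>L + 1\<close> pairs \<open>(W, b)\<close>; the function
  \<open>d\<close> gives the layer widths.
\<close>

type_synonym network = "(real mat \<times> real Matrix.vec) list"

definition is_network :: "nat \<Rightarrow> nat \<Rightarrow> network \<Rightarrow> bool" where
  "is_network n_in n_out \<Phi> \<longleftrightarrow>
     length \<Phi> \<ge> 2 \<and>
     (\<exists>d. d 0 = n_in \<and> d (length \<Phi>) = n_out \<and> (\<forall>i\<le>length \<Phi>. d i \<ge> 1) \<and>
          (\<forall>i<length \<Phi>. fst (\<Phi> ! i) \<in> carrier_mat (d (Suc i)) (d i) \<and>
                        snd (\<Phi> ! i) \<in> carrier_vec (d (Suc i))))"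

definition relu :: "real Matrix.vec \<Rightarrow> real Matrix.vec" where
  "relu v = map_vec (max 0) v"

fun net_eval :: "network \<Rightarrow> real Matrix.vec \<Rightarrow> real Matrix.vec" where
  "net_eval [] x = x"
| "net_eval [(W, b)] x = W *\<^sub>v x + b"
| "net_eval ((W, b) # \<Phi>) x = net_eval \<Phi> (relu (W *\<^sub>v x + b))"

text \<open>The scalar function on \<open>Rn n\<close> given by a network with input width \<open>n\<close>
  and output width 1.\<close>

definition net_fun :: "nat \<Rightarrow> network \<Rightarrow> (nat \<Rightarrow> real) \<Rightarrow> real" where
  "net_fun n \<Phi> x = vec_index (net_eval \<Phi> (Matrix.vec n x)) 0"

definition net_depth :: "network \<Rightarrow> nat" where
  "net_depth \<Phi> = length \<Phi> - 1"

definition net_size :: "network \<Rightarrow> nat" where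
  "net_size \<Phi> = (\<Sum>(W, b)\<leftarrow>\<Phi>.
     card {(i, j). i < dim_row W \<and> j < dim_col W \<and> W $$ (i, j) \<noteq> 0} +
     card {i. i < dim_vec b \<and> vec_index b i \<noteq> 0})"

definition net_max :: "network \<Rightarrow> real" where
  "net_max \<Phi> = Max (abs ` (\<Union>(W, b)\<in>set \<Phi>. elements_mat W \<union> vec_set b))"

end

theory Submission
  imports Defs
begin

text \<open>
  \<^bold>\<open>Reduction to regions between graphs.\<close> Fix \<open>a\<close>. If on some level \<open>i > k\<close> the two maps that
  bound a traceable set coincide, its slice lies in the graph of a function and is a null set.
  Otherwise the slice is empty or equal to
  \<open>{y. \<forall>i<n. F i y < y i \<and> y i < G i y}\<close>, where \<open>F i\<close> and \<open>G i\<close> are the global extensions of the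
  bounding maps with the first \<open>k\<close> arguments frozen at \<open>a\<close>, so that they only depend on the
  coordinates of \<open>y\<close> before the \<open>i\<close>-th (\<open>slice_dichotomy\<close>). The essential bounds on their
  derivatives are pointwise bounds by continuity, so Taylor's formula holds for them with constants
  that depend neither on \<open>k\<close> nor on \<open>a\<close> (\<open>locally_poly_slice\<close>).

  \<^bold>\<open>Exactness off a small set.\<close> A function with values in \<open>[0, 1]\<close> that agrees with the indicator
  function off a set of measure \<open>\<eta>\<close> is within \<open>\<eta> powr (1 / p)\<close> of it in \<open>L\<^sup>p\<close>. It is therefore enough
  to have, for every integer \<open>N\<close>, a network of fixed depth with \<open>O(N ^ (n - 1))\<close> weights, all
  polynomially large in \<open>N\<close>, that is exact off a set of measure \<open>O(1 / N ^ m)\<close>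
  (\<open>network_at_scale\<close>), and to take \<open>N\<close> of order \<open>\<epsilon> powr (- p / m)\<close>. The exceptional set
  consists of strips around the graphs of \<open>F i\<close> and \<open>G i\<close>, where approximations of \<open>F i\<close> and \<open>G i\<close>
  cannot decide on which side of the graph a point lies, and of much thinner strips around the
  hyperplanes of a grid, where steep ramps differ from step functions. By Fubini the part of a strip
  inside the cube has at most the measure that its width suggests (\<open>graph_strip_measure\<close>), and
  the widths of all strips add up to \<open>O(1 / N ^ m)\<close>.

  \<^bold>\<open>The network.\<close> Cut the cube into cells of side \<open>1 / N\<close>. A function of at most \<open>n - 1\<close>
  variables meets at most \<open>N ^ (n - 1)\<close> cells and is within \<open>O(1 / N ^ m)\<close> of a Taylor polynomial
  of degree below \<open>m\<close> on each of them. One neuron per cell suffices to switch the polynomial of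
  that cell on and off, provided that all cells share the neurons that compute monomials. To
  evaluate monomials with error \<open>O(1 / N ^ m)\<close> in bounded depth, the network extracts \<open>L\<close> digits of
  every coordinate in base \<open>w = N ^ (n - 1)\<close>, where \<open>m \<le> (n - 1) * L\<close>. A polynomial of degree at
  most \<open>q = m - 1\<close> in the truncated coordinates is a linear combination of products of \<open>q\<close> factors,
  each a digit or 1;
  by \<open>polarization\<close> such a product is a linear combination of \<open>q\<close>-th powers of sums of digits, and
  the \<open>q\<close>-th power of an integer between \<open>0\<close> and \<open>q * w\<close> is computed without error by
  interpolation with \<open>q * w\<close> neurons in a single layer. So the number of weights is
  \<open>O(w + N ^ (n - 1)) = O(N ^ (n - 1))\<close>, and the depth \<open>2 * L + 7\<close> is far below the bound claimed.
\<close>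


section \<open>Networks as layers of functions\<close>

text \<open>
  A layer is described by the finite set of functions of the input that its neurons compute, not by
  matrices. Sharing of neurons is then union of sets, and the cost of a neuron is the number of
  summands in one representation of its argument as an affine combination of functions in the
  previous layer. Matrices only appear in the conversion at the end of this section.
\<close>

type_synonym rfun = "(nat \<Rightarrow> real) \<Rightarrow> real"
type_synonym row = "(real \<times> rfun option) list"

text \<open>
  \<open>None\<close> stands for the bias. A function may occur several times in a row; equal entries are only
  merged in \<open>row_coeff\<close>, which is why the weights of the final network are bounded by the
  size times the bound on row entries.
\<close>

definition row_eval :: "row \<Rightarrow> rfun" where
  "row_eval r x = (\<Sum>(c, f)\<leftarrow>r. c * (case f of None \<Rightarrow> 1 | Some g \<Rightarrow> g x))"

definition row_over :: "rfun set \<Rightarrow> real \<Rightarrow> row \<Rightarrow> bool" where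
  "row_over F M r \<longleftrightarrow> (\<forall>(c, f)\<in>set r. \<bar>c\<bar> \<le> M \<and> (\<forall>g. f = Some g \<longrightarrow> g \<in> F))"

definition affine_over :: "rfun set \<Rightarrow> real \<Rightarrow> nat \<Rightarrow> rfun \<Rightarrow> bool" where
  "affine_over F M k g \<longleftrightarrow> (\<exists>r. length r \<le> k \<and> row_over F M r \<and> g = row_eval r)"

lemma affine_over_mono:
  assumes "affine_over F M k g" "F \<subseteq> F'" "M \<le> M'" "k \<le> k'"
  shows "affine_over F' M' k' g"
  using assms unfolding affine_over_def row_over_def by (fastforce dest: order_trans)

lemma affine_over_zero: "affine_over F M 0 (\<lambda>_. 0)"
  unfolding affine_over_def by (rule exI[of _ "[]"]) (auto simp: row_over_def row_eval_def)

lemma affine_over_const: "\<bar>c\<bar> \<le> M \<Longrightarrow> affine_over F M 1 (\<lambda>_. c)"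
  unfolding affine_over_def by (rule exI[of _ "[(c, None)]"]) (auto simp: row_over_def row_eval_def)

lemma affine_over_member: "f \<in> F \<Longrightarrow> \<bar>c\<bar> \<le> M \<Longrightarrow> affine_over F M 1 (\<lambda>x. c * f x)"
  unfolding affine_over_def by (rule exI[of _ "[(c, Some f)]"]) (auto simp: row_over_def row_eval_def)

lemma affine_over_add:
  assumes "affine_over F M k g" "affine_over F M k' g'"
  shows "affine_over F M (k + k') (\<lambda>x. g x + g' x)"
proof -
  obtain r r' where "length r \<le> k" "row_over F M r" "g = row_eval r"
    "length r' \<le> k'" "row_over F M r'" "g' = row_eval r'"
    using assms unfolding affine_over_def by auto
  then show ?thesis
    unfolding affine_over_def
    by (intro exI[of _ "r @ r'"]) (auto simp: row_over_def row_eval_def)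
qed

lemma affine_over_scale:
  assumes "affine_over F M k g" "\<bar>a\<bar> * M \<le> M'"
  shows "affine_over F M' k (\<lambda>x. a * g x)"
proof -
  obtain r where r: "length r \<le> k" "row_over F M r" "g = row_eval r"
    using assms unfolding affine_over_def by auto
  have "row_eval (map (\<lambda>(c, f). (a * c, f)) r) = (\<lambda>x. a * row_eval r x)"
    unfolding row_eval_def by (rule ext, induction r) (auto simp: algebra_simps)
  moreover have "row_over F M' (map (\<lambda>(c, f). (a * c, f)) r)"
    unfolding row_over_def
  proof safe
    fix c f assume "(c, f) \<in> set (map (\<lambda>(c, f). (a * c, f)) r)"
    then obtain c' where c': "(c', f) \<in> set r" "c = a * c'" by auto
    then have "\<bar>c'\<bar> \<le> M" using r unfolding row_over_def by auto
    then have "\<bar>a\<bar> * \<bar>c'\<bar> \<le> \<bar>a\<bar> * M" by (intro mult_left_mono) auto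
    then show "\<bar>c\<bar> \<le> M'" using c' assms(2) by (simp add: abs_mult)
  next
    fix c f g assume "(c, Some g) \<in> set (map (\<lambda>(c, f). (a * c, f)) r)"
    then show "g \<in> F" using r(2) unfolding row_over_def by auto
  qed
  ultimately show ?thesis
    unfolding affine_over_def using r
    by (intro exI[of _ "map (\<lambda>(c, f). (a * c, f)) r"]) auto
qed

lemma affine_over_sum:
  assumes "finite I" "\<And>i. i \<in> I \<Longrightarrow> affine_over F M (k i) (g i)"
  shows "affine_over F M (sum k I) (\<lambda>x. \<Sum>i\<in>I. g i x)"
  using assms
proof (induction I rule: finite_induct)
  case empty then show ?case by (simp add: affine_over_zero)
next
  case (insert i I)
  then show ?case using affine_over_add[of F M "k i" "g i" "sum k I"] by simp
qed

lemma affine_over_sum_const: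
  assumes "finite I" "\<And>i. i \<in> I \<Longrightarrow> affine_over F M k (g i)"
  shows "affine_over F M (card I * k) (\<lambda>x. \<Sum>i\<in>I. g i x)"
  using affine_over_sum[of I F M "\<lambda>_. k" g] assms by simp

text \<open>
  The function \<open>k\<close> gives the cost of each neuron. Costs are attached to neurons because a layer
  mixes few expensive neurons with many cheap ones.
\<close>

definition relu_layer :: "rfun set \<Rightarrow> real \<Rightarrow> nat \<Rightarrow> rfun set \<Rightarrow> bool" where
  "relu_layer F M s G \<longleftrightarrow> finite G \<and>
     (\<exists>k. (\<forall>g\<in>G. \<exists>h. affine_over F M (k g) h \<and> g = (\<lambda>x. max 0 (h x))) \<and> sum k G \<le> s)"

lemma relu_layer_mono:
  assumes "relu_layer F M s G" "F \<subseteq> F'" "M \<le> M'" "s \<le> s'"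
  shows "relu_layer F' M' s' G"
  using assms unfolding relu_layer_def
  by (meson affine_over_mono order_refl order_trans)

lemma relu_layer_Un:
  assumes "relu_layer F M s G" "relu_layer F M s' G'"
  shows "relu_layer F M (s + s') (G \<union> G')"
proof -
  obtain k where k: "finite G" "\<And>g. g\<in>G \<Longrightarrow> \<exists>h. affine_over F M (k g) h \<and> g = (\<lambda>x. max 0 (h x))" "sum k G \<le> s"
    using assms(1) unfolding relu_layer_def by blast
  obtain k' where k': "finite G'" "\<And>g. g\<in>G' \<Longrightarrow> \<exists>h. affine_over F M (k' g) h \<and> g = (\<lambda>x. max 0 (h x))" "sum k' G' \<le> s'"
    using assms(2) unfolding relu_layer_def by blast
  let ?k = "\<lambda>g. if g \<in> G then k g else k' g"
  have "sum ?k (G \<union> G') = sum ?k G + sum ?k (G' - G)"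
    using k(1) k'(1) by (subst sum.union_disjoint[symmetric]) auto
  also have "sum ?k G = sum k G" by (rule sum.cong) auto
  also have "sum ?k (G' - G) = sum k' (G' - G)" by (rule sum.cong) auto
  also have "\<dots> \<le> sum k' G'" using k'(1) by (intro sum_mono2) auto
  finally have "sum ?k (G \<union> G') \<le> s + s'" using k(3) k'(3) by simp
  then show ?thesis unfolding relu_layer_def using k k'
    by (intro conjI exI[of _ ?k]) auto
qed

lemma relu_layer_image:
  assumes "finite I" "\<And>i. i \<in> I \<Longrightarrow> affine_over F M k (h i)"
  shows "relu_layer F M (card I * k) ((\<lambda>i x. max 0 (h i x)) ` I)"
  unfolding relu_layer_def
proof (intro conjI exI[of _ "\<lambda>_. k"] ballI)
  show "(\<Sum>g\<in>(\<lambda>i x. max 0 (h i x)) ` I. k) \<le> card I * k"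
    using card_image_le[OF assms(1), of "\<lambda>i x. max 0 (h i x)"] by (simp add: mult_le_mono1)
qed (use assms in auto)

primrec computes :: "nat \<Rightarrow> real \<Rightarrow> nat \<Rightarrow> nat \<Rightarrow> rfun set \<Rightarrow> bool" where
  "computes n M 0 S F \<longleftrightarrow> F = (\<lambda>j x. x j) ` {..<n}"
| "computes n M (Suc i) S F \<longleftrightarrow>
     (\<exists>F' S' s. computes n M i S' F' \<and> relu_layer F' M s F \<and> S' + s \<le> S)"

lemma computes_Suc:
  "computes n M i S F \<Longrightarrow> relu_layer F M s G \<Longrightarrow> S + s \<le> S' \<Longrightarrow> computes n M (Suc i) S' G"
  by auto

definition row_coeff :: "row \<Rightarrow> rfun option \<Rightarrow> real" where
  "row_coeff r h = (\<Sum>(c, f)\<leftarrow>r. if f = h then c else 0)"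

lemma row_eval_coeff:
  assumes "row_over F M r" "F \<subseteq> set fs" "distinct fs"
  shows "row_eval r x =
    (\<Sum>j<length fs. row_coeff r (Some (fs ! j)) * (fs ! j) x) + row_coeff r None"
  using assms(1)
proof (induction r)
  case Nil
  then show ?case by (simp add: row_eval_def row_coeff_def)
next
  case (Cons a r)
  obtain c f where a: "a = (c, f)" by force
  have r: "row_over F M r" using Cons.prems by (auto simp: row_over_def)
  have *: "row_coeff (a # r) h = (if f = h then c else 0) + row_coeff r h" for h
    by (simp add: row_coeff_def a)
  have **: "row_eval (a # r) x = c * (case f of None \<Rightarrow> 1 | Some g \<Rightarrow> g x) + row_eval r x"
    by (simp add: row_eval_def a)
  show ?case
  proof (cases f)
    case None
    then show ?thesis unfolding * ** Cons.IH[OF r] by simp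
  next
    case (Some g)
    then have "g \<in> set fs" using Cons.prems assms(2) by (auto simp: row_over_def a)
    then obtain i where i: "i < length fs" "g = fs ! i" by (auto simp: in_set_conv_nth)
    have "(\<Sum>j<length fs. (if f = Some (fs ! j) then c else 0) * (fs ! j) x) =
        (\<Sum>j<length fs. if j = i then c * (fs ! j) x else 0)"
      using i assms(3) Some by (intro sum.cong) (auto simp: nth_eq_iff_index_eq)
    also have "\<dots> = c * g x" using i by (simp add: sum.delta)
    finally show ?thesis unfolding * ** Cons.IH[OF r] using Some
      by (simp add: distrib_right sum.distrib)
  qed
qed

lemma row_coeff_bound: "row_over F M r \<Longrightarrow> 0 \<le> M \<Longrightarrow> \<bar>row_coeff r h\<bar> \<le> real (length r) * M"
proof (induction r)
  case (Cons a r)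
  obtain c f where a: "a = (c, f)" by force
  have "row_over F M r" "\<bar>c\<bar> \<le> M" using Cons.prems by (auto simp: row_over_def a)
  moreover have "row_coeff (a # r) h = (if f = h then c else 0) + row_coeff r h"
    by (simp add: row_coeff_def a)
  ultimately show ?case using Cons.IH Cons.prems(2) by (auto simp: algebra_simps split: if_splits)
qed (simp add: row_coeff_def)

text \<open>
  By this lemma a row of a weight matrix has at most as many nonzero entries, bias included, as the
  list it comes from has elements.
\<close>

lemma row_coeff_nonzero: "row_coeff r h \<noteq> 0 \<Longrightarrow> h \<in> snd ` set r"
proof (induction r)
  case (Cons a r)
  obtain c f where a: "a = (c, f)" by force
  have "row_coeff (a # r) h = (if f = h then c else 0) + row_coeff r h"
    by (simp add: row_coeff_def a)
  then show ?case using Cons by (auto simp: a split: if_splits)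
qed (simp add: row_coeff_def)

definition layer_size :: "real mat \<Rightarrow> real Matrix.vec \<Rightarrow> nat" where
  "layer_size W b = card {(i, j). i < dim_row W \<and> j < dim_col W \<and> W $$ (i, j) \<noteq> 0} +
     card {i. i < dim_vec b \<and> vec_index b i \<noteq> 0}"

lemma net_size_layers: "net_size \<Phi> = (\<Sum>(W, b)\<leftarrow>\<Phi>. layer_size W b)"
  by (simp add: net_size_def layer_size_def)

text \<open>
  Distinctness of \<open>fs\<close> makes the column of a function well defined. The nonzero entries of \<open>W\<close> and
  \<open>b\<close> are counted by an injection into the pairs of a row and a function (or bias) of that row.
\<close>

lemma matrix_of_rows:
  assumes rows: "\<And>r. r \<in> set rs \<Longrightarrow> row_over F M r"
    and F: "F \<subseteq> set fs" and dist: "distinct fs" and M: "0 \<le> M"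
  shows "\<exists>W b. W \<in> carrier_mat (length rs) (length fs) \<and> b \<in> carrier_vec (length rs) \<and>
    (\<forall>x. W *\<^sub>v Matrix.vec (length fs) (\<lambda>j. (fs ! j) x) + b =
       Matrix.vec (length rs) (\<lambda>i. row_eval (rs ! i) x)) \<and>
    layer_size W b \<le> sum_list (map length rs) \<and>
    (\<forall>e\<in>elements_mat W \<union> vec_set b. \<bar>e\<bar> \<le> real (sum_list (map length rs)) * M)"
proof -
  define W where "W = Matrix.mat (length rs) (length fs) (\<lambda>(i, j). row_coeff (rs ! i) (Some (fs ! j)))"
  define b where "b = Matrix.vec (length rs) (\<lambda>i. row_coeff (rs ! i) None)"
  have ev: "W *\<^sub>v Matrix.vec (length fs) (\<lambda>j. (fs ! j) x) + b =
       Matrix.vec (length rs) (\<lambda>i. row_eval (rs ! i) x)" for x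
  proof (rule eq_vecI)
    fix i assume "i < dim_vec (Matrix.vec (length rs) (\<lambda>i. row_eval (rs ! i) x))"
    then have i: "i < length rs" by simp
    have "row_over F M (rs ! i)" using rows i by simp
    from row_eval_coeff[OF this F dist] show
      "vec_index (W *\<^sub>v Matrix.vec (length fs) (\<lambda>j. (fs ! j) x) + b) i =
       vec_index (Matrix.vec (length rs) (\<lambda>i. row_eval (rs ! i) x)) i"
      using i by (simp add: W_def b_def scalar_prod_def atLeast0LessThan)
  qed (simp add: b_def)
  have len: "length (rs ! i) \<le> sum_list (map length rs)" if "i < length rs" for i
    using that by (intro member_le_sum_list) auto
  have bound: "\<bar>row_coeff (rs ! i) h\<bar> \<le> real (sum_list (map length rs)) * M" if "i < length rs" for i h
  proof -
    have "\<bar>row_coeff (rs ! i) h\<bar> \<le> real (length (rs ! i)) * M"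
      using that rows M by (intro row_coeff_bound[of F]) auto
    also have "\<dots> \<le> real (sum_list (map length rs)) * M"
      using len[OF that] M by (intro mult_right_mono) auto
    finally show ?thesis .
  qed
  have ent: "\<forall>e\<in>elements_mat W \<union> vec_set b. \<bar>e\<bar> \<le> real (sum_list (map length rs)) * M"
    using bound by (auto simp: elements_mat_def W_def b_def vec_set_def)
  define P where "P i = {h. row_coeff (rs ! i) h \<noteq> 0 \<and> (h = None \<or> (\<exists>j<length fs. h = Some (fs ! j)))}" for i
  have P: "finite (P i) \<and> card (P i) \<le> length (rs ! i)" for i
  proof -
    have "P i \<subseteq> set (map snd (rs ! i))" using row_coeff_nonzero unfolding P_def by auto
    then have "card (P i) \<le> card (set (map snd (rs ! i)))" "finite (P i)"
      by (auto intro: card_mono finite_subset)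
    with card_length[of "map snd (rs ! i)"] show ?thesis by simp
  qed
  let ?A = "{(i, j). i < dim_row W \<and> j < dim_col W \<and> W $$ (i, j) \<noteq> 0}"
  let ?B = "{i. i < dim_vec b \<and> vec_index b i \<noteq> 0}"
  \<comment> \<open>columns go to the function they stand for, bias entries to \<open>None\<close>\<close>
  let ?f = "\<lambda>s. case s of Inl (i, j) \<Rightarrow> (i, Some (fs ! j)) | Inr i \<Rightarrow> (i, None)"
  have "finite ?A" by (rule finite_subset[of _ "{..<dim_row W} \<times> {..<dim_col W}"]) auto
  then have "card ?A + card ?B = card (?A <+> ?B)" by (subst card_Plus) auto
  also have "\<dots> \<le> card (Sigma {..<length rs} P)"
  proof (rule card_inj_on_le[of ?f])
    show "inj_on ?f (?A <+> ?B)"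
      using dist by (auto simp: inj_on_def W_def nth_eq_iff_index_eq)
    show "?f ` (?A <+> ?B) \<subseteq> Sigma {..<length rs} P"
      by (auto simp: W_def b_def P_def)
    show "finite (Sigma {..<length rs} P)" using P by auto
  qed
  also have "\<dots> = (\<Sum>i<length rs. card (P i))" using P by (simp add: card_SigmaI)
  also have "\<dots> \<le> (\<Sum>i<length rs. length (rs ! i))" using P by (intro sum_mono) auto
  also have "\<dots> = sum_list (map length rs)"
    by (simp add: sum_list_sum_nth atLeast0LessThan)
  finally have "layer_size W b \<le> sum_list (map length rs)" by (simp add: layer_size_def)
  with ev ent show ?thesis
    by (intro exI[of _ W] exI[of _ b]) (auto simp: W_def b_def)
qed

definition hidden_eval :: "network \<Rightarrow> real Matrix.vec \<Rightarrow> real Matrix.vec" where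
  "hidden_eval \<Phi> = fold (\<lambda>(W, b) x. relu (W *\<^sub>v x + b)) \<Phi>"

lemma net_eval_snoc: "net_eval (\<Phi> @ [(W, b)]) x = W *\<^sub>v hidden_eval \<Phi> x + b"
proof (induction \<Phi> arbitrary: x)
  case (Cons a \<Phi>)
  obtain V c where a: "a = (V, c)" by force
  have "net_eval ((a # \<Phi>) @ [(W, b)]) x = net_eval (\<Phi> @ [(W, b)]) (relu (V *\<^sub>v x + c))"
    by (cases "\<Phi> @ [(W, b)]") (auto simp: a)
  then show ?case by (simp add: Cons hidden_eval_def a)
qed (simp add: hidden_eval_def)

definition chain :: "nat \<Rightarrow> nat \<Rightarrow> network \<Rightarrow> bool" where
  "chain n n' \<Phi> \<longleftrightarrow> (\<exists>d. d 0 = n \<and> d (length \<Phi>) = n' \<and> (\<forall>i\<le>length \<Phi>. d i \<ge> 1) \<and>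
          (\<forall>i<length \<Phi>. fst (\<Phi> ! i) \<in> carrier_mat (d (Suc i)) (d i) \<and>
                        snd (\<Phi> ! i) \<in> carrier_vec (d (Suc i))))"

lemma chain_snoc:
  assumes "chain n n' \<Phi>" "W \<in> carrier_mat n'' n'" "b \<in> carrier_vec n''" "n'' \<ge> 1"
  shows "chain n n'' (\<Phi> @ [(W, b)])"
proof -
  obtain d where d: "d 0 = n" "d (length \<Phi>) = n'" "\<forall>i\<le>length \<Phi>. d i \<ge> 1"
     "\<forall>i<length \<Phi>. fst (\<Phi> ! i) \<in> carrier_mat (d (Suc i)) (d i) \<and> snd (\<Phi> ! i) \<in> carrier_vec (d (Suc i))"
    using assms(1) unfolding chain_def by blast
  show ?thesis unfolding chain_def
    by (rule exI[of _ "d(Suc (length \<Phi>) := n'')"])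
      (use d assms in \<open>auto simp: nth_append le_Suc_eq less_Suc_eq\<close>)
qed

text \<open>
  The enumerations \<open>fs\<close> may contain the zero function in addition to the functions of the layer: a
  network needs positive widths, and a zero neuron costs nothing.
\<close>

lemma computes_hidden_eval:
  assumes "n \<ge> 1" "0 \<le> M"
  shows "computes n M i S F \<Longrightarrow> \<exists>\<Phi> fs. length \<Phi> = i \<and> distinct fs \<and> F \<subseteq> set fs \<and>
     chain n (length fs) \<Phi> \<and>
     (\<forall>x. hidden_eval \<Phi> (Matrix.vec n x) = Matrix.vec (length fs) (\<lambda>j. (fs ! j) x)) \<and>
     net_size \<Phi> \<le> S \<and>
     (\<forall>(W, b)\<in>set \<Phi>. \<forall>e\<in>elements_mat W \<union> vec_set b. \<bar>e\<bar> \<le> real S * M)"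
proof (induction i arbitrary: S F)
  case 0
  have 1: "(\<lambda>x::nat\<Rightarrow>real. x j) = (\<lambda>x. x j') \<Longrightarrow> j = j'" for j j'
    by (drule fun_cong[of _ _ "\<lambda>i. if i = j then 1 else 0"]) (auto split: if_splits)
  show ?case using 0 1 assms
    by (intro exI[of _ "[]"] exI[of _ "map (\<lambda>j x. x j) [0..<n]"])
      (auto simp: distinct_map inj_on_def chain_def hidden_eval_def net_size_def)
next
  case (Suc i)
  then obtain F' S' s where F': "computes n M i S' F'" "relu_layer F' M s F" "S' + s \<le> S" by auto
  from Suc.IH[OF F'(1)] obtain \<Phi> fs where IH: "length \<Phi> = i" "distinct fs" "F' \<subseteq> set fs"
     "chain n (length fs) \<Phi>"
     "\<And>x. hidden_eval \<Phi> (Matrix.vec n x) = Matrix.vec (length fs) (\<lambda>j. (fs ! j) x)"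
     "net_size \<Phi> \<le> S'"
     "\<forall>(W, b)\<in>set \<Phi>. \<forall>e\<in>elements_mat W \<union> vec_set b. \<bar>e\<bar> \<le> real S' * M" by blast
  obtain k where k: "finite F" "sum k F \<le> s"
    "\<forall>g\<in>F. \<exists>h. affine_over F' M (k g) h \<and> g = (\<lambda>x. max 0 (h x))"
    using F'(2) unfolding relu_layer_def by blast
  then have "\<forall>g\<in>F. \<exists>r. length r \<le> k g \<and> row_over F' M r \<and> g = (\<lambda>x. max 0 (row_eval r x))"
    unfolding affine_over_def by blast
  then obtain R where R: "\<And>g. g \<in> F \<Longrightarrow> length (R g) \<le> k g \<and> row_over F' M (R g) \<and> g = (\<lambda>x. max 0 (row_eval (R g) x))"
    by metis
  obtain gs0 where gs0: "set gs0 = F" "distinct gs0" using finite_distinct_list[OF k(1)] by blast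
  define gs where "gs = (if (\<lambda>_. 0) \<in> F then gs0 else (\<lambda>_. 0) # gs0)"
  define rs where "rs = (if (\<lambda>_. 0) \<in> F then map R gs0 else [] # map R gs0)"
  have gs: "distinct gs" "F \<subseteq> set gs" "length gs \<ge> 1" "length rs = length gs"
    using gs0 by (auto simp: gs_def rs_def Suc_le_eq)
  have row_Nil: "row_over F' M []" by (simp add: row_over_def)
  have rs: "\<And>r. r \<in> set rs \<Longrightarrow> row_over F' M r"
    using R gs0 row_Nil by (auto simp: rs_def split: if_splits)
  have gs_eq: "gs ! j = (\<lambda>x. max 0 (row_eval (rs ! j) x))" if "j < length gs" for j
  proof (cases "(\<lambda>_. 0) \<in> F")
    case True
    then have "rs ! j = R (gs ! j)" "gs ! j \<in> F" using that gs0 by (auto simp: gs_def rs_def)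
    then show ?thesis using R by metis
  next
    case False
    show ?thesis
    proof (cases j)
      case 0
      then show ?thesis using False by (simp add: gs_def rs_def row_eval_def)
    next
      case (Suc j')
      then have "rs ! j = R (gs ! j)" "gs ! j \<in> F" using that False gs0 by (auto simp: gs_def rs_def)
      then show ?thesis using R by metis
    qed
  qed
  have "sum_list (map length rs) = sum_list (map (\<lambda>g. length (R g)) gs0)"
    by (simp add: rs_def comp_def)
  also have "\<dots> = sum (\<lambda>g. length (R g)) F" using gs0 by (simp add: sum_list_distinct_conv_sum_set)
  also have "\<dots> \<le> sum k F" using R by (intro sum_mono) auto
  finally have len: "sum_list (map length rs) \<le> s" using k by simp
  obtain W b where Wb: "W \<in> carrier_mat (length rs) (length fs)" "b \<in> carrier_vec (length rs)"
    "\<And>x. W *\<^sub>v Matrix.vec (length fs) (\<lambda>j. (fs ! j) x) + b =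
       Matrix.vec (length rs) (\<lambda>i. row_eval (rs ! i) x)"
    "layer_size W b \<le> sum_list (map length rs)"
    "\<forall>e\<in>elements_mat W \<union> vec_set b. \<bar>e\<bar> \<le> real (sum_list (map length rs)) * M"
    using matrix_of_rows[OF rs IH(3,2) assms(2)] by blast
  have le: "real (sum_list (map length rs)) * M \<le> real S * M" "real S' * M \<le> real S * M"
    using len F'(3) assms by (auto intro!: mult_right_mono)
  show ?case
  proof (intro exI[of _ "\<Phi> @ [(W, b)]"] exI[of _ gs] conjI allI)
    show "chain n (length gs) (\<Phi> @ [(W, b)])"
      using IH(4) Wb gs by (intro chain_snoc) auto
    show "hidden_eval (\<Phi> @ [(W, b)]) (Matrix.vec n x) = Matrix.vec (length gs) (\<lambda>j. (gs ! j) x)" for x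
    proof -
      have "hidden_eval (\<Phi> @ [(W, b)]) (Matrix.vec n x) = relu (W *\<^sub>v hidden_eval \<Phi> (Matrix.vec n x) + b)"
        by (simp add: hidden_eval_def)
      also have "\<dots> = Matrix.vec (length gs) (\<lambda>j. (gs ! j) x)"
        unfolding IH(5) Wb(3) by (rule eq_vecI) (auto simp: relu_def gs gs_eq)
      finally show ?thesis .
    qed
    show "net_size (\<Phi> @ [(W, b)]) \<le> S"
      using IH(6) Wb(4) len F'(3) by (simp add: net_size_layers)
    have "\<bar>e\<bar> \<le> real S * M" if "(V, c) \<in> set (\<Phi> @ [(W, b)])" "e \<in> elements_mat V \<union> vec_set c" for V c e
    proof (cases "(V, c) \<in> set \<Phi>")
      case True
      then have "\<bar>e\<bar> \<le> real S' * M" using IH(7) that(2) by blast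
      then show ?thesis using le by linarith
    next
      case False
      then have "V = W" "c = b" using that by auto
      then have "\<bar>e\<bar> \<le> real (sum_list (map length rs)) * M" using Wb(5) that(2) by blast
      then show ?thesis using le by linarith
    qed
    then show "\<forall>(W, b)\<in>set (\<Phi> @ [(W, b)]). \<forall>e\<in>elements_mat W \<union> vec_set b. \<bar>e\<bar> \<le> real S * M"
      by blast
  qed (use IH gs in auto)
qed

lemma network_of_computes:
  assumes "n \<ge> 1" "0 \<le> M" "i \<ge> 1" "computes n M i S F" "affine_over F M k g"
  shows "\<exists>\<Phi>. is_network n 1 \<Phi> \<and> net_depth \<Phi> = i \<and> net_size \<Phi> \<le> S + k \<and>
    net_max \<Phi> \<le> real (S + k) * M \<and> net_fun n \<Phi> = g"
proof -
  obtain \<Phi> fs where \<Phi>: "length \<Phi> = i" "distinct fs" "F \<subseteq> set fs"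
     "chain n (length fs) \<Phi>"
     "\<And>x. hidden_eval \<Phi> (Matrix.vec n x) = Matrix.vec (length fs) (\<lambda>j. (fs ! j) x)"
     "net_size \<Phi> \<le> S"
     "\<forall>(W, b)\<in>set \<Phi>. \<forall>e\<in>elements_mat W \<union> vec_set b. \<bar>e\<bar> \<le> real S * M"
    using computes_hidden_eval[OF assms(1,2,4)] by blast
  obtain r where r: "length r \<le> k" "row_over F M r" "g = row_eval r"
    using assms(5) unfolding affine_over_def by blast
  obtain W b where Wb: "W \<in> carrier_mat 1 (length fs)" "b \<in> carrier_vec 1"
    "\<And>x. W *\<^sub>v Matrix.vec (length fs) (\<lambda>j. (fs ! j) x) + b =
       Matrix.vec 1 (\<lambda>i. row_eval ([r] ! i) x)"
    "layer_size W b \<le> length r"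
    "\<forall>e\<in>elements_mat W \<union> vec_set b. \<bar>e\<bar> \<le> real (length r) * M"
    using matrix_of_rows[of "[r]", OF _ \<Phi>(3,2) assms(2)] r(2) by auto
  let ?\<Psi> = "\<Phi> @ [(W, b)]"
  have "chain n 1 ?\<Psi>" using \<Phi>(4) Wb by (intro chain_snoc) auto
  then have net: "is_network n 1 ?\<Psi>" using assms(3) \<Phi>(1) unfolding is_network_def chain_def by auto
  have fn: "net_fun n ?\<Psi> = g"
    unfolding net_fun_def net_eval_snoc \<Phi>(5) Wb(3) by (auto simp: r)
  have le: "real (length r) * M \<le> real (S + k) * M" "real S * M \<le> real (S + k) * M"
    using r assms by (auto intro!: mult_right_mono)
  have fin: "finite (\<Union>(W, b)\<in>set ?\<Psi>. elements_mat W \<union> vec_set b)"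
    by (auto simp: elements_mat_def vec_set_def)
  have "vec_index b 0 \<in> vec_set b" using Wb(2) by (auto simp: vec_set_def)
  then have ne: "(\<Union>(W, b)\<in>set ?\<Psi>. elements_mat W \<union> vec_set b) \<noteq> {}" by auto
  have "\<bar>e\<bar> \<le> real (S + k) * M" if "(V, c) \<in> set ?\<Psi>" "e \<in> elements_mat V \<union> vec_set c" for V c e
  proof (cases "(V, c) \<in> set \<Phi>")
    case True
    then have "\<bar>e\<bar> \<le> real S * M" using \<Phi>(7) that(2) by blast
    then show ?thesis using le by linarith
  next
    case False
    then have "V = W" "c = b" using that by auto
    then have "\<bar>e\<bar> \<le> real (length r) * M" using Wb(5) that(2) by blast
    then show ?thesis using le by linarith
  qed
  then have "\<forall>z\<in>abs ` (\<Union>(W, b)\<in>set ?\<Psi>. elements_mat W \<union> vec_set b). z \<le> real (S + k) * M"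
    by blast
  then have "net_max ?\<Psi> \<le> real (S + k) * M"
    unfolding net_max_def using fin ne by (subst Max_le_iff) (simp_all del: UN_iff)
  moreover have "net_size ?\<Psi> \<le> S + k" using \<Phi>(6) Wb(4) r(1) by (simp add: net_size_layers)
  ultimately show ?thesis using net fn \<Phi>(1) by (intro exI[of _ ?\<Psi>]) (simp add: net_depth_def)
qed


section \<open>Lebesgue measure on the cube\<close>

abbreviation leb :: "nat \<Rightarrow> (nat \<Rightarrow> real) measure" where
  "leb n \<equiv> Pi\<^sub>M {..<n} (\<lambda>_. lborel)"

interpretation lborel_product: product_sigma_finite "\<lambda>_::nat. lborel :: real measure"
  by standard

lemma space_leb: "space (leb n) = Rn n"
  by (simp add: space_PiM Rn_def)

lemma Qn_subset_Rn: "Qn n \<subseteq> Rn n"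
  unfolding Qn_def Rn_def by auto

lemma sets_Qn [measurable]: "Qn n \<in> sets (leb n)"
  unfolding Qn_def by (intro sets_PiM_I_finite) auto

text \<open>
  Continuity refers to the product topology on all of \<open>nat \<Rightarrow> real\<close>, whose Borel sets are those of
  the countable product; coordinates from \<open>D\<close> on are constant on \<open>Rn D\<close> and thus measurable.
\<close>

lemma continuous_on_Rn_measurable:
  assumes "continuous_on (Rn D) F"
    and "\<And>j. j < D \<Longrightarrow> (\<lambda>x. T x j) \<in> borel_measurable M"
    and "\<And>x. x \<in> space M \<Longrightarrow> T x \<in> Rn D"
  shows "(\<lambda>x. F (T x)) \<in> borel_measurable M"
proof -
  have "(\<lambda>x. T x j) \<in> borel_measurable M" for j
  proof (cases "j < D")
    case False
    have "(\<lambda>x. T x j) \<in> borel_measurable M \<longleftrightarrow> (\<lambda>x. undefined :: real) \<in> borel_measurable M"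
      using assms(3) False by (intro measurable_cong) (auto simp: Rn_def PiE_def extensional_def)
    then show ?thesis by simp
  qed (rule assms(2))
  then have "T \<in> borel_measurable M" by (rule measurable_coordinatewise_then_product)
  then have "T \<in> measurable M (restrict_space borel (Rn D))"
    using assms(3) by (intro measurable_restrict_space2) auto
  from measurable_compose[OF this borel_measurable_continuous_on_restrict[OF assms(1)]]
  show ?thesis .
qed

text \<open>
  Fubini in the \<open>i\<close>-th coordinate: the remaining coordinates range over a cube of volume 1.
\<close>

lemma slab_measure:
  assumes i: "i < n" and S: "S \<in> sets (leb n)"
    and sec: "\<And>x. x \<in> Qn n \<Longrightarrow> emeasure lborel {t \<in> {-1/2..1/2}. x(i := t) \<in> S} \<le> c"
  shows "emeasure (leb n) (S \<inter> Qn n) \<le> c"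
proof -
  define I where "I = {..<n} - {i}"
  have ins: "{..<n} = insert i I" and I: "finite I" "i \<notin> I" using i by (auto simp: I_def)
  define R where "R = (I \<rightarrow>\<^sub>E {-1/2..1/2::real})"
  have Rsets: "R \<in> sets (Pi\<^sub>M I (\<lambda>_. lborel))"
    unfolding R_def using I by (intro sets_PiM_I_finite) auto
  have SQ: "S \<inter> Qn n \<in> sets (leb n)" using S by auto
  have "emeasure (leb n) (S \<inter> Qn n) = (\<integral>\<^sup>+x. indicator (S \<inter> Qn n) x \<partial>leb n)"
    using SQ by simp
  also have "\<dots> = (\<integral>\<^sup>+x. (\<integral>\<^sup>+t. indicator (S \<inter> Qn n) (x(i := t)) \<partial>lborel) \<partial>Pi\<^sub>M I (\<lambda>_. lborel))"
    using SQ unfolding ins by (intro lborel_product.product_nn_integral_insert[OF I]) auto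
  also have "\<dots> \<le> (\<integral>\<^sup>+x. c * indicator R x \<partial>Pi\<^sub>M I (\<lambda>_. lborel))"
  proof (rule nn_integral_mono)
    fix x assume x: "x \<in> space (Pi\<^sub>M I (\<lambda>_. lborel :: real measure))"
    have mem: "x(i := t) \<in> Qn n \<longleftrightarrow> x \<in> R \<and> t \<in> {-1/2..1/2}" for t
      using x I unfolding Qn_def R_def ins
      by (auto simp: space_PiM PiE_def extensional_def Pi_def split: if_splits)
    show "(\<integral>\<^sup>+t. indicator (S \<inter> Qn n) (x(i := t)) \<partial>lborel) \<le> c * indicator R x"
    proof (cases "x \<in> R")
      case True
      have upd: "(\<lambda>t. x(i := t)) \<in> measurable lborel (leb n)"
        unfolding ins using measurable_component_update[OF x I(2)] by simp
      have eq: "{t \<in> {-1/2..1/2}. x(i := t) \<in> S} = (\<lambda>t. x(i := t)) -` (S \<inter> Qn n) \<inter> space lborel"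
        using mem True by auto
      have "{t \<in> {-1/2..1/2}. x(i := t) \<in> S} \<in> sets lborel"
        unfolding eq using measurable_sets[OF upd SQ] .
      moreover have "indicator (S \<inter> Qn n) (x(i := t)) =
          (indicator {t \<in> {-1/2..1/2}. x(i := t) \<in> S} t :: ennreal)" for t
        using mem True by (auto simp: indicator_def)
      ultimately have "(\<integral>\<^sup>+t. indicator (S \<inter> Qn n) (x(i := t)) \<partial>lborel) =
        emeasure lborel {t \<in> {-1/2..1/2}. x(i := t) \<in> S}" by simp
      also have "{t \<in> {-1/2..1/2}. x(i := t) \<in> S} = {t \<in> {-1/2..1/2}. (x(i := 0))(i := t) \<in> S}" by simp
      also have "emeasure lborel \<dots> \<le> c"
        using mem[of 0] True by (intro sec) auto
      finally show ?thesis using True by (metis indicator_simps(1) mult.right_neutral)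
    next
      case False
      then show ?thesis using mem by (simp add: indicator_def)
    qed
  qed
  also have "\<dots> = c * emeasure (Pi\<^sub>M I (\<lambda>_. lborel)) R"
    using Rsets by (simp add: nn_integral_cmult)
  also have "emeasure (Pi\<^sub>M I (\<lambda>_. lborel)) R = 1"
    unfolding R_def using I by (subst lborel_product.emeasure_PiM) auto
  finally show ?thesis by simp
qed

lemma graph_strip_measure:
  assumes i: "i < n" and F: "F \<in> borel_measurable (leb n)" and r: "0 \<le> r"
    and indep: "\<And>x t. F (x(i := t)) = F x"
  shows "{x \<in> Rn n. \<bar>x i - F x\<bar> \<le> r} \<in> sets (leb n)"
    and "emeasure (leb n) ({x \<in> Rn n. \<bar>x i - F x\<bar> \<le> r} \<inter> Qn n) \<le> ennreal (2 * r)"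
proof -
  have [measurable]: "(\<lambda>x. x i) \<in> borel_measurable (leb n)"
    using i measurable_component_singleton[of i "{..<n}" "\<lambda>_. lborel"] by simp
  have "{x \<in> space (leb n). \<bar>x i - F x\<bar> \<le> r} \<in> sets (leb n)" using F by measurable
  then show S: "{x \<in> Rn n. \<bar>x i - F x\<bar> \<le> r} \<in> sets (leb n)" by (simp add: space_leb)
  show "emeasure (leb n) ({x \<in> Rn n. \<bar>x i - F x\<bar> \<le> r} \<inter> Qn n) \<le> ennreal (2 * r)"
  proof (rule slab_measure[OF i S])
    fix x assume "x \<in> Qn n"
    have "emeasure lborel {t \<in> {-1/2..1/2}. x(i := t) \<in> {x \<in> Rn n. \<bar>x i - F x\<bar> \<le> r}}
        \<le> emeasure lborel {F x - r .. F x + r}"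
      by (rule emeasure_mono) (auto simp: indep)
    also have "\<dots> = ennreal (2 * r)" using r by simp
    finally show "emeasure lborel {t \<in> {-1/2..1/2}. x(i := t) \<in> {x \<in> Rn n. \<bar>x i - F x\<bar> \<le> r}} \<le> ennreal (2 * r)" .
  qed
qed

lemma measurable_leb_Qn: "h \<in> borel_measurable (leb n) \<Longrightarrow> h \<in> borel_measurable (leb_Qn n)"
  unfolding leb_Qn_def by (intro measurable_restrict_space1 measurable_completion)

lemma space_leb_Qn: "space (leb_Qn n) = Qn n"
  using Qn_subset_Rn by (auto simp: leb_Qn_def space_restrict_space space_leb)

lemma sets_leb_Qn_iff: "A \<in> sets (leb_Qn n) \<longleftrightarrow> A \<subseteq> Qn n \<and> A \<in> sets (completion (leb n))"
  unfolding leb_Qn_def by (intro sets_restrict_space_iff) (auto intro: sets_completionI_sets)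

lemma emeasure_leb_Qn:
  assumes "A \<in> sets (leb n)"
  shows "emeasure (leb_Qn n) (A \<inter> Qn n) = emeasure (leb n) (A \<inter> Qn n)"
  unfolding leb_Qn_def using assms
  by (subst emeasure_restrict_space) (auto intro: sets_completionI_sets)

lemma emeasure_Qn: "emeasure (leb n) (Qn n) = 1"
  unfolding Qn_def by (subst lborel_product.emeasure_PiM) auto

text \<open>
  Since \<open>h\<close> is bounded by 1, its \<open>p\<close>-th power is dominated by the indicator of \<open>Bad\<close> almost everywhere.
  The null set \<open>Z\<close> is separate because \<open>h\<close> is only measurable for the completed measure.
\<close>

lemma Lp_norm_less_of_bad_set:
  assumes h: "h \<in> borel_measurable (leb_Qn n)" and h1: "\<And>x. x \<in> Qn n \<Longrightarrow> \<bar>h x\<bar> \<le> 1"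
    and Bad: "Bad \<in> sets (leb n)" "emeasure (leb n) (Bad \<inter> Qn n) \<le> ennreal \<eta>"
    and Z: "Z \<in> null_sets (leb n)"
    and h0: "\<And>x. x \<in> Qn n \<Longrightarrow> x \<notin> Bad \<Longrightarrow> x \<notin> Z \<Longrightarrow> h x = 0"
    and p: "p \<ge> 1" and \<epsilon>: "0 < \<epsilon>" "0 \<le> \<eta>" "\<eta> < \<epsilon> powr p"
  shows "Lp_norm p (leb_Qn n) h < ereal \<epsilon>"
proof -
  let ?M = "leb_Qn n"
  have BM: "Bad \<inter> Qn n \<in> sets ?M"
    using Bad by (auto simp: sets_leb_Qn_iff intro!: sets_completionI_sets)
  have fin: "finite_measure ?M"
  proof
    have "emeasure ?M (Rn n \<inter> Qn n) = emeasure (leb n) (Rn n \<inter> Qn n)"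
      by (intro emeasure_leb_Qn) (metis sets.top space_leb)
    also have "Rn n \<inter> Qn n = Qn n" using Qn_subset_Rn by auto
    finally show "emeasure ?M (space ?M) \<noteq> \<infinity>" by (simp add: space_leb_Qn emeasure_Qn)
  qed
  interpret finite_measure ?M by (rule fin)
  have "Z \<inter> Qn n \<in> null_sets ?M"
  proof (rule null_setsI)
    have "Z \<in> sets (leb n)" using Z by auto
    then show "Z \<inter> Qn n \<in> sets ?M" by (auto simp: sets_leb_Qn_iff intro!: sets_completionI_sets)
    have "emeasure (leb n) (Z \<inter> Qn n) \<le> emeasure (leb n) Z" using Z by (intro emeasure_mono) auto
    then show "emeasure ?M (Z \<inter> Qn n) = 0" using Z emeasure_leb_Qn[OF \<open>Z \<in> sets (leb n)\<close>]
      by (auto simp: null_sets_def)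
  qed
  then have AE: "AE x in ?M. x \<notin> Z \<inter> Qn n" by (rule AE_not_in)
  have le: "AE x in ?M. \<bar>h x\<bar> powr p \<le> indicat_real (Bad \<inter> Qn n) x"
    using AE
  proof (rule AE_mp, intro AE_I2 impI)
    fix x assume x: "x \<in> space ?M" "x \<notin> Z \<inter> Qn n"
    then have xQ: "x \<in> Qn n" by (simp add: space_leb_Qn)
    show "\<bar>h x\<bar> powr p \<le> indicat_real (Bad \<inter> Qn n) x"
    proof (cases "x \<in> Bad")
      case True
      then show ?thesis using h1[OF xQ] p xQ powr_mono2[of p "\<bar>h x\<bar>" 1] by simp
    next
      case False
      then show ?thesis using h0[OF xQ] x xQ p by simp
    qed
  qed
  have intB: "integrable ?M (indicat_real (Bad \<inter> Qn n))"
    using BM by (intro integrable_real_indicator) (auto simp: less_top[symmetric])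
  have mp: "(\<lambda>x. \<bar>h x\<bar> powr p) \<in> borel_measurable ?M" using h by measurable
  have int: "integrable ?M (\<lambda>x. \<bar>h x\<bar> powr p)"
    by (rule Bochner_Integration.integrable_bound[OF intB mp]) (use le in auto)
  have "(LINT x|?M. \<bar>h x\<bar> powr p) \<le> (LINT x|?M. indicat_real (Bad \<inter> Qn n) x)"
    using int intB le by (rule integral_mono_AE)
  also have "\<dots> = measure ?M (Bad \<inter> Qn n)" using BM by simp
  also have "\<dots> \<le> \<eta>"
    unfolding measure_def using emeasure_leb_Qn[OF Bad(1)] Bad(2) \<epsilon>
    by (intro enn2real_leI) auto
  finally have I: "(LINT x|?M. \<bar>h x\<bar> powr p) \<le> \<eta>" .
  have "(LINT x|?M. \<bar>h x\<bar> powr p) powr (1 / p) < (\<epsilon> powr p) powr (1 / p)"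
    using I \<epsilon> p by (intro powr_less_mono2) (auto intro!: integral_nonneg_AE)
  also have "\<dots> = \<epsilon>" using \<epsilon> p by (simp add: powr_powr)
  finally show ?thesis using h int by (simp add: Lp_norm_def)
qed

text \<open>
  Where a continuous function exceeds \<open>B\<close> it does so on a relatively open box, and a box that meets
  the closed cube \<open>Qn n\<close> intersects it in a product of nondegenerate intervals.
\<close>

lemma AE_leb_Qn_continuous_le:
  fixes D :: "(nat \<Rightarrow> real) \<Rightarrow> real"
  assumes D: "continuous_on (Rn n) D" and AE: "AE x in leb_Qn n. D x \<le> B" and x: "x \<in> Qn n"
  shows "D x \<le> B"
proof (rule ccontr)
  assume "\<not> D x \<le> B"
  have xR: "x \<in> Rn n" using x Qn_subset_Rn by auto
  have "open {B<..}" by simp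
  then obtain W where W: "open W" "W \<inter> Rn n = D -` {B<..} \<inter> Rn n"
    using D unfolding continuous_on_open_invariant by blast
  have "x \<in> W" using W(2) xR \<open>\<not> D x \<le> B\<close> by auto
  have "openin (product_topology (\<lambda>_. euclidean) UNIV) W"
    using W(1) by (simp add: open_fun_def)
  from product_topology_open_contains_basis[OF this \<open>x \<in> W\<close>]
  obtain X where X: "x \<in> (\<Pi>\<^sub>E i\<in>UNIV. X i)" "\<And>i. openin euclidean (X i)" "(\<Pi>\<^sub>E i\<in>UNIV. X i) \<subseteq> W"
    by metis
  have oX: "open (X i)" for i using X(2)[of i] by (simp only: open_openin)
  have sX: "X i \<inter> {-1/2..1/2} \<in> sets lborel" for i using oX[of i] by (auto intro: borel_open)
  define V where "V = (\<Pi>\<^sub>E i\<in>{..<n}. X i \<inter> {-1/2..1/2})"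
  have VQ: "V \<subseteq> Qn n" unfolding V_def Qn_def by auto
  have Vset: "V \<in> sets (leb n)"
    unfolding V_def using sX by (intro sets_PiM_I_finite) auto
  have "V \<subseteq> W"
  proof
    fix y assume y: "y \<in> V"
    have "y i \<in> X i" for i
    proof (cases "i < n")
      case True
      then show ?thesis using y unfolding V_def by auto
    next
      case False
      then have "y i = x i" using y xR unfolding V_def Rn_def by (auto simp: PiE_def extensional_def)
      then show ?thesis using X(1) by auto
    qed
    then show "y \<in> W" using X(3) by auto
  qed
  then have VB: "D y > B" if "y \<in> V" for y using that W(2) VQ Qn_subset_Rn by blast
  obtain N where N: "N \<in> null_sets (leb_Qn n)" "{x \<in> space (leb_Qn n). \<not> D x \<le> B} \<subseteq> N"
    using AE by (rule AE_E3) auto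
  have "V \<subseteq> N" using N(2) VB VQ by (fastforce simp: space_leb_Qn)
  then have "emeasure (leb_Qn n) V \<le> emeasure (leb_Qn n) N" using N by (intro emeasure_mono) auto
  then have V0: "emeasure (leb n) V = 0"
    using N(1) emeasure_leb_Qn[OF Vset] VQ by (auto simp: Int_absorb2 null_sets_def)
  have prod: "emeasure (leb n) V = (\<Prod>i<n. emeasure lborel (X i \<inter> {-1/2..1/2}))"
    unfolding V_def by (rule lborel_product.emeasure_PiM) (use sX in blast)+
  have nz: "emeasure lborel (X i \<inter> {-1/2..1/2}) \<noteq> 0" if "i < n" for i
  proof -
    have xi: "x i \<in> X i" "-1/2 \<le> x i" "x i \<le> 1/2" using X(1) x that by (auto simp: Qn_def PiE_def Pi_def)
    then obtain e where e: "e > 0" "\<And>y. \<bar>y - x i\<bar> < e \<Longrightarrow> y \<in> X i"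
      using xi(1) oX[of i] unfolding open_dist dist_real_def by blast
    define a where "a = max (-1/2) (x i - e)"
    define b where "b = min (1/2) (x i + e)"
    have ab: "a < b" using e(1) xi by (auto simp: a_def b_def max_def min_def)
    have "{a<..<b} \<subseteq> X i \<inter> {-1/2..1/2}"
    proof
      fix y assume "y \<in> {a<..<b}"
      then have "- 1 / 2 < y" "x i - e < y" "y < 1 / 2" "y < x i + e"
        unfolding a_def b_def by auto
      then have "\<bar>y - x i\<bar> < e" "y \<in> {-1/2..1/2}" by (auto simp: abs_less_iff)
      then show "y \<in> X i \<inter> {-1/2..1/2}" using e(2) by blast
    qed
    then have "emeasure lborel {a<..<b} \<le> emeasure lborel (X i \<inter> {-1/2..1/2})"
      using sX[of i] by (rule emeasure_mono)
    moreover have "0 < emeasure lborel {a<..<b}" using ab by simp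
    ultimately have "0 < emeasure lborel (X i \<inter> {-1/2..1/2})" by (rule order.strict_trans2[rotated])
    then show ?thesis by (rule order.strict_implies_not_eq[THEN not_sym])
  qed
  have "(\<Prod>i<n. emeasure lborel (X i \<inter> {-1/2..1/2})) \<noteq> 0"
    unfolding ennreal_prod_eq_0 using nz by blast
  then show False unfolding prod[symmetric] using V0 by (rule notE)
qed

lemma Linf_norm_continuous_bound:
  assumes D: "continuous_on (Rn n) D" and le: "Linf_norm (leb_Qn n) D \<le> ereal B" and x: "x \<in> Qn n"
  shows "\<bar>D x\<bar> \<le> B"
proof -
  have "AE x in leb_Qn n. ereal \<bar>D x\<bar> \<le> Linf_norm (leb_Qn n) D"
    unfolding Linf_norm_def by (rule esssup_AE[of "\<lambda>x. ereal \<bar>D x\<bar>"])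
  then have "AE x in leb_Qn n. \<bar>D x\<bar> \<le> B"
  proof (rule AE_mp, intro AE_I2 impI)
    fix y assume "ereal \<bar>D y\<bar> \<le> Linf_norm (leb_Qn n) D"
    then have "ereal \<bar>D y\<bar> \<le> ereal B" using le by (rule order_trans)
    then show "\<bar>D y\<bar> \<le> B" by simp
  qed
  moreover have "continuous_on (Rn n) (\<lambda>y. \<bar>D y\<bar>)" using D by (rule continuous_on_rabs)
  ultimately show ?thesis by (intro AE_leb_Qn_continuous_le[of n "\<lambda>y. \<bar>D y\<bar>" B x] x)
qed


section \<open>Taylor expansion by coordinates\<close>

lemma Cm_open_continuous: "Cm_open m n U F \<Longrightarrow> continuous_on U F"
  by (cases m) auto

lemma Cm_open_Suc_D: "Cm_open (Suc m) n U F \<Longrightarrow> Cm_open m n U F"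
proof (induction m arbitrary: F)
  case (Suc m)
  then show ?case using Cm_open.simps(2)[of "Suc m" n U F] Cm_open.simps(2)[of m n U F] by blast
qed simp

lemma Cm_open_antimono: "Cm_open m n U F \<Longrightarrow> m' \<le> m \<Longrightarrow> Cm_open m' n U F"
proof (induction m)
  case (Suc m)
  then show ?case using Cm_open_Suc_D[of m n U F] by (cases "m' = Suc m") auto
qed simp

lemma Cm_open_coord_deriv_power:
  "Cm_open m n U F \<Longrightarrow> j < n \<Longrightarrow> i \<le> m \<Longrightarrow> Cm_open (m - i) n U ((coord_deriv j ^^ i) F)"
proof (induction i)
  case (Suc i)
  then have "Cm_open (Suc (m - Suc i)) n U ((coord_deriv j ^^ i) F)"
    by (simp add: Suc_diff_Suc)
  then show ?case using Suc.prems by simp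
qed simp

text \<open>
  In \<open>multi_deriv\<close> the derivative in the last coordinate is taken last. Expanding one coordinate
  after the other, in increasing order, therefore meets only derivatives of this form, and the
  symmetry of mixed derivatives is never an issue.
\<close>

lemma multi_deriv_Suc:
  "multi_deriv (Suc j) \<alpha> F = (coord_deriv j ^^ \<alpha> j) (multi_deriv j \<alpha> F)"
  by (simp add: multi_deriv_def)

lemma multi_deriv_0 [simp]: "multi_deriv 0 \<alpha> F = F"
  by (simp add: multi_deriv_def)

lemma multi_deriv_cong:
  "(\<And>i. i < j \<Longrightarrow> \<alpha> i = \<beta> i) \<Longrightarrow> multi_deriv j \<alpha> F = multi_deriv j \<beta> F"
  by (induction j) (auto simp: multi_deriv_Suc)

lemma multi_deriv_tail:
  "j \<le> n \<Longrightarrow> (\<And>i. j \<le> i \<Longrightarrow> i < n \<Longrightarrow> \<alpha> i = 0) \<Longrightarrow> multi_deriv n \<alpha> F = multi_deriv j \<alpha> F"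
proof (induction n)
  case (Suc n)
  then show ?case by (cases "j = Suc n") (auto simp: multi_deriv_Suc)
qed simp

lemma Cm_open_multi_deriv:
  "Cm_open m n U F \<Longrightarrow> j \<le> n \<Longrightarrow> (\<Sum>i<j. \<alpha> i) \<le> m \<Longrightarrow>
   Cm_open (m - (\<Sum>i<j. \<alpha> i)) n U (multi_deriv j \<alpha> F)"
proof (induction j)
  case (Suc j)
  then have "Cm_open (m - (\<Sum>i<j. \<alpha> i)) n U (multi_deriv j \<alpha> F)" by auto
  from Cm_open_coord_deriv_power[OF this, of j "\<alpha> j"] Suc.prems
  show ?case by (simp add: multi_deriv_Suc)
qed simp

lemma multi_deriv_bound:
  assumes F: "Cm_open m n (Rn n) F" and norm: "Wm_inf_norm m n F \<le> ereal B"
    and \<alpha>: "(\<Sum>i<n. \<alpha> i) \<le> m" and x: "x \<in> Qn n"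
  shows "\<bar>multi_deriv n \<alpha> F x\<bar> \<le> B"
proof -
  let ?A = "{\<alpha> \<in> {..<n} \<rightarrow>\<^sub>E UNIV. sum \<alpha> {..<n} \<le> m}"
  have "?A \<subseteq> {..<n} \<rightarrow>\<^sub>E {..m}"
  proof safe
    fix \<alpha> i assume "sum \<alpha> {..<n} \<le> m" "i < n"
    then show "\<alpha> i \<le> m" using member_le_sum[of i "{..<n}" \<alpha>] by simp
  qed auto
  then have fin: "finite ?A" by (rule finite_subset) (auto intro: finite_PiE)
  define \<beta> where "\<beta> = restrict \<alpha> {..<n}"
  have \<beta>: "\<beta> \<in> ?A" using \<alpha> by (auto simp: \<beta>_def)
  have "Linf_norm (leb_Qn n) (multi_deriv n \<beta> F) \<le> Wm_inf_norm m n F"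
    unfolding Wm_inf_norm_def using fin \<beta> by (intro Max_ge) auto
  then have le: "Linf_norm (leb_Qn n) (multi_deriv n \<beta> F) \<le> ereal B" using norm by (rule order_trans)
  have eq: "multi_deriv n \<beta> F = multi_deriv n \<alpha> F"
    by (rule multi_deriv_cong) (simp add: \<beta>_def)
  have "continuous_on (Rn n) (multi_deriv n \<alpha> F)"
    using Cm_open_multi_deriv[OF F, of n \<alpha>] \<alpha> by (auto intro: Cm_open_continuous)
  from Linf_norm_continuous_bound[OF this le[unfolded eq] x] show ?thesis .
qed

lemma Qn_iff: "x \<in> Qn n \<longleftrightarrow> (\<forall>i<n. \<bar>x i\<bar> \<le> 1/2) \<and> (\<forall>i\<ge>n. x i = undefined)"
proof -
  have "\<bar>t\<bar> \<le> 1/2 \<longleftrightarrow> t \<in> {-1/2..1/2}" for t :: real by (simp only: abs_le_iff atLeastAtMost_iff) linarith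
  then show ?thesis by (auto simp: Qn_def PiE_def extensional_def Pi_def)
qed

lemma Rn_upd: "z \<in> Rn n \<Longrightarrow> c < n \<Longrightarrow> z(c := t) \<in> Rn n"
  by (auto simp: Rn_def PiE_def extensional_def)

lemma taylor_coord:
  assumes G: "Cm_open s n (Rn n) G" and c: "c < n" and z: "z \<in> Rn n" and s: "s \<ge> 1"
    and u: "\<bar>u\<bar> \<le> 1/2" and v: "\<bar>v\<bar> \<le> 1/2"
    and bound: "\<And>t. \<bar>t\<bar> \<le> 1/2 \<Longrightarrow> \<bar>(coord_deriv c ^^ s) G (z(c := t))\<bar> \<le> B"
  shows "\<bar>G (z(c := v)) - (\<Sum>i<s. (coord_deriv c ^^ i) G (z(c := u)) * ((v - u) ^ i / fact i))\<bar> \<le> B * \<bar>v - u\<bar> ^ s"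
proof (cases "u = v")
  case True
  have "(\<Sum>i<s. (coord_deriv c ^^ i) G (z(c := u)) * ((v - u) ^ i / fact i)) =
      (\<Sum>i<s. if i = 0 then G (z(c := u)) else 0)"
    using True by (intro sum.cong) (auto simp: power_0_left)
  also have "\<dots> = G (z(c := u))" using s by (simp add: sum.delta)
  finally have "G (z(c := v)) - (\<Sum>i<s. (coord_deriv c ^^ i) G (z(c := u)) * ((v - u) ^ i / fact i)) = 0"
    using True by simp
  moreover have "0 \<le> B" using bound[of 0] by simp
  ultimately show ?thesis by simp
next
  case False
  define diff where "diff i t = (coord_deriv c ^^ i) G (z(c := t))" for i t
  have D: "DERIV (diff i) t :> diff (Suc i) t" if "i < s" for i t
  proof -
    have "Cm_open (Suc (s - Suc i)) n (Rn n) ((coord_deriv c ^^ i) G)"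
      using Cm_open_coord_deriv_power[OF G c, of i] that by (simp add: Suc_diff_Suc)
    then have "\<forall>x\<in>Rn n. (\<lambda>u. (coord_deriv c ^^ i) G (x(c := u))) field_differentiable at (x c)"
      using c by simp
    from bspec[OF this Rn_upd[OF z c, of t]]
    have "(\<lambda>u. (coord_deriv c ^^ i) G (z(c := u))) field_differentiable at t" by simp
    then have "DERIV (\<lambda>u. (coord_deriv c ^^ i) G (z(c := u))) t :> deriv (\<lambda>u. (coord_deriv c ^^ i) G (z(c := u))) t"
      by (simp add: DERIV_deriv_iff_field_differentiable)
    then show ?thesis by (simp add: diff_def[abs_def] coord_deriv_def)
  qed
  have "\<exists>t. (if v < u then v < t \<and> t < u else u < t \<and> t < v) \<and>
     diff 0 v = (\<Sum>i<s. diff i u / fact i * (v - u) ^ i) + diff s t / fact s * (v - u) ^ s"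
    using s u v False D by (intro Taylor[where a = "-1/2" and b = "1/2"]) auto
  then obtain t where t: "if v < u then v < t \<and> t < u else u < t \<and> t < v"
    "diff 0 v = (\<Sum>i<s. diff i u / fact i * (v - u) ^ i) + diff s t / fact s * (v - u) ^ s" by blast
  have "\<bar>t\<bar> \<le> 1/2" using t(1) u v by (auto split: if_splits)
  then have B: "\<bar>diff s t\<bar> \<le> B" using bound by (simp add: diff_def)
  have "\<bar>diff s t / fact s\<bar> \<le> \<bar>diff s t\<bar>"
    by (simp add: divide_le_eq mult_right_le_one_le fact_ge_1 mult_le_cancel_left1)
  then have "\<bar>diff s t / fact s * (v - u) ^ s\<bar> \<le> B * \<bar>v - u\<bar> ^ s"
    unfolding abs_mult power_abs using B by (intro mult_right_mono) auto
  moreover have "G (z(c := v)) - (\<Sum>i<s. (coord_deriv c ^^ i) G (z(c := u)) * ((v - u) ^ i / fact i)) =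
     diff s t / fact s * (v - u) ^ s"
    using t(2) by (simp add: diff_def)
  ultimately show ?thesis by simp
qed

text \<open>
  Multi-indices of order below \<open>q\<close> supported on the \<open>j\<close> coordinates from \<open>k\<close> on.
\<close>

definition multi_indices :: "nat \<Rightarrow> nat \<Rightarrow> nat \<Rightarrow> (nat \<Rightarrow> nat) set" where
  "multi_indices k j q = {\<alpha>. (\<forall>i. \<alpha> i \<noteq> 0 \<longrightarrow> k \<le> i \<and> i < k + j) \<and> (\<Sum>i<k + j. \<alpha> i) < q}"

lemma multi_indices_0: "q \<ge> 1 \<Longrightarrow> multi_indices k 0 q = {\<lambda>_. 0}"
  by (auto simp: multi_indices_def fun_eq_iff) (metis leD neq0_conv)

text \<open>
  Splitting off the exponent of the last coordinate; this is the combinatorial part of the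
  induction step in \<open>multivariate_taylor\<close>.
\<close>

lemma multi_indices_Suc:
  "bij_betw (\<lambda>(\<alpha>, i). \<alpha>(k + j := i)) (SIGMA \<alpha>:multi_indices k j q. {..<q - (\<Sum>i<k + j. \<alpha> i)})
     (multi_indices k (Suc j) q)"
proof (rule bij_betw_byWitness[where f' = "\<lambda>\<beta>. (\<beta>(k + j := 0), \<beta> (k + j))"])
  have zero: "\<alpha> (k + j) = 0" if "\<alpha> \<in> multi_indices k j q" for \<alpha>
    using that by (auto simp: multi_indices_def)
  have sum_upd: "(\<Sum>i<k + j. (\<alpha>(k + j := c)) i) = (\<Sum>i<k + j. \<alpha> i)" for \<alpha> :: "nat \<Rightarrow> nat" and c
    by (rule sum.cong) auto
  show "\<forall>a\<in>SIGMA \<alpha>:multi_indices k j q. {..<q - (\<Sum>i<k + j. \<alpha> i)}.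
       (\<lambda>\<beta>. (\<beta>(k + j := 0), \<beta> (k + j))) ((\<lambda>(\<alpha>, i). \<alpha>(k + j := i)) a) = a"
    using zero by (auto simp: fun_eq_iff)
  show "\<forall>\<beta>\<in>multi_indices k (Suc j) q.
       (\<lambda>(\<alpha>, i). \<alpha>(k + j := i)) ((\<lambda>\<beta>. (\<beta>(k + j := 0), \<beta> (k + j))) \<beta>) = \<beta>" by auto
  show "(\<lambda>(\<alpha>, i). \<alpha>(k + j := i)) ` (SIGMA \<alpha>:multi_indices k j q. {..<q - (\<Sum>i<k + j. \<alpha> i)})
      \<subseteq> multi_indices k (Suc j) q"
  proof (rule image_subsetI, clarify)
    fix \<alpha> i assume a: "\<alpha> \<in> multi_indices k j q" "i < q - (\<Sum>i<k + j. \<alpha> i)"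
    have "(\<Sum>i'<k + Suc j. (\<alpha>(k + j := i)) i') = (\<Sum>i<k + j. \<alpha> i) + i" using sum_upd by simp
    then show "\<alpha>(k + j := i) \<in> multi_indices k (Suc j) q"
      using a by (auto simp: multi_indices_def less_Suc_eq)
  qed
  show "(\<lambda>\<beta>. (\<beta>(k + j := 0), \<beta> (k + j))) ` multi_indices k (Suc j) q
     \<subseteq> (SIGMA \<alpha>:multi_indices k j q. {..<q - (\<Sum>i<k + j. \<alpha> i)})"
  proof (rule image_subsetI)
    fix \<beta> assume b: "\<beta> \<in> multi_indices k (Suc j) q"
    then have "(\<Sum>i<k + j. \<beta> i) + \<beta> (k + j) < q" by (simp add: multi_indices_def)
    then show "(\<beta>(k + j := 0), \<beta> (k + j)) \<in> (SIGMA \<alpha>:multi_indices k j q. {..<q - (\<Sum>i<k + j. \<alpha> i)})"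
      using b sum_upd[of \<beta> 0] by (auto simp: multi_indices_def less_Suc_eq)
  qed
qed

lemma multi_indices_card:
  assumes "q \<ge> 1"
  shows "finite (multi_indices k j q) \<and> card (multi_indices k j q) \<le> q ^ j"
proof (induction j)
  case 0
  then show ?case using assms by (simp add: multi_indices_0)
next
  case (Suc j)
  let ?S = "SIGMA \<alpha>:multi_indices k j q. {..<q - (\<Sum>i<k + j. \<alpha> i)}"
  have "card ?S = (\<Sum>\<alpha>\<in>multi_indices k j q. q - (\<Sum>i<k + j. \<alpha> i))" using Suc by simp
  also have "\<dots> \<le> (\<Sum>\<alpha>\<in>multi_indices k j q. q)" by (intro sum_mono) simp
  also have "\<dots> \<le> q ^ Suc j" using Suc by (simp add: mult.commute)
  finally have "card ?S \<le> q ^ Suc j" .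
  moreover have "finite ?S" using Suc by simp
  ultimately show ?case using multi_indices_Suc[of k j q]
    by (metis bij_betw_finite bij_betw_same_card)
qed

text \<open>
  Move from \<open>x\<close> to \<open>x0\<close> one coordinate at a time. In a step, each of the at most \<open>q ^ d\<close> terms
  already present is a derivative of some order \<open>r < q\<close> times a monomial of degree \<open>r\<close>; expanding it
  to order \<open>q - r\<close> in the next coordinate costs an error \<open>B * h ^ (q - r) * h ^ r\<close>. The first \<open>k\<close>
  coordinates, in which \<open>x\<close> and \<open>x0\<close> agree, contribute nothing, so the bound is uniform in \<open>k\<close>.
\<close>

lemma multivariate_taylor:
  assumes F: "Cm_open m (k + d) (Rn (k + d)) F" and q: "1 \<le> q" "q \<le> m"
    and bound: "\<And>\<alpha> x. (\<Sum>i<k + d. \<alpha> i) \<le> m \<Longrightarrow> x \<in> Qn (k + d) \<Longrightarrow> \<bar>multi_deriv (k + d) \<alpha> F x\<bar> \<le> B"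
    and x: "x \<in> Qn (k + d)" and x0: "x0 \<in> Qn (k + d)"
    and eq: "\<And>i. i < k \<Longrightarrow> x i = x0 i" and h: "\<And>i. i < k + d \<Longrightarrow> \<bar>x i - x0 i\<bar> \<le> h" "0 \<le> h"
  shows "\<bar>F x - (\<Sum>\<alpha>\<in>multi_indices k d q. multi_deriv (k + d) \<alpha> F x0 *
           (\<Prod>i<k + d. (x i - x0 i) ^ \<alpha> i / fact (\<alpha> i)))\<bar> \<le> real (d * q ^ d) * B * h ^ q"
proof -
  have B: "0 \<le> B" using bound[of "\<lambda>_. 0" x] x by force
  \<comment> \<open>\<open>mix j\<close> has the first \<open>k + j\<close> coordinates of \<open>x0\<close> and the others of \<open>x\<close>\<close>
  define mix where "mix j i = (if i < k + j then x0 i else x i)" for j i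
  define mono where "mono j \<alpha> = (\<Prod>i<k + j. (x i - x0 i) ^ \<alpha> i / fact (\<alpha> i))" for j and \<alpha> :: "nat \<Rightarrow> nat"
  define T where "T j = (\<Sum>\<alpha>\<in>multi_indices k j q. multi_deriv (k + j) \<alpha> F (mix j) * mono j \<alpha>)" for j
  have mixQ: "mix j \<in> Qn (k + d)" for j
    using x x0 by (auto simp: Qn_iff mix_def)
  have mixR: "mix j \<in> Rn (k + d)" for j using mixQ Qn_subset_Rn by blast
  have step: "\<bar>T j - T (Suc j)\<bar> \<le> real (q ^ d) * B * h ^ q" if j: "j < d" for j
  proof -
    let ?c = "k + j"
    let ?I = "multi_indices k j q"
    let ?s = "\<lambda>\<alpha>. q - (\<Sum>i<k + j. \<alpha> i)"
    define G where "G \<alpha> = multi_deriv ?c \<alpha> F" for \<alpha>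
    define rest where "rest \<alpha> = G \<alpha> (mix j) - (\<Sum>i<?s \<alpha>.
        (coord_deriv ?c ^^ i) (G \<alpha>) (mix (Suc j)) * ((x ?c - x0 ?c) ^ i / fact i))" for \<alpha>
    have mix_c: "mix j = (mix j)(?c := x ?c)" "mix (Suc j) = (mix j)(?c := x0 ?c)"
      by (auto simp: mix_def fun_eq_iff)
    have xc: "\<bar>x ?c\<bar> \<le> 1/2" "\<bar>x0 ?c\<bar> \<le> 1/2"
      using x x0 j by (simp_all add: Qn_iff)
    have md: "multi_deriv (k + Suc j) (\<alpha>(?c := i)) F = (coord_deriv ?c ^^ i) (G \<alpha>)" for \<alpha> i
      unfolding G_def using multi_deriv_cong[of ?c "\<alpha>(?c := i)" \<alpha> F] by (simp add: multi_deriv_Suc)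
    have mo: "mono (Suc j) (\<alpha>(?c := i)) = mono j \<alpha> * ((x ?c - x0 ?c) ^ i / fact i)" for \<alpha> i
    proof -
      have "mono j (\<alpha>(?c := i)) = mono j \<alpha>" unfolding mono_def by (intro prod.cong) auto
      then show ?thesis by (simp add: mono_def)
    qed
    have "T (Suc j) = (\<Sum>(\<alpha>, i)\<in>(SIGMA \<alpha>:?I. {..<?s \<alpha>}).
        multi_deriv (k + Suc j) (\<alpha>(?c := i)) F (mix (Suc j)) * mono (Suc j) (\<alpha>(?c := i)))"
      unfolding T_def sum.reindex_bij_betw[OF multi_indices_Suc, symmetric]
      by (simp add: case_prod_unfold)
    also have "\<dots> = (\<Sum>\<alpha>\<in>?I. \<Sum>i<?s \<alpha>.
        multi_deriv (k + Suc j) (\<alpha>(?c := i)) F (mix (Suc j)) * mono (Suc j) (\<alpha>(?c := i)))"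
      using multi_indices_card[OF q(1), of k j] by (subst sum.Sigma) auto
    also have "\<dots> = (\<Sum>\<alpha>\<in>?I. mono j \<alpha> * (\<Sum>i<?s \<alpha>.
        (coord_deriv ?c ^^ i) (G \<alpha>) (mix (Suc j)) * ((x ?c - x0 ?c) ^ i / fact i)))"
      unfolding md mo by (simp add: sum_distrib_left mult_ac)
    finally have diff: "T j - T (Suc j) = (\<Sum>\<alpha>\<in>?I. mono j \<alpha> * rest \<alpha>)"
      by (simp add: T_def G_def rest_def sum_subtractf[symmetric] algebra_simps)
    have tm: "\<bar>mono j \<alpha> * rest \<alpha>\<bar> \<le> B * h ^ q"
      if \<alpha>: "\<alpha> \<in> ?I" for \<alpha>
    proof -
      have sum\<alpha>: "(\<Sum>i<?c. \<alpha> i) < q" using \<alpha> by (simp add: multi_indices_def)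
      have "Cm_open (m - (\<Sum>i<?c. \<alpha> i)) (k + d) (Rn (k + d)) (G \<alpha>)"
        unfolding G_def using Cm_open_multi_deriv[OF F, of ?c \<alpha>] j sum\<alpha> q by simp
      then have G: "Cm_open (?s \<alpha>) (k + d) (Rn (k + d)) (G \<alpha>)"
        using q by (elim Cm_open_antimono) simp
      have bd: "\<bar>(coord_deriv ?c ^^ ?s \<alpha>) (G \<alpha>) ((mix j)(?c := t))\<bar> \<le> B" if t: "\<bar>t\<bar> \<le> 1/2" for t
      proof -
        let ?\<beta> = "\<alpha>(?c := ?s \<alpha>)"
        have tail: "?\<beta> i = 0" if "k + Suc j \<le> i" for i using \<alpha> that by (auto simp: multi_indices_def)
        have 1: "multi_deriv (k + d) ?\<beta> F = multi_deriv (k + Suc j) ?\<beta> F"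
          using j tail by (intro multi_deriv_tail) auto
        have "(\<Sum>i<k + d. ?\<beta> i) = (\<Sum>i<k + Suc j. ?\<beta> i)"
          using j tail by (intro sum.mono_neutral_right) auto
        also have "\<dots> = (\<Sum>i<k + j. ?\<beta> i) + ?s \<alpha>" by simp
        also have "(\<Sum>i<k + j. ?\<beta> i) = (\<Sum>i<k + j. \<alpha> i)" by (intro sum.cong) auto
        finally have "(\<Sum>i<k + d. ?\<beta> i) \<le> m" using sum\<alpha> q by simp
        moreover have "(mix j)(?c := t) \<in> Qn (k + d)"
          using mixQ[of j] t j by (auto simp: Qn_iff)
        ultimately show ?thesis using bound[of ?\<beta> "(mix j)(?c := t)"] unfolding 1 md by simp
      qed
      have T: "\<bar>rest \<alpha>\<bar> \<le> B * \<bar>x ?c - x0 ?c\<bar> ^ ?s \<alpha>"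
        unfolding rest_def using taylor_coord[OF G _ mixR[of j] _ xc(2,1) bd] sum\<alpha> j
        by (subst (1) mix_c(1), subst mix_c(2)) simp
      also have "\<dots> \<le> B * h ^ ?s \<alpha>" using h(1)[of ?c] j B by (intro mult_left_mono power_mono) auto
      finally have T: "\<bar>rest \<alpha>\<bar> \<le> B * h ^ ?s \<alpha>" .
      have "\<bar>mono j \<alpha>\<bar> = (\<Prod>i<?c. \<bar>x i - x0 i\<bar> ^ \<alpha> i / fact (\<alpha> i))"
        unfolding mono_def abs_prod by (simp add: power_abs)
      also have "\<dots> \<le> (\<Prod>i<?c. h ^ \<alpha> i)"
      proof (intro prod_mono conjI)
        fix i assume "i \<in> {..<?c}"
        then have "\<bar>x i - x0 i\<bar> ^ \<alpha> i \<le> h ^ \<alpha> i" using h j by (intro power_mono) auto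
        moreover have "\<bar>x i - x0 i\<bar> ^ \<alpha> i / fact (\<alpha> i) \<le> \<bar>x i - x0 i\<bar> ^ \<alpha> i"
          by (simp add: divide_le_eq mult_le_cancel_left1 fact_ge_1)
        ultimately show "\<bar>x i - x0 i\<bar> ^ \<alpha> i / fact (\<alpha> i) \<le> h ^ \<alpha> i" by linarith
      qed simp
      also have "\<dots> = h ^ (\<Sum>i<?c. \<alpha> i)" by (simp add: power_sum)
      finally have M: "\<bar>mono j \<alpha>\<bar> \<le> h ^ (\<Sum>i<?c. \<alpha> i)" .
      have "\<bar>mono j \<alpha>\<bar> * \<bar>rest \<alpha>\<bar> \<le> h ^ (\<Sum>i<?c. \<alpha> i) * (B * h ^ ?s \<alpha>)"
        using M T h(2) by (intro mult_mono) auto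
      also have "\<dots> = B * h ^ q" using sum\<alpha> by (simp add: power_add[symmetric])
      finally show ?thesis by (simp add: abs_mult)
    qed
    have "\<bar>T j - T (Suc j)\<bar> \<le> (\<Sum>\<alpha>\<in>?I. B * h ^ q)"
      unfolding diff by (rule order_trans[OF sum_abs sum_mono[OF tm]])
    also have "\<dots> = real (card ?I) * (B * h ^ q)" by simp
    also have "\<dots> \<le> real (q ^ d) * (B * h ^ q)"
    proof (intro mult_right_mono)
      have "card ?I \<le> q ^ j" using multi_indices_card[OF q(1)] by blast
      also have "\<dots> \<le> q ^ d" using j q by (intro power_increasing) auto
      finally show "real (card ?I) \<le> real (q ^ d)" by (simp only: of_nat_le_iff)
    qed (use B h in auto)
    finally show ?thesis by (simp add: mult.assoc)
  qed
  have claim: "j \<le> d \<Longrightarrow> \<bar>F x - T j\<bar> \<le> real j * (real (q ^ d) * B * h ^ q)" for j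
  proof (induction j)
    case 0
    have "mix 0 = x" using eq by (auto simp: mix_def fun_eq_iff)
    moreover have "multi_deriv k (\<lambda>_. 0) F = F"
      using multi_deriv_tail[of 0 k "\<lambda>_. 0" F] by simp
    ultimately have "T 0 = F x" by (simp add: T_def multi_indices_0[OF q(1)] mono_def)
    then show ?case by simp
  next
    case (Suc j)
    then have "\<bar>F x - T j\<bar> \<le> real j * (real (q ^ d) * B * h ^ q)" by simp
    with step[of j] Suc.prems show ?case by (simp add: distrib_right)
  qed
  have "mix d = x0" using x x0 by (auto simp: mix_def fun_eq_iff Qn_iff)
  with claim[of d] show ?thesis by (simp add: T_def mono_def mult.assoc)
qed

definition cube :: "nat \<Rightarrow> (nat \<Rightarrow> real) set" where
  "cube d = {y. \<forall>i<d. \<bar>y i\<bar> \<le> 1/2}"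

text \<open>
  A polynomial is a list of monomials, each a coefficient with a word listing the variables with
  multiplicity; the product over a word is what is later expanded into digits.
\<close>

type_synonym local_poly = "(real \<times> nat list) list"

definition poly_at :: "local_poly \<Rightarrow> (nat \<Rightarrow> real) \<Rightarrow> real" where
  "poly_at ts u = (\<Sum>(c, w)\<leftarrow>ts. c * prod_list (map u w))"

definition poly_bounded :: "nat \<Rightarrow> nat \<Rightarrow> real \<Rightarrow> local_poly \<Rightarrow> bool" where
  "poly_bounded d m C ts \<longleftrightarrow> real (length ts) \<le> C \<and>
     (\<forall>(c, w)\<in>set ts. \<bar>c\<bar> \<le> C \<and> length w < m \<and> set w \<subseteq> {..<d})"

text \<open>
  The only consequences of smoothness that the construction uses: Taylor approximation of order \<open>m\<close>
  at every point of the cube with uniformly bounded data, and a Lipschitz bound.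
\<close>

definition locally_poly :: "nat \<Rightarrow> nat \<Rightarrow> real \<Rightarrow> ((nat \<Rightarrow> real) \<Rightarrow> real) \<Rightarrow> bool" where
  "locally_poly d m C G \<longleftrightarrow>
     (\<forall>y0\<in>cube d. \<exists>ts. poly_bounded d m C ts \<and>
        (\<forall>y\<in>cube d. \<forall>h\<ge>0. (\<forall>i<d. \<bar>y i - y0 i\<bar> \<le> h) \<longrightarrow>
           \<bar>G y - poly_at ts (\<lambda>i. y i - y0 i)\<bar> \<le> C * h ^ m)) \<and>
     (\<forall>y0\<in>cube d. \<forall>y\<in>cube d. \<forall>h\<ge>0. (\<forall>i<d. \<bar>y i - y0 i\<bar> \<le> h) \<longrightarrow> \<bar>G y - G y0\<bar> \<le> C * h)"

text \<open>
  The Lipschitz bound is \<open>multivariate_taylor\<close> of order 1. The constant dominates the number of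
  monomials, their coefficients and both error bounds, and does not depend on \<open>k\<close> or \<open>a\<close>.
\<close>

lemma locally_poly_slice:
  assumes F: "Cm_open m (k + d) (Rn (k + d)) F" and m: "m \<ge> 1"
    and norm: "Wm_inf_norm m (k + d) F \<le> ereal B"
    and a: "a \<in> Qn k" and d: "d < n"
  shows "locally_poly d m (real (n * m ^ n) * (B + 1)) (\<lambda>y. F (append_pt k d a y))"
proof -
  let ?D = "k + d"
  let ?C = "real (n * m ^ n) * (B + 1)"
  let ?p = "append_pt k d a"
  have bound: "\<bar>multi_deriv ?D \<alpha> F x\<bar> \<le> B" if "(\<Sum>i<?D. \<alpha> i) \<le> m" "x \<in> Qn ?D" for \<alpha> x
    using multi_deriv_bound[OF F norm that] .
  have pQ: "?p y \<in> Qn ?D" if "y \<in> cube d" for y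
    using that a by (auto simp: append_pt_def Qn_iff cube_def)
  have B: "0 \<le> B" using bound[of "\<lambda>_. 0" "?p (\<lambda>_. 0)"] pQ[of "\<lambda>_. 0"] by (force simp: cube_def)
  have p1: "?p y i - ?p y0 i = 0" if "i < k" for y y0 i using that by (simp add: append_pt_def)
  have p2: "?p y (k + i) - ?p y0 (k + i) = y i - y0 i" if "i < d" for y y0 i
    using that by (simp add: append_pt_def)
  have le: "\<bar>?p y i - ?p y0 i\<bar> \<le> h" if yh: "\<forall>i<d. \<bar>y i - y0 i\<bar> \<le> h" "0 \<le> h" "i < ?D" for y y0 h i
  proof (cases "i < k")
    case True
    then show ?thesis using p1[of i y y0] yh(2) by simp
  next
    case False
    then obtain j where "i = k + j" "j < d" using yh(3) by (metis add_diff_inverse_nat nat_add_left_cancel_less)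
    then show ?thesis using p2[of j y y0] yh(1) by simp
  qed
  have pow: "real (d * q ^ d) \<le> real (n * m ^ n)" if "1 \<le> q" "q \<le> m" for q
  proof -
    have "q ^ d \<le> m ^ d" using that by (intro power_mono) auto
    also have "\<dots> \<le> m ^ n" using m d by (intro power_increasing) auto
    finally have "d * q ^ d \<le> n * m ^ n" using d by (intro mult_le_mono) auto
    then show ?thesis by (simp only: of_nat_le_iff)
  qed
  have CB: "real (d * q ^ d) * B * t \<le> ?C * t" if "1 \<le> q" "q \<le> m" "0 \<le> t" for q t
  proof -
    have "real (d * q ^ d) * B \<le> real (n * m ^ n) * (B + 1)"
      using pow[OF that(1,2)] B by (intro mult_mono) auto
    then show ?thesis using that(3) by (rule mult_right_mono)
  qed
  have "1 \<le> n * m ^ n" using d m by (simp add: Suc_le_eq)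
  then have nm: "1 \<le> real (n * m ^ n)" by (simp only: of_nat_le_iff[of 1, simplified])
  then have CB1: "B \<le> ?C" using B mult_mono[of 1 "real (n * m ^ n)" B "B + 1"] by simp
  have prod_split: "(\<Prod>i<k + d. f i) = (\<Prod>i<d. f (k + i))" if "\<And>i. i < k \<Longrightarrow> f i = 1" for f :: "nat \<Rightarrow> real"
    using that by (induction d) auto
  have sum_split: "(\<Sum>i<k + d. f i) = (\<Sum>i<d. f (k + i))" if "\<And>i. i < k \<Longrightarrow> f i = 0" for f :: "nat \<Rightarrow> nat"
    using that by (induction d) auto
  have taylor: "\<exists>ts. poly_bounded d m ?C ts \<and>
        (\<forall>y\<in>cube d. \<forall>h\<ge>0. (\<forall>i<d. \<bar>y i - y0 i\<bar> \<le> h) \<longrightarrow>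
           \<bar>F (?p y) - poly_at ts (\<lambda>i. y i - y0 i)\<bar> \<le> ?C * h ^ m)" if y0: "y0 \<in> cube d" for y0
  proof -
    let ?I = "multi_indices k d m"
    obtain xs where xs: "set xs = ?I" "distinct xs"
      using multi_indices_card[OF m, of k d] finite_distinct_list by blast
    define w where "w \<alpha> = concat (map (\<lambda>i. replicate (\<alpha> (k + i)) i) [0..<d])" for \<alpha> :: "nat \<Rightarrow> nat"
    define c where "c \<alpha> = multi_deriv ?D \<alpha> F (?p y0) / (\<Prod>i<?D. fact (\<alpha> i))" for \<alpha> :: "nat \<Rightarrow> nat"
    define ts where "ts = map (\<lambda>\<alpha>. (c \<alpha>, w \<alpha>)) xs"
    have "length ts = card ?I" using xs distinct_card[of xs] by (simp add: ts_def)
    also have "\<dots> \<le> m ^ d" using multi_indices_card[OF m] by blast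
    also have "\<dots> \<le> m ^ n" using m d by (intro power_increasing) auto
    also have "\<dots> \<le> n * m ^ n" using d by simp
    finally have "real (length ts) \<le> real (n * m ^ n)" by (simp only: of_nat_le_iff)
    also have "\<dots> \<le> ?C" using B nm by (simp add: mult_le_cancel_left1)
    finally have len: "real (length ts) \<le> ?C" .
    have I0: "\<alpha> i = 0" if "\<alpha> \<in> ?I" "i < k" for \<alpha> i using that by (auto simp: multi_indices_def)
    have "\<bar>c \<alpha>\<bar> \<le> ?C \<and> length (w \<alpha>) < m \<and> set (w \<alpha>) \<subseteq> {..<d}" if \<alpha>: "\<alpha> \<in> ?I" for \<alpha>
    proof (intro conjI)
      have s: "(\<Sum>i<?D. \<alpha> i) < m" using \<alpha> by (simp add: multi_indices_def)
      then have 1: "\<bar>multi_deriv ?D \<alpha> F (?p y0)\<bar> \<le> B" using pQ[OF y0] by (intro bound) auto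
      have "1 \<le> (\<Prod>i<?D. fact (\<alpha> i) :: real)" by (intro prod_ge_1) (simp add: fact_ge_1)
      then have "\<bar>c \<alpha>\<bar> \<le> \<bar>multi_deriv ?D \<alpha> F (?p y0)\<bar>"
        by (simp add: c_def divide_le_eq mult_le_cancel_left1)
      then show "\<bar>c \<alpha>\<bar> \<le> ?C" using 1 CB1 by linarith
      have "length (w \<alpha>) = (\<Sum>i<d. \<alpha> (k + i))"
        by (simp add: w_def length_concat comp_def interv_sum_list_conv_sum_set_nat atLeast0LessThan)
      also have "\<dots> = (\<Sum>i<?D. \<alpha> i)" using I0[OF \<alpha>] by (subst sum_split) auto
      finally show "length (w \<alpha>) < m" using s by simp
      show "set (w \<alpha>) \<subseteq> {..<d}" by (auto simp: w_def)
    qed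
    then have bdd: "poly_bounded d m ?C ts" using len xs by (auto simp: poly_bounded_def ts_def)
    have poly: "poly_at ts (\<lambda>i. y i - y0 i) = (\<Sum>\<alpha>\<in>?I. multi_deriv ?D \<alpha> F (?p y0) *
           (\<Prod>i<?D. (?p y i - ?p y0 i) ^ \<alpha> i / fact (\<alpha> i)))" for y
    proof -
      have "poly_at ts (\<lambda>i. y i - y0 i) = (\<Sum>\<alpha>\<in>?I. c \<alpha> * prod_list (map (\<lambda>i. y i - y0 i) (w \<alpha>)))"
        using xs by (simp add: poly_at_def ts_def comp_def sum_list_distinct_conv_sum_set)
      also have "\<dots> = (\<Sum>\<alpha>\<in>?I. multi_deriv ?D \<alpha> F (?p y0) *
           (\<Prod>i<?D. (?p y i - ?p y0 i) ^ \<alpha> i / fact (\<alpha> i)))"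
      proof (rule sum.cong[OF refl])
        fix \<alpha> assume \<alpha>: "\<alpha> \<in> ?I"
        have "prod_list (map u (concat (map (\<lambda>i. replicate (\<alpha> (k + i)) i) [0..<d]))) = (\<Prod>i<d. u i ^ \<alpha> (k + i))" for u :: "nat \<Rightarrow> real"
          by (induction d) (auto simp: prod_list_replicate)
        then have "prod_list (map (\<lambda>i. y i - y0 i) (w \<alpha>)) = (\<Prod>i<d. (y i - y0 i) ^ \<alpha> (k + i))"
          by (simp add: w_def)
        also have "\<dots> = (\<Prod>i<d. (?p y (k + i) - ?p y0 (k + i)) ^ \<alpha> (k + i))"
          by (intro prod.cong) (simp_all add: p2)
        also have "\<dots> = (\<Prod>i<?D. (?p y i - ?p y0 i) ^ \<alpha> i)"
          using I0[OF \<alpha>] by (subst prod_split) auto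
        finally show "c \<alpha> * prod_list (map (\<lambda>i. y i - y0 i) (w \<alpha>)) = multi_deriv ?D \<alpha> F (?p y0) *
           (\<Prod>i<?D. (?p y i - ?p y0 i) ^ \<alpha> i / fact (\<alpha> i))"
          by (simp add: c_def prod_dividef)
      qed
      finally show ?thesis .
    qed
    show ?thesis
    proof (intro exI[of _ ts] conjI ballI allI impI bdd)
      fix y h assume y: "y \<in> cube d" and h: "0 \<le> (h::real)" "\<forall>i<d. \<bar>y i - y0 i\<bar> \<le> h"
      have "\<bar>F (?p y) - poly_at ts (\<lambda>i. y i - y0 i)\<bar> \<le> real (d * m ^ d) * B * h ^ m"
        unfolding poly using p1 le[OF h(2,1)] h(1)
        by (intro multivariate_taylor[OF F m order_refl bound pQ[OF y] pQ[OF y0]]) auto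
      also have "\<dots> \<le> ?C * h ^ m" using m h by (intro CB) auto
      finally show "\<bar>F (?p y) - poly_at ts (\<lambda>i. y i - y0 i)\<bar> \<le> ?C * h ^ m" .
    qed
  qed
  have "\<bar>F (?p y) - F (?p y0)\<bar> \<le> ?C * h"
    if "y0 \<in> cube d" "y \<in> cube d" "0 \<le> h" "\<forall>i<d. \<bar>y i - y0 i\<bar> \<le> h" for y y0 h
  proof -
    have I1: "multi_indices k d 1 = {\<lambda>_. 0}" by (auto simp: multi_indices_def fun_eq_iff)
    have md: "multi_deriv (k + d) (\<lambda>_. 0) F = F" using multi_deriv_tail[of 0 "k + d" "\<lambda>_. 0" F] by simp
    have "\<bar>F (?p y) - (\<Sum>\<alpha>\<in>multi_indices k d 1. multi_deriv ?D \<alpha> F (?p y0) *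
           (\<Prod>i<?D. (?p y i - ?p y0 i) ^ \<alpha> i / fact (\<alpha> i)))\<bar> \<le> real (d * 1 ^ d) * B * h ^ 1"
      using p1 le[OF that(4,3)] that(3) m
      by (intro multivariate_taylor[OF F _ _ bound pQ[OF that(2)] pQ[OF that(1)]]) auto
    then have "\<bar>F (?p y) - F (?p y0)\<bar> \<le> real (d * 1 ^ d) * B * h" unfolding I1 by (simp add: md)
    also have "\<dots> \<le> ?C * h" using m that by (intro CB) auto
    finally show ?thesis .
  qed
  with taylor show ?thesis unfolding locally_poly_def by blast
qed


section \<open>Digits and products of digits\<close>

text \<open>
  The left-hand side is an iterated finite difference of the \<open>k\<close>-th power, with one step \<open>z a\<close> for
  every \<open>a \<in> A\<close>. Each difference lowers the degree by one, so that below degree \<open>card A\<close> it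
  vanishes. Including the lower degrees makes the induction go through.
\<close>

lemma polarization_aux:
  fixes z :: "'a \<Rightarrow> real"
  assumes "finite A"
  shows "k \<le> card A \<Longrightarrow> (\<Sum>S\<in>Pow A. (-1) ^ (card A - card S) * (y + sum z S) ^ k) =
    (if k = card A then fact k * prod z A else 0)"
  using assms
proof (induction A arbitrary: k y rule: finite_induct)
  case empty
  then show ?case by simp
next
  case (insert a A)
  have finP: "finite (Pow A)" using insert by simp
  have disj: "Pow A \<inter> insert a ` Pow A = {}" using insert by auto
  have inj: "inj_on (insert a) (Pow A)" 
  proof (rule inj_onI)
    fix S T assume "S \<in> Pow A" "T \<in> Pow A" "insert a S = insert a T"
    then show "S = T" using insert.hyps(2) insert_ident[of a S T] by blast
  qed
  have fS: "finite S" "a \<notin> S" "card S \<le> card A" if "S \<in> Pow A" for S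
    using that insert by (auto intro: finite_subset card_mono)
  have "(\<Sum>S\<in>Pow (insert a A). (-1) ^ (card (insert a A) - card S) * (y + sum z S) ^ k) =
    (\<Sum>S\<in>Pow A. (-1) ^ (card (insert a A) - card S) * (y + sum z S) ^ k) +
    (\<Sum>S\<in>Pow A. (-1) ^ (card (insert a A) - card (insert a S)) * (y + sum z (insert a S)) ^ k)"
    unfolding Pow_insert using finP disj inj
    by (subst sum.union_disjoint) (auto simp: sum.reindex)
  also have "\<dots> = (\<Sum>S\<in>Pow A. (-1) ^ (card A - card S) *
      ((y + sum z S + z a) ^ k - (y + sum z S) ^ k))"
    unfolding sum.distrib[symmetric]
    using fS insert by (intro sum.cong) (auto simp: Suc_diff_le algebra_simps)
  also have "\<dots> = (\<Sum>S\<in>Pow A. (-1) ^ (card A - card S) *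
      (\<Sum>i<k. real (k choose i) * (y + sum z S) ^ i * z a ^ (k - i)))"
  proof (rule sum.cong[OF refl])
    fix S
    have "(y + sum z S + z a) ^ k = (\<Sum>i\<le>k. real (k choose i) * (y + sum z S) ^ i * z a ^ (k - i))"
      by (rule binomial_ring)
    also have "{..k} = insert k {..<k}" by auto
    finally show "(-1) ^ (card A - card S) * ((y + sum z S + z a) ^ k - (y + sum z S) ^ k) =
      (-1) ^ (card A - card S) * (\<Sum>i<k. real (k choose i) * (y + sum z S) ^ i * z a ^ (k - i))"
      by simp
  qed
  also have "\<dots> = (\<Sum>i<k. real (k choose i) * z a ^ (k - i) *
      (\<Sum>S\<in>Pow A. (-1) ^ (card A - card S) * (y + sum z S) ^ i))"
    unfolding sum_distrib_left by (subst sum.swap) (simp add: mult_ac)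
  also have "\<dots> = (\<Sum>i<k. real (k choose i) * z a ^ (k - i) * (if i = card A then fact i * prod z A else 0))"
    using insert.prems insert.hyps by (intro sum.cong refl arg_cong2[of _ _ _ _ "(*)"] insert.IH) auto
  also have "\<dots> = (if k = card (insert a A) then fact k * prod z (insert a A) else 0)"
  proof (cases "k = Suc (card A)")
    case True
    have "(\<Sum>i<k. real (k choose i) * z a ^ (k - i) * (if i = card A then fact i * prod z A else 0)) =
      (\<Sum>i<k. if i = card A then real (k choose i) * z a ^ (k - i) * (fact i * prod z A) else 0)"
      by (intro sum.cong) auto
    also have "\<dots> = real (k choose card A) * z a ^ (k - card A) * (fact (card A) * prod z A)"
      using True by (simp add: sum.delta)
    finally show ?thesis using True insert.hyps by (simp add: algebra_simps)
  next
    case False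
    then have "\<forall>i<k. i \<noteq> card A" using insert by auto
    then show ?thesis using False insert.hyps by simp
  qed
  finally show ?case .
qed

lemma polarization:
  fixes z :: "nat \<Rightarrow> real"
  shows "(\<Prod>i<q. z i) = (\<Sum>S\<in>Pow {..<q}. (-1) ^ (q - card S) / fact q * (\<Sum>i\<in>S. z i) ^ q)"
proof -
  have "(\<Sum>S\<in>Pow {..<q}. (-1) ^ (q - card S) / fact q * (\<Sum>i\<in>S. z i) ^ q) =
    (\<Sum>S\<in>Pow {..<q}. (-1) ^ (card {..<q} - card S) * (0 + sum z S) ^ q) / fact q"
    by (simp add: sum_divide_distrib)
  also have "\<dots> = (\<Prod>i<q. z i)" by (subst polarization_aux) auto
  finally show ?thesis ..
qed

text \<open>
  Second differences, the changes of slope of the piecewise linear interpolant of \<open>f\<close> at the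
  integers; at 0 the slope changes from 0.
\<close>

definition interp_coeff :: "(nat \<Rightarrow> real) \<Rightarrow> nat \<Rightarrow> real" where
  "interp_coeff f v = (if v = 0 then f 1 - f 0 else f (v + 1) - 2 * f v + f (v - 1))"

lemma sum_interp_coeff: "(\<Sum>v\<le>s. interp_coeff f v) = f (Suc s) - f s"
  by (induction s) (auto simp: interp_coeff_def)

lemma relu_interpolation:
  "s \<le> M \<Longrightarrow> f 0 + (\<Sum>v<M. interp_coeff f v * max 0 (real s - real v)) = f s"
proof (induction s)
  case (Suc s)
  have "(\<Sum>v<M. interp_coeff f v * max 0 (real (Suc s) - real v)) =
    (\<Sum>v<M. interp_coeff f v * max 0 (real s - real v) + (if v \<in> {..s} then interp_coeff f v else 0))"
    by (intro sum.cong) (auto simp: max_def algebra_simps)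
  also have "\<dots> = (\<Sum>v<M. interp_coeff f v * max 0 (real s - real v)) + (\<Sum>v\<in>{..<M} \<inter> {..s}. interp_coeff f v)"
    by (simp only: sum.distrib sum.inter_restrict[OF finite_lessThan, symmetric])
  also have "{..<M} \<inter> {..s} = {..s}" using Suc.prems by auto
  finally show ?case using Suc by (simp add: sum_interp_coeff)
qed simp

lemma interp_coeff_power_bound:
  assumes "v < M"
  shows "\<bar>interp_coeff (\<lambda>s. real s ^ q) v\<bar> \<le> 4 * real M ^ q"
proof -
  define f where "f s = real s ^ q" for s
  define X where "X = real M ^ q"
  have le: "0 \<le> f s \<and> f s \<le> X" if "s \<le> M" for s
    using that by (auto simp: f_def X_def intro: power_mono)
  have "\<bar>interp_coeff f v\<bar> \<le> 4 * X"
  proof -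
    have "v - 1 \<le> M" "v + 1 \<le> M" "1 \<le> M" using assms by auto
    then show ?thesis
      using le[of 1] le[of 0] le[of "v + 1"] le[of v] le[of "v - 1"] assms
      unfolding interp_coeff_def by (auto simp: abs_le_iff)
  qed
  then show ?thesis by (simp add: f_def[abs_def] X_def)
qed

text \<open>
  A sum of ramps of slope \<open>K\<close> starting at the points \<open>v / w\<close>; it equals the integer part of \<open>w * r\<close>
  unless \<open>r\<close> lies just to the right of one of these points. The argument is written as
  \<open>K * r - K * v / w\<close> since this is the form of the affine argument of a neuron.
\<close>

definition digit :: "nat \<Rightarrow> real \<Rightarrow> real \<Rightarrow> real" where
  "digit w K r = (\<Sum>v\<in>{1..<w}. max 0 (K * r - K * real v / real w) - max 0 (K * r - K * real v / real w - 1))"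

text \<open>
  The truncation at 0 changes nothing where the digits are exact; it is there because every value has
  to pass through neurons.
\<close>

primrec remainder :: "nat \<Rightarrow> real \<Rightarrow> nat \<Rightarrow> real \<Rightarrow> real" where
  "remainder w K 0 t = max 0 t"
| "remainder w K (Suc i) t = max 0 (real w * remainder w K i t - digit w K (remainder w K i t))"

text \<open>
  Distance at least \<open>1 / K\<close> to the grid of mesh \<open>1 / W\<close>, including its end points 0 and 1.
\<close>

definition off_grid :: "nat \<Rightarrow> real \<Rightarrow> real \<Rightarrow> bool" where
  "off_grid W K t \<longleftrightarrow> 0 \<le> t \<and> t \<le> 1 \<and> (\<forall>u\<le>W. 1 / K \<le> \<bar>t - real u / real W\<bar>)"

lemma digit_nonneg: "0 \<le> digit w K r"
  unfolding digit_def by (intro sum_nonneg) auto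

lemma remainder_nonneg: "0 \<le> remainder w K i t"
  by (cases i) auto

lemma digit_exact:
  assumes w: "w \<ge> 1" and K: "K > 0" and r: "0 \<le> r" "r < 1"
    and gap: "\<And>v. 1 \<le> v \<Longrightarrow> v < w \<Longrightarrow> 1 / K \<le> \<bar>r - real v / real w\<bar>"
  shows "\<exists>b<w. digit w K r = real b \<and> real b \<le> real w * r \<and> real w * r < real b + 1"
proof -
  define b where "b = nat \<lfloor>real w * r\<rfloor>"
  have wr: "0 \<le> real w * r" "real w * r < real w" using w r by auto
  have b: "real b \<le> real w * r" "real w * r < real b + 1" using wr unfolding b_def by linarith+
  have bw: "b < w" using b(1) wr(2) by linarith
  have "digit w K r = (\<Sum>v\<in>{1..<w}. if v \<in> {1..b} then 1 else 0)"
    unfolding digit_def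
  proof (rule sum.cong[OF refl])
    fix v assume v: "v \<in> {1..<w}"
    have e: "K * r - K * real v / real w = K * (r - real v / real w)" by (simp add: algebra_simps)
    have g: "1 \<le> K * \<bar>r - real v / real w\<bar>"
      using gap[of v] v K by (simp add: divide_le_eq mult.commute)
    show "max 0 (K * r - K * real v / real w) - max 0 (K * r - K * real v / real w - 1) =
      (if v \<in> {1..b} then 1 else 0)"
    proof (cases "v \<le> b")
      case True
      then have "real v \<le> real w * r" using b by linarith
      then have "0 \<le> r - real v / real w" using w by (simp add: field_simps)
      then have "1 \<le> K * (r - real v / real w)" using g by simp
      then show ?thesis unfolding e using True v by simp
    next
      case False
      then have "real w * r < real v" using b by linarith
      then have "r - real v / real w < 0" using w by (simp add: field_simps)
      then have "K * (r - real v / real w) < 0" using K by (simp add: mult_pos_neg)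
      then show ?thesis unfolding e using False v by simp
    qed
  qed
  also have "\<dots> = real (card ({1..<w} \<inter> {1..b}))"
    by (subst sum.inter_restrict[symmetric]) auto
  also have "{1..<w} \<inter> {1..b} = {1..b}" using bw by auto
  finally show ?thesis using b bw by (intro exI[of _ b]) simp
qed

lemma off_grid_less_1:
  assumes "off_grid W K t" "K > 0" "W \<ge> 1"
  shows "t < 1"
proof -
  have "1 / K \<le> \<bar>t - 1\<bar>" using assms by (auto simp: off_grid_def dest: spec[of _ W])
  moreover have "0 < 1 / K" using assms by simp
  moreover have "t \<le> 1" using assms by (simp add: off_grid_def)
  ultimately show ?thesis by linarith
qed

text \<open>
  The \<open>i\<close>-th remainder is the fractional part of \<open>w ^ i * t\<close>. Its distance to a point \<open>v / w\<close> is
  \<open>w ^ i\<close> times the distance of \<open>t\<close> to a point of the grid of mesh \<open>1 / w ^ L\<close>, so a single gap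
  condition on \<open>t\<close> makes the ramps exact on all levels.
\<close>

lemma digit_expansion:
  assumes w: "w \<ge> 1" and K: "K > 0" and t: "off_grid (w ^ L) K t"
  shows "i \<le> L \<Longrightarrow> (\<exists>u<w ^ i. remainder w K i t = real w ^ i * t - real u) \<and>
    remainder w K i t < 1 \<and>
    t = (\<Sum>l<i. digit w K (remainder w K l t) / real w ^ Suc l) + remainder w K i t / real w ^ i \<and>
    (\<forall>l<i. \<exists>b<w. digit w K (remainder w K l t) = real b)"
proof (induction i)
  case 0
  have "t < 1" using off_grid_less_1[OF t K] w by simp
  then show ?case using t by (auto simp: off_grid_def)
next
  case (Suc i)
  define r where "r = remainder w K i t"
  obtain u where u: "u < w ^ i" "r = real w ^ i * t - real u" using Suc by (auto simp: r_def)
  have r: "0 \<le> r" "r < 1" using Suc by (auto simp: r_def remainder_nonneg)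
  have w0: "real w > 0" using w by simp
  have gap: "1 / K \<le> \<bar>r - real v / real w\<bar>" if v: "1 \<le> v" "v < w" for v
  proof -
    have iL: "L = Suc i + (L - Suc i)" using Suc.prems by simp
    have "u * w + v \<le> w ^ Suc i"
    proof -
      have "(u + 1) * w \<le> w ^ i * w" using u(1) by (intro mult_le_mono1) simp
      then show ?thesis using v by (simp add: mult.commute)
    qed
    then have "(u * w + v) * w ^ (L - Suc i) \<le> w ^ L"
      by (subst iL, subst power_add) (rule mult_le_mono1)
    then have g: "1 / K \<le> \<bar>t - real ((u * w + v) * w ^ (L - Suc i)) / real (w ^ L)\<bar>"
      using t unfolding off_grid_def by blast
    have "real ((u * w + v) * w ^ (L - Suc i)) / real (w ^ L) = real (u * w + v) / real w ^ Suc i"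
      using w0 by (subst (2) iL) (simp add: power_add)
    then have "1 / K \<le> \<bar>t - real (u * w + v) / real w ^ Suc i\<bar>" using g by simp
    also have "\<dots> \<le> real w ^ i * \<bar>t - real (u * w + v) / real w ^ Suc i\<bar>"
      using w by (simp add: mult_le_cancel_right1)
    also have "\<dots> = \<bar>real w ^ i * (t - real (u * w + v) / real w ^ Suc i)\<bar>"
      by (simp add: abs_mult)
    also have "real w ^ i * (t - real (u * w + v) / real w ^ Suc i) = r - real v / real w"
    proof -
      have "real w ^ i * (real (u * w + v) / real w ^ Suc i) = (real u * real w + real v) / real w"
        using w0 by simp
      also have "\<dots> = real u + real v / real w" using w0 by (simp add: add_divide_distrib)
      finally show ?thesis by (simp add: right_diff_distrib u(2))
    qed
    finally show ?thesis .
  qed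
  obtain b where b: "b < w" "digit w K r = real b" "real b \<le> real w * r" "real w * r < real b + 1"
    using digit_exact[OF w K r gap] by blast
  have rem: "remainder w K (Suc i) t = real w * r - real b" using b by (simp add: r_def[symmetric])
  have "u * w + b < w ^ Suc i"
  proof -
    have "(u + 1) * w \<le> w ^ i * w" using u(1) by (intro mult_le_mono1) simp
    then show ?thesis using b(1) by (simp add: mult.commute)
  qed
  moreover have "real w * r - real b = real w ^ Suc i * t - real (u * w + b)"
    unfolding u(2) by (simp add: algebra_simps)
  moreover have "real w * r - real b < 1" using b by simp
  moreover have "t = (\<Sum>l<Suc i. digit w K (remainder w K l t) / real w ^ Suc l) + (real w * r - real b) / real w ^ Suc i"
  proof -
    have "t = (\<Sum>l<i. digit w K (remainder w K l t) / real w ^ Suc l) + r / real w ^ i"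
      using Suc by (simp add: r_def)
    moreover have "r / real w ^ i = real b / real w ^ Suc i + (real w * r - real b) / real w ^ Suc i"
      using w0 by (simp add: field_simps)
    ultimately show ?thesis using b(2) by (simp add: r_def)
  qed
  moreover have "\<forall>l<Suc i. \<exists>b<w. digit w K (remainder w K l t) = real b"
    using Suc b(1,2) by (auto simp: less_Suc_eq r_def)
  ultimately show ?case unfolding rem by blast
qed

text \<open>
  Variables of the products: \<open>Some (l, j)\<close> is the \<open>l\<close>-th digit of the \<open>j\<close>-th coordinate, and \<open>None\<close> is
  the constant 1, with which shorter products are padded to length \<open>q\<close>.
\<close>

type_synonym digit_var = "(nat \<times> nat) option"

definition digit_vars :: "nat \<Rightarrow> nat \<Rightarrow> digit_var set" where
  "digit_vars n L = insert None (Some ` ({..<L} \<times> {..<n}))"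

text \<open>
  A pair \<open>(\<phi>, S)\<close> stands for the \<open>q\<close>-th power of the sum of the variables \<open>\<phi> i\<close> over \<open>i \<in> S\<close>, a term
  in the polarization of the product of all \<open>\<phi> i\<close>.
\<close>

definition features :: "nat \<Rightarrow> nat \<Rightarrow> nat \<Rightarrow> ((nat \<Rightarrow> digit_var) \<times> nat set) set" where
  "features n L q = ({..<q} \<rightarrow>\<^sub>E digit_vars n L) \<times> Pow {..<q}"

lemma finite_digit_vars: "finite (digit_vars n L)"
  by (simp add: digit_vars_def)

lemma finite_features: "finite (features n L q)"
  unfolding features_def by (intro finite_cartesian_product finite_PiE finite_digit_vars) auto

lemma sum_digit_vars:
  "(\<Sum>v\<in>digit_vars n L. f v) = f None + (\<Sum>l<L. \<Sum>j<n. f (Some (l, j)))"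
  unfolding digit_vars_def
  by (subst sum.insert) (auto simp: sum.reindex sum.cartesian_product)

text \<open>
  Each factor is an affine form in the digits. Padding with the constant form 1 gives exactly \<open>q\<close>
  factors, and multiplying out yields one summand for every choice of a variable in each factor.
  The coefficients are products of numbers of modulus at most 1.
\<close>

lemma word_product_features:
  assumes len: "length wd \<le> q" and sub: "set wd \<subseteq> {..<n}" and w: "w \<ge> 1"
    and \<tau>: "\<And>j. \<bar>\<tau> j\<bar> \<le> 1"
  shows "\<exists>a. (\<forall>\<phi>. \<bar>a \<phi>\<bar> \<le> 1) \<and> (\<forall>z. z None = 1 \<longrightarrow>
     prod_list (map (\<lambda>j. (\<Sum>l<L. z (Some (l, j)) / real w ^ Suc l) - \<tau> j) wd) =
     (\<Sum>\<phi>\<in>{..<q} \<rightarrow>\<^sub>E digit_vars n L. a \<phi> * (\<Prod>i<q. z (\<phi> i))))"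
proof -
  define A where "A i v = (if i < length wd
      then (case v of None \<Rightarrow> - \<tau> (wd ! i) | Some (l, j) \<Rightarrow> if j = wd ! i then 1 / real w ^ Suc l else 0)
      else (case v of None \<Rightarrow> 1 | Some _ \<Rightarrow> 0))" for i and v :: digit_var
  have A1: "\<bar>A i v\<bar> \<le> 1" for i v
  proof -
    have "\<bar>1 / real w ^ Suc l\<bar> \<le> 1" for l
      using w one_le_power[of "real w" "Suc l"] by (simp add: divide_le_eq del: power_Suc)
    then show ?thesis using \<tau> by (auto simp: A_def split: option.split)
  qed
  have factor: "(\<Sum>v\<in>digit_vars n L. A i v * z v) =
      (if i < length wd then (\<Sum>l<L. z (Some (l, wd ! i)) / real w ^ Suc l) - \<tau> (wd ! i) else 1)"
    if z: "z None = 1" for z i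
  proof (cases "i < length wd")
    case True
    then have "wd ! i < n" using sub by (auto dest: nth_mem)
    then have "(\<Sum>j<n. A i (Some (l, j)) * z (Some (l, j))) = z (Some (l, wd ! i)) / real w ^ Suc l" for l
    proof -
      have "(\<Sum>j<n. A i (Some (l, j)) * z (Some (l, j))) =
        (\<Sum>j<n. if j = wd ! i then z (Some (l, j)) / real w ^ Suc l else 0)"
        using True by (intro sum.cong) (auto simp: A_def)
      also have "\<dots> = z (Some (l, wd ! i)) / real w ^ Suc l"
        using \<open>wd ! i < n\<close> by (simp add: sum.delta)
      finally show ?thesis .
    qed
    then show ?thesis unfolding sum_digit_vars using True z by (simp add: A_def)
  next
    case False
    then show ?thesis unfolding sum_digit_vars using z by (simp add: A_def)
  qed
  show ?thesis
  proof (intro exI[of _ "\<lambda>\<phi>. \<Prod>i<q. A i (\<phi> i)"] conjI allI impI)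
    fix \<phi> show "\<bar>\<Prod>i<q. A i (\<phi> i)\<bar> \<le> 1"
      unfolding abs_prod using A1 by (intro prod_le_1) auto
  next
    fix z :: "digit_var \<Rightarrow> real" assume z: "z None = 1"
    define u where "u j = (\<Sum>l<L. z (Some (l, j)) / real w ^ Suc l) - \<tau> j" for j
    have "prod_list (map u wd) = (\<Prod>i<length wd. u (wd ! i))"
      by (simp add: prod.list_conv_set_nth atLeast0LessThan)
    also have "\<dots> = (\<Prod>i<q. if i < length wd then u (wd ! i) else 1)"
      using len by (intro prod.mono_neutral_cong_left) auto
    also have "\<dots> = (\<Prod>i<q. \<Sum>v\<in>digit_vars n L. A i v * z v)"
      unfolding factor[of z, OF z] u_def ..
    also have "\<dots> = (\<Sum>\<phi>\<in>{..<q} \<rightarrow>\<^sub>E digit_vars n L. \<Prod>i<q. A i (\<phi> i) * z (\<phi> i))"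
      by (subst prod_sum_PiE) (auto simp: finite_digit_vars)
    finally show "prod_list (map (\<lambda>j. (\<Sum>l<L. z (Some (l, j)) / real w ^ Suc l) - \<tau> j) wd) =
      (\<Sum>\<phi>\<in>{..<q} \<rightarrow>\<^sub>E digit_vars n L. (\<Prod>i<q. A i (\<phi> i)) * (\<Prod>i<q. z (\<phi> i)))"
      by (simp add: prod.distrib u_def[abs_def])
  qed
qed

lemma poly_features:
  assumes ts: "poly_bounded d m C ts" and m: "m = Suc q" and d: "d \<le> n" and w: "w \<ge> 1"
    and \<tau>: "\<And>j. \<bar>\<tau> j\<bar> \<le> 1" and C: "C \<ge> 0"
  shows "\<exists>a. (\<forall>\<xi>. \<bar>a \<xi>\<bar> \<le> C * C) \<and> (\<forall>z. z None = 1 \<longrightarrow>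
     poly_at ts (\<lambda>j. (\<Sum>l<L. z (Some (l, j)) / real w ^ Suc l) - \<tau> j) =
     (\<Sum>(\<phi>, S)\<in>features n L q. a (\<phi>, S) * (\<Sum>i\<in>S. z (\<phi> i)) ^ q))"
proof -
  have "\<forall>(c, wd)\<in>set ts. \<bar>c\<bar> \<le> C \<and> length wd < m \<and> set wd \<subseteq> {..<d}"
    using ts unfolding poly_bounded_def by blast
  then have "\<exists>a. (\<forall>\<xi>. \<bar>a \<xi>\<bar> \<le> real (length ts) * C) \<and> (\<forall>z. z None = 1 \<longrightarrow>
     poly_at ts (\<lambda>j. (\<Sum>l<L. z (Some (l, j)) / real w ^ Suc l) - \<tau> j) =
     (\<Sum>(\<phi>, S)\<in>features n L q. a (\<phi>, S) * (\<Sum>i\<in>S. z (\<phi> i)) ^ q))"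
  proof (induction ts)
    case Nil
    then show ?case by (intro exI[of _ "\<lambda>_. 0"]) (auto simp: poly_at_def)
  next
    case (Cons t ts)
    obtain c wd where t: "t = (c, wd)" by force
    have cw: "\<bar>c\<bar> \<le> C" "length wd \<le> q" "set wd \<subseteq> {..<n}" using Cons.prems m d by (auto simp: t)
    obtain a where a: "\<And>\<xi>. \<bar>a \<xi>\<bar> \<le> real (length ts) * C" "\<And>z. z None = 1 \<Longrightarrow>
     poly_at ts (\<lambda>j. (\<Sum>l<L. z (Some (l, j)) / real w ^ Suc l) - \<tau> j) =
     (\<Sum>(\<phi>, S)\<in>features n L q. a (\<phi>, S) * (\<Sum>i\<in>S. z (\<phi> i)) ^ q)"
      using Cons.IH Cons.prems by auto
    obtain a' where a': "\<And>\<phi>. \<bar>a' \<phi>\<bar> \<le> 1" "\<And>z. z None = 1 \<Longrightarrow>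
     prod_list (map (\<lambda>j. (\<Sum>l<L. z (Some (l, j)) / real w ^ Suc l) - \<tau> j) wd) =
     (\<Sum>\<phi>\<in>{..<q} \<rightarrow>\<^sub>E digit_vars n L. a' \<phi> * (\<Prod>i<q. z (\<phi> i)))"
      using word_product_features[OF cw(2,3) w, of \<tau> L, OF \<tau>] by blast
    define a'' where "a'' = (\<lambda>(\<phi>, S :: nat set). c * a' \<phi> * ((-1) ^ (q - card S) / fact q))"
    have a''C: "\<bar>a'' \<xi>\<bar> \<le> C" for \<xi>
    proof -
      obtain \<phi> S where \<xi>: "\<xi> = (\<phi>, S)" by force
      have "\<bar>(-1) ^ (q - card S) / fact q :: real\<bar> \<le> 1"
        by (simp add: power_abs fact_ge_1 divide_le_eq)
      then have "\<bar>a' \<phi>\<bar> * \<bar>(-1) ^ (q - card S) / fact q :: real\<bar> \<le> 1"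
        using a'(1) by (intro mult_le_one) auto
      then have "\<bar>c\<bar> * (\<bar>a' \<phi>\<bar> * \<bar>(-1) ^ (q - card S) / fact q :: real\<bar>) \<le> C * 1"
        using cw(1) by (intro mult_mono) auto
      then show ?thesis by (simp add: \<xi> a''_def abs_mult mult.assoc)
    qed
    have 1: "\<bar>a \<xi> + a'' \<xi>\<bar> \<le> real (length (t # ts)) * C" for \<xi>
    proof -
      have "\<bar>a \<xi> + a'' \<xi>\<bar> \<le> real (length ts) * C + C"
        by (rule order_trans[OF abs_triangle_ineq add_mono[OF a(1) a''C]])
      then show ?thesis by (simp add: distrib_right)
    qed
    have 2: "poly_at (t # ts) (\<lambda>j. (\<Sum>l<L. z (Some (l, j)) / real w ^ Suc l) - \<tau> j) =
     (\<Sum>(\<phi>, S)\<in>features n L q. (a (\<phi>, S) + a'' (\<phi>, S)) * (\<Sum>i\<in>S. z (\<phi> i)) ^ q)"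
      if z: "z None = 1" for z
    proof -
      let ?u = "\<lambda>j. (\<Sum>l<L. z (Some (l, j)) / real w ^ Suc l) - \<tau> j"
      have "c * prod_list (map ?u wd) = (\<Sum>\<phi>\<in>{..<q} \<rightarrow>\<^sub>E digit_vars n L. \<Sum>S\<in>Pow {..<q}.
          a'' (\<phi>, S) * (\<Sum>i\<in>S. z (\<phi> i)) ^ q)"
        unfolding a'(2)[of z, OF z] polarization a''_def
        by (simp add: sum_distrib_left mult_ac)
      also have "\<dots> = (\<Sum>(\<phi>, S)\<in>features n L q. a'' (\<phi>, S) * (\<Sum>i\<in>S. z (\<phi> i)) ^ q)"
        unfolding features_def by (simp add: sum.cartesian_product)
      finally have "c * prod_list (map ?u wd) = (\<Sum>(\<phi>, S)\<in>features n L q. a'' (\<phi>, S) * (\<Sum>i\<in>S. z (\<phi> i)) ^ q)" .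
      moreover have "poly_at (t # ts) ?u = c * prod_list (map ?u wd) + poly_at ts ?u"
        by (simp add: poly_at_def t)
      ultimately show ?thesis using a(2)[of z, OF z]
        by (simp add: case_prod_unfold distrib_right sum.distrib)
    qed
    show ?case by (rule exI[of _ "\<lambda>\<xi>. a \<xi> + a'' \<xi>"]) (use 1 2 in blast)
  qed
  then obtain a where a: "\<And>\<xi>. \<bar>a \<xi>\<bar> \<le> real (length ts) * C" "\<forall>z. z None = 1 \<longrightarrow>
     poly_at ts (\<lambda>j. (\<Sum>l<L. z (Some (l, j)) / real w ^ Suc l) - \<tau> j) =
     (\<Sum>(\<phi>, S)\<in>features n L q. a (\<phi>, S) * (\<Sum>i\<in>S. z (\<phi> i)) ^ q)" by blast
  have le: "real (length ts) * C \<le> C * C"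
    using ts C unfolding poly_bounded_def by (blast intro: mult_right_mono)
  have "\<forall>\<xi>. \<bar>a \<xi>\<bar> \<le> C * C" by (rule allI, rule order_trans[OF a(1) le])
  from conjI[OF this a(2)] show ?thesis by (rule exI[of _ a])
qed

lemma poly_at_bound:
  assumes ts: "poly_bounded d m C ts" and u: "\<And>j. j < d \<Longrightarrow> \<bar>u j\<bar> \<le> 1" and C: "C \<ge> 0"
  shows "\<bar>poly_at ts u\<bar> \<le> C * C"
proof -
  have "\<forall>(c, wd)\<in>set ts. \<bar>c\<bar> \<le> C \<and> set wd \<subseteq> {..<d}"
    using ts unfolding poly_bounded_def by blast
  then have "\<bar>poly_at ts u\<bar> \<le> real (length ts) * C"
  proof (induction ts)
    case (Cons t ts)
    obtain c wd where t: "t = (c, wd)" by force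
    have cw: "\<bar>c\<bar> \<le> C" "set wd \<subseteq> {..<d}" using Cons.prems by (auto simp: t)
    have "\<bar>prod_list (map u wd)\<bar> \<le> 1"
      using cw(2) by (induction wd) (auto simp: abs_mult u intro!: mult_le_one)
    then have "\<bar>c\<bar> * \<bar>prod_list (map u wd)\<bar> \<le> C * 1" using cw(1) by (intro mult_mono) auto
    then have 1: "\<bar>c * prod_list (map u wd)\<bar> \<le> C" by (simp add: abs_mult)
    have 2: "poly_at (t # ts) u = c * prod_list (map u wd) + poly_at ts u"
      by (simp add: poly_at_def t)
    have 3: "\<bar>poly_at ts u\<bar> \<le> real (length ts) * C"
      by (rule Cons.IH, rule ballI, rule bspec[OF Cons.prems], simp)
    have "\<bar>poly_at (t # ts) u\<bar> \<le> C + real (length ts) * C"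
      unfolding 2 by (rule order_trans[OF abs_triangle_ineq add_mono[OF 1 3]])
    then show ?case by (simp add: distrib_right)
  qed (simp add: poly_at_def)
  also have "\<dots> \<le> C * C"
    using ts C unfolding poly_bounded_def by (blast intro: mult_right_mono)
  finally show ?thesis .
qed


section \<open>The network and its cost\<close>

lemma affine_over_eqI:
  "affine_over F M k g \<Longrightarrow> k \<le> k' \<Longrightarrow> (\<And>x. g' x = g x) \<Longrightarrow> affine_over F M k' g'"
  by (metis affine_over_mono ext order_refl)

lemma relu_layer_carry:
  assumes "finite I" "\<And>i. i \<in> I \<Longrightarrow> f i \<in> F" "\<And>i x. i \<in> I \<Longrightarrow> 0 \<le> f i x" "1 \<le> M"
  shows "relu_layer F M (card I) (f ` I)"
proof -
  have "relu_layer F M (card I * 1) ((\<lambda>i x. max 0 (1 * f i x)) ` I)"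
    using assms by (intro relu_layer_image affine_over_member) auto
  also have "(\<lambda>i x. max 0 (1 * f i x)) ` I = f ` I"
    using assms(3) by (intro image_cong) (auto simp: max_def fun_eq_iff order.antisym)
  finally show ?thesis by simp
qed

lemma relu_layer_family:
  assumes "finite I" "\<And>i. i \<in> I \<Longrightarrow> affine_over F M k (h i)" "\<And>i x. i \<in> I \<Longrightarrow> f i x = max 0 (h i x)"
    "card I * k \<le> s"
  shows "relu_layer F M s (f ` I)"
proof -
  have "relu_layer F M (card I * k) ((\<lambda>i x. max 0 (h i x)) ` I)"
    using assms by (intro relu_layer_image) auto
  also have "(\<lambda>i x. max 0 (h i x)) ` I = f ` I"
    using assms(3) by (intro image_cong) (auto simp: fun_eq_iff)
  finally show ?thesis by (rule relu_layer_mono) (use assms(4) in auto)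
qed

text \<open>
  The parameters: \<open>P\<close> regions in dimension \<open>n\<close>, cells of side \<open>1 / N\<close>, \<open>L\<close> digits in base \<open>w\<close>, slopes
  \<open>K\<close> for the ramps at the grid and \<open>H\<close> for the comparisons with \<open>F i\<close> and \<open>G i\<close>, a bound \<open>C\<close> on
  the local polynomials, and a bound \<open>M\<close> on all row entries. A target \<open>(a, i, b)\<close> is the lower
  (\<open>b = False\<close>) or upper (\<open>b = True\<close>) bounding function on level \<open>i\<close> of the region \<open>a\<close>; it depends
  on \<open>i\<close> variables. The polynomial of a target in a cell is given by the coefficients \<open>co\<close> of
  the features.
\<close>

locale relu_construction =
  fixes n q L w N P :: nat and K H C M :: real
    and co :: "nat \<times> nat \<times> bool \<Rightarrow> (nat \<Rightarrow> nat) \<Rightarrow> ((nat \<Rightarrow> digit_var) \<times> nat set) \<Rightarrow> real"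
  assumes n: "n \<ge> 2" and N: "N \<ge> 1" and w_eq: "w = N ^ (n - 1)"
    and K0: "K > 0" and H0: "H > 0" and C0: "C \<ge> 0"
    and co: "\<And>g \<kappa> \<xi>. \<bar>co g \<kappa> \<xi>\<bar> \<le> C"
    and M: "K + 1 \<le> M" "real w \<le> M" "real (q * w) \<le> M" "4 * real (q * w) ^ q \<le> M"
      "1 + H + H * C \<le> M" "2 * C \<le> M"
begin

text \<open>
  The input coordinates are shifted from \<open>[-1/2, 1/2]\<close> to \<open>[0, 1]\<close>. All functions below are defined
  on the whole space by the formulas that the neurons compute; they have the intended meaning only
  off the exceptional set.
\<close>

definition tpos :: "nat \<Rightarrow> rfun" where "tpos j x = max 0 (x j + 1/2)"
definition rm :: "nat \<Rightarrow> nat \<Rightarrow> rfun" where "rm i j x = remainder w K i (x j + 1/2)"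
definition dg :: "nat \<Rightarrow> nat \<Rightarrow> rfun" where "dg i j x = digit w K (rm i j x)"
definition zval :: "digit_var \<Rightarrow> rfun" where
  "zval v x = (case v of None \<Rightarrow> 1 | Some (i, j) \<Rightarrow> dg i j x)"
definition argsum :: "(nat \<Rightarrow> digit_var) \<times> nat set \<Rightarrow> rfun" where
  "argsum \<xi> x = (\<Sum>i\<in>snd \<xi>. zval (fst \<xi> i) x)"
definition pramp :: "(nat \<Rightarrow> digit_var) \<times> nat set \<Rightarrow> nat \<Rightarrow> rfun" where
  "pramp \<xi> v x = max 0 (argsum \<xi> x - real v)"
definition feat :: "(nat \<Rightarrow> digit_var) \<times> nat set \<Rightarrow> rfun" where
  "feat \<xi> x = max 0 (real 0 ^ q + (\<Sum>v<q * w. interp_coeff (\<lambda>s. real s ^ q) v * pramp \<xi> v x))"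

text \<open>
  The sum \<open>below k j + above k j\<close> is a penalty for leaving the \<open>k\<close>-th interval of length \<open>1 / N\<close>: off
  the grid it is 0 inside and at least 1 outside.
\<close>

definition below :: "nat \<Rightarrow> nat \<Rightarrow> rfun" where
  "below k j x = max 0 (1 + K * real k / real N - K * tpos j x)"
definition above :: "nat \<Rightarrow> nat \<Rightarrow> rfun" where
  "above k j x = max 0 (1 - K * real (k + 1) / real N + K * tpos j x)"
definition pen :: "nat \<Rightarrow> nat \<Rightarrow> rfun" where "pen k j x = max 0 (below k j x + above k j x)"
definition cells :: "nat \<Rightarrow> (nat \<Rightarrow> nat) set" where "cells d = ({..<d} \<rightarrow>\<^sub>E {..<N})"

text \<open>
  Inside the cell \<open>\<kappa>\<close> the value is \<open>C\<close> plus the polynomial of the cell. In any other cell the penalty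
  is at least \<open>2 * C\<close> and beats the polynomial, so that the neuron is off.
\<close>

definition cell :: "nat \<times> nat \<times> bool \<Rightarrow> (nat \<Rightarrow> nat) \<Rightarrow> rfun" where
  "cell g \<kappa> x = max 0 (C + (\<Sum>\<xi>\<in>features n L q. co g \<kappa> \<xi> * feat \<xi> x)
      - (\<Sum>j<fst (snd g). 2 * C * pen (\<kappa> j) j x))"
definition approx :: "nat \<times> nat \<times> bool \<Rightarrow> rfun" where
  "approx g x = (\<Sum>\<kappa>\<in>cells (fst (snd g)). cell g \<kappa> x) - C"

text \<open>
  Zero if the \<open>i\<close>-th coordinate exceeds the approximate lower bound by \<open>1 / H\<close>, and at least 1 if it
  does not exceed it; \<open>high\<close> does the same for the upper bound.
\<close>

definition low :: "nat \<Rightarrow> nat \<Rightarrow> rfun" where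
  "low a i x = max 0 (1 - H * (tpos i x - 1/2 - approx (a, i, False) x))"
definition high :: "nat \<Rightarrow> nat \<Rightarrow> rfun" where
  "high a i x = max 0 (1 - H * (approx (a, i, True) x - (tpos i x - 1/2)))"
definition psi :: "nat \<Rightarrow> rfun" where
  "psi a x = max 0 (1 - (\<Sum>i<n. low a i x + high a i x))"
definition outside :: rfun where "outside x = max 0 (1 - (\<Sum>a<P. psi a x))"
definition net :: rfun where "net x = 1 - outside x"

lemma w1: "w \<ge> 1" using N by (simp add: w_eq)

lemma Nw: "N \<le> w"
  using N n self_le_power[of N "n - 1"] by (simp add: w_eq)

lemma M1: "1 \<le> M" using M(1) K0 by simp

lemma card_cells: "finite (cells d)" "d < n \<Longrightarrow> card (cells d) \<le> w"
proof -
  show "finite (cells d)" unfolding cells_def by (intro finite_PiE) auto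
  assume "d < n"
  then have "N ^ d \<le> N ^ (n - 1)" using N by (intro power_increasing) auto
  then show "card (cells d) \<le> w" by (simp add: cells_def card_PiE w_eq)
qed

text \<open>
  After \<open>1 + 2 * i\<close> layers: the coordinates, the current remainders and the digits found so far. All
  of these are nonnegative, so one neuron carries each of them to the next layer.
\<close>

definition state :: "nat \<Rightarrow> rfun set" where
  "state i = tpos ` {..<n} \<union> rm i ` {..<n} \<union> (\<lambda>(l, j). dg l j) ` ({..<i} \<times> {..<n})"

definition ramps :: "nat \<Rightarrow> rfun set" where
  "ramps i = (\<lambda>(v, j) x. max 0 (K * rm i j x - K * real v / real w)) ` ({1..<w} \<times> {..<n})
     \<union> (\<lambda>(v, j) x. max 0 (K * rm i j x - K * real v / real w - 1)) ` ({1..<w} \<times> {..<n})"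

lemma dg_nonneg: "0 \<le> dg i j x" by (simp add: dg_def digit_nonneg)
lemma rm_nonneg: "0 \<le> rm i j x" by (simp add: rm_def remainder_nonneg)
lemma tpos_nonneg: "0 \<le> tpos j x" by (simp add: tpos_def)

lemma rm_0: "rm 0 = tpos" by (intro ext) (simp add: rm_def tpos_def)

lemma state_carry: "state i \<subseteq> F \<Longrightarrow> relu_layer F M ((2 + i) * n) (state i)"
proof -
  assume F: "state i \<subseteq> F"
  have 1: "relu_layer F M (card {..<n}) (tpos ` {..<n})"
    using F by (intro relu_layer_carry) (auto simp: state_def tpos_nonneg M1)
  have 2: "relu_layer F M (card {..<n}) (rm i ` {..<n})"
    using F by (intro relu_layer_carry) (auto simp: state_def rm_nonneg M1)
  have 3: "relu_layer F M (card ({..<i} \<times> {..<n})) ((\<lambda>(l, j). dg l j) ` ({..<i} \<times> {..<n}))"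
    using F by (intro relu_layer_carry) (auto simp: state_def dg_nonneg M1)
  from relu_layer_Un[OF relu_layer_Un[OF 1 2] 3] show ?thesis
    unfolding state_def by (simp add: algebra_simps)
qed

lemma computes_state_0: "computes n M 1 (2 * n * w) (state 0)"
proof -
  have "relu_layer ((\<lambda>j x. x j) ` {..<n}) M (2 * n * w) (tpos ` {..<n})"
  proof (rule relu_layer_family)
    fix j assume "j \<in> {..<n}"
    then have "affine_over ((\<lambda>j x. x j) ` {..<n}) M 1 (\<lambda>x. 1 * x j)"
      using M1 by (intro affine_over_member) auto
    from affine_over_add[OF this affine_over_const[of "1/2" M]] M1
    show "affine_over ((\<lambda>j x. x j) ` {..<n}) M 2 (\<lambda>x. 1 * x j + 1/2)" by (simp add: numeral_2_eq_2)
    show "tpos j x = max 0 (1 * x j + 1/2)" for x by (simp add: tpos_def)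
  qed (use w1 in auto)
  then have "computes n M (Suc 0) (2 * n * w) (tpos ` {..<n})"
    by (rule computes_Suc[of n M 0 0, rotated]) auto
  moreover have "state 0 = tpos ` {..<n}" by (auto simp: state_def rm_0)
  ultimately show ?thesis by (simp only: One_nat_def)
qed

lemma ramps_layer: "relu_layer (state i) M (4 * n * w) (ramps i)"
proof -
  have aff: "affine_over (state i) M 2 (\<lambda>x. K * rm i j x - (K * real v / real w + e))"
    if "v \<in> {1..<w}" "j < n" "0 \<le> e" "e \<le> 1" for v j e
  proof -
    have "real v / real w \<le> 1" using that by simp
    then have "K * (real v / real w) \<le> K * 1" using K0 by (intro mult_left_mono) auto
    moreover have "0 \<le> K * (real v / real w)" using K0 by simp
    ultimately have b: "\<bar>- (K * real v / real w + e)\<bar> \<le> M" using that M(1) by simp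
    have "affine_over (state i) M 1 (\<lambda>x. K * rm i j x)"
      using that K0 M(1) by (intro affine_over_member) (auto simp: state_def)
    from affine_over_add[OF this affine_over_const[OF b]] show ?thesis
      by (rule affine_over_eqI) auto
  qed
  have c: "card ({1..<w} \<times> {..<n}) * 2 \<le> 2 * n * w" by (simp add: algebra_simps)
  have 1: "relu_layer (state i) M (2 * n * w)
     ((\<lambda>(v, j) x. max 0 (K * rm i j x - K * real v / real w)) ` ({1..<w} \<times> {..<n}))"
    by (rule relu_layer_family[OF _ _ _ c, where h = "\<lambda>(v, j) x. K * rm i j x - (K * real v / real w + 0)"])
      (use aff[where e = 0] in auto)
  have 2: "relu_layer (state i) M (2 * n * w)
     ((\<lambda>(v, j) x. max 0 (K * rm i j x - K * real v / real w - 1)) ` ({1..<w} \<times> {..<n}))"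
    by (rule relu_layer_family[OF _ _ _ c, where h = "\<lambda>(v, j) x. K * rm i j x - (K * real v / real w + 1)"])
      (use aff[where e = 1] in \<open>auto simp: algebra_simps\<close>)
  show ?thesis unfolding ramps_def by (rule relu_layer_mono[OF relu_layer_Un[OF 1 2]]) auto
qed

lemma digit_affine:
  assumes "j < n"
  shows "affine_over (state i \<union> ramps i) M (2 * w) (dg i j)"
proof -
  let ?F = "state i \<union> ramps i"
  have "affine_over ?F M (card {1..<w} * 2) (\<lambda>x. \<Sum>v\<in>{1..<w}.
     1 * max 0 (K * rm i j x - K * real v / real w) + (-1) * max 0 (K * rm i j x - K * real v / real w - 1))"
  proof (rule affine_over_sum_const)
    fix v assume v: "v \<in> {1..<w}"
    have 1: "affine_over ?F M 1 (\<lambda>x. 1 * max 0 (K * rm i j x - K * real v / real w))"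
      using v assms M1 by (intro affine_over_member) (auto simp: ramps_def image_iff)
    have 2: "affine_over ?F M 1 (\<lambda>x. (-1) * max 0 (K * rm i j x - K * real v / real w - 1))"
      using v assms M1 by (intro affine_over_member) (auto simp: ramps_def image_iff)
    from affine_over_add[OF 1 2] show "affine_over ?F M 2 (\<lambda>x.
      1 * max 0 (K * rm i j x - K * real v / real w) + (-1) * max 0 (K * rm i j x - K * real v / real w - 1))"
      by (simp only: one_add_one)
  qed simp
  then show ?thesis by (rule affine_over_eqI) (auto simp: dg_def digit_def)
qed

text \<open>
  One digit takes two layers: the ramps, and then their sum (the digit) together with the new
  remainder.
\<close>

lemma computes_state:
  "i \<le> L \<Longrightarrow> computes n M (1 + 2 * i) ((2 * n + i * ((15 + 3 * L) * n)) * w) (state i)"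
proof (induction i)
  case 0
  then show ?case using computes_state_0 by simp
next
  case (Suc i)
  let ?S = "(2 * n + i * ((15 + 3 * L) * n)) * w"
  let ?F = "state i \<union> ramps i"
  have "relu_layer (state i) M ((2 + i) * n + 4 * n * w) ?F"
    by (intro relu_layer_Un state_carry ramps_layer) simp
  moreover have "(2 + i) * n + 4 * n * w \<le> (6 + L) * n * w"
  proof -
    have "(2 + i) * n * 1 \<le> (2 + L) * n * w" using Suc.prems w1 by (intro mult_le_mono) auto
    then show ?thesis by (simp add: algebra_simps)
  qed
  ultimately have L1: "relu_layer (state i) M ((6 + L) * n * w) ?F" by (auto elim: relu_layer_mono)
  have c1: "computes n M (Suc (1 + 2 * i)) (?S + (6 + L) * n * w) ?F"
    by (rule computes_Suc[OF _ L1 order_refl]) (use Suc in simp)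
  have D: "relu_layer ?F M (2 * n * w) (dg i ` {..<n})"
    by (rule relu_layer_family[where h = "dg i" and k = "2 * w"])
      (use digit_affine dg_nonneg in \<open>auto simp: max_def order.antisym\<close>)
  have R: "relu_layer ?F M (3 * n * w) (rm (Suc i) ` {..<n})"
  proof (rule relu_layer_family)
    fix j assume j: "j \<in> {..<n}"
    have 1: "affine_over ?F M 1 (\<lambda>x. real w * rm i j x)"
      using j M(2) by (intro affine_over_member) (auto simp: state_def)
    have 2: "affine_over ?F M (2 * w) (\<lambda>x. (-1) * dg i j x)"
      using j digit_affine[of j i] by (intro affine_over_scale) auto
    from affine_over_add[OF 1 2]
    show "affine_over ?F M (1 + 2 * w) (\<lambda>x. real w * rm i j x + (-1) * dg i j x)" .
    show "rm (Suc i) j x = max 0 (real w * rm i j x + (-1) * dg i j x)" for x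
      by (simp add: rm_def dg_def)
  next
    have "n * (1 + 2 * w) \<le> n * (3 * w)" using w1 by (intro mult_le_mono2) simp
    then show "card {..<n} * (1 + 2 * w) \<le> 3 * n * w" by (simp add: algebra_simps)
  qed simp
  have T1: "relu_layer ?F M (card {..<n}) (tpos ` {..<n})"
    by (intro relu_layer_carry) (auto simp: state_def tpos_nonneg M1)
  have T3: "relu_layer ?F M (card ({..<i} \<times> {..<n})) ((\<lambda>(l, j). dg l j) ` ({..<i} \<times> {..<n}))"
    by (intro relu_layer_carry) (auto simp: state_def dg_nonneg M1)
  have "relu_layer ?F M (card {..<n} + 3 * n * w + (card ({..<i} \<times> {..<n}) + 2 * n * w))
     (tpos ` {..<n} \<union> rm (Suc i) ` {..<n} \<union> ((\<lambda>(l, j). dg l j) ` ({..<i} \<times> {..<n}) \<union> dg i ` {..<n}))"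
    by (intro relu_layer_Un T1 R T3 D)
  also have "(\<lambda>(l, j). dg l j) ` ({..<i} \<times> {..<n}) \<union> dg i ` {..<n} = (\<lambda>(l, j). dg l j) ` ({..<Suc i} \<times> {..<n})"
    by (force simp: less_Suc_eq image_iff)
  finally have L2: "relu_layer ?F M (n + 3 * n * w + (i * n + 2 * n * w)) (state (Suc i))"
    by (simp add: state_def)
  have le: "?S + (6 + L) * n * w + (n + 3 * n * w + (i * n + 2 * n * w)) \<le> (2 * n + Suc i * ((15 + 3 * L) * n)) * w"
  proof -
    have "i * n * 1 \<le> L * n * w" using Suc.prems w1 by (intro mult_le_mono) auto
    then have 1: "i * n \<le> L * n * w" "n \<le> n * w" using w1 by simp_all
    have 2: "(2 * n + Suc i * ((15 + 3 * L) * n)) * w = ?S + (15 * n * w + 3 * (L * n * w))"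
      by (simp add: algebra_simps)
    have 3: "(6 + L) * n * w = 6 * n * w + L * n * w" by (simp add: algebra_simps)
    show ?thesis unfolding 2 3 using 1 by linarith
  qed
  from computes_Suc[OF c1 L2 le] show ?case by simp
qed

definition power_layer :: "rfun set" where
  "power_layer = (\<lambda>(\<xi>, v). pramp \<xi> v) ` (features n L q \<times> {..<q * w})
     \<union> (\<lambda>(k, j). below k j) ` ({..<N} \<times> {..<n}) \<union> (\<lambda>(k, j). above k j) ` ({..<N} \<times> {..<n})
     \<union> tpos ` {..<n}"

definition feature_layer :: "rfun set" where
  "feature_layer = feat ` features n L q \<union> (\<lambda>(k, j). pen k j) ` ({..<N} \<times> {..<n}) \<union> tpos ` {..<n}"

definition targets :: "(nat \<times> nat \<times> bool) set" where
  "targets = {..<P} \<times> {..<n} \<times> UNIV"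

definition cell_layer :: "rfun set" where
  "cell_layer = (\<lambda>(g, \<kappa>). cell g \<kappa>) ` (SIGMA g:targets. cells (fst (snd g))) \<union> tpos ` {..<n}"

definition strip_layer :: "rfun set" where
  "strip_layer = (\<lambda>(a, i). low a i) ` ({..<P} \<times> {..<n}) \<union> (\<lambda>(a, i). high a i) ` ({..<P} \<times> {..<n})"

lemma tpos_carry: "tpos ` {..<n} \<subseteq> F \<Longrightarrow> relu_layer F M n (tpos ` {..<n})"
  using relu_layer_carry[of "{..<n}" tpos F M] by (auto simp: tpos_nonneg M1)

lemma zval_affine:
  assumes "v \<in> digit_vars n L"
  shows "affine_over (state L) M 1 (zval v)"
proof (cases v)
  case None
  show ?thesis by (rule affine_over_eqI[OF affine_over_const[of 1 M]]) (use M1 None in \<open>auto simp: zval_def\<close>)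
next
  case (Some a)
  then obtain i j where v: "v = Some (i, j)" "i < L" "j < n"
    using assms by (cases a) (auto simp: digit_vars_def)
  have "affine_over (state L) M 1 (\<lambda>x. 1 * dg i j x)"
    using v M1 by (intro affine_over_member) (auto simp: state_def)
  then show ?thesis by (rule affine_over_eqI) (auto simp: zval_def v)
qed

lemma argsum_affine:
  assumes "\<xi> \<in> features n L q"
  shows "affine_over (state L) M q (argsum \<xi>)"
proof -
  have S: "snd \<xi> \<subseteq> {..<q}" and v: "\<And>i. i \<in> snd \<xi> \<Longrightarrow> fst \<xi> i \<in> digit_vars n L"
    using assms by (auto simp: features_def PiE_def Pi_def)
  have "affine_over (state L) M (card (snd \<xi>) * 1) (\<lambda>x. \<Sum>i\<in>snd \<xi>. zval (fst \<xi> i) x)"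
    using S v by (intro affine_over_sum_const zval_affine) (auto intro: finite_subset)
  moreover have "card (snd \<xi>) \<le> q" using card_mono[OF _ S] by simp
  ultimately show ?thesis by (elim affine_over_eqI) (auto simp: argsum_def)
qed

text \<open>
  The number of features does not depend on \<open>N\<close>, so the ramps from which all their powers are
  interpolated cost \<open>O(w)\<close>, and the penalties cost no more because \<open>N \<le> w\<close>.
\<close>

lemma relu_power_layer:
  "relu_layer (state L) M ((card (features n L q) * q * (q + 1) + 5 * n) * w) power_layer"
proof -
  let ?\<Xi> = "features n L q"
  have A: "relu_layer (state L) M (card ?\<Xi> * q * (q + 1) * w) ((\<lambda>(\<xi>, v). pramp \<xi> v) ` (?\<Xi> \<times> {..<q * w}))"
  proof (rule relu_layer_family[where h = "\<lambda>(\<xi>, v) x. argsum \<xi> x + - real v" and k = "q + 1"])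
    fix i assume "i \<in> ?\<Xi> \<times> {..<q * w}"
    then obtain \<xi> v where i: "i = (\<xi>, v)" "\<xi> \<in> ?\<Xi>" "v < q * w" by auto
    have "\<bar>- real v\<bar> \<le> M" using i(3) M(3) by linarith
    from affine_over_add[OF argsum_affine[OF i(2)] affine_over_const[OF this]]
    show "affine_over (state L) M (q + 1) ((\<lambda>(\<xi>, v) x. argsum \<xi> x + - real v) i)" by (simp add: i)
  qed (auto simp: finite_features pramp_def card_cartesian_product algebra_simps)
  have bnd: "0 \<le> K * real k / real N" "K * real k / real N \<le> K" if "k \<le> N" for k
  proof -
    have "K * (real k / real N) \<le> K * 1" using that N K0 by (intro mult_left_mono) auto
    then show "K * real k / real N \<le> K" by simp
  qed (use K0 in auto)
  have c: "card ({..<N} \<times> {..<n}) * 2 \<le> 2 * n * w" using Nw by simp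
  have KM: "\<bar>K\<bar> \<le> M" "\<bar>- K\<bar> \<le> M" using K0 M(1) by auto
  have B: "relu_layer (state L) M (2 * n * w) ((\<lambda>(k, j). below k j) ` ({..<N} \<times> {..<n}))"
  proof (rule relu_layer_family[OF _ _ _ c, where h = "\<lambda>(k, j) x. (1 + K * real k / real N) + (- K) * tpos j x"])
    fix i assume "i \<in> {..<N} \<times> {..<n}"
    then obtain k j where i: "i = (k, j)" "k < N" "j < n" by auto
    have 1: "affine_over (state L) M 1 (\<lambda>x. 1 + K * real k / real N)"
      using bnd[of k] i M(1) by (intro affine_over_const) auto
    have 2: "affine_over (state L) M 1 (\<lambda>x. (- K) * tpos j x)"
      using i KM by (intro affine_over_member) (auto simp: state_def)
    from affine_over_add[OF 1 2]
    show "affine_over (state L) M 2 ((\<lambda>(k, j) x. (1 + K * real k / real N) + (- K) * tpos j x) i)"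
      by (simp add: i numeral_2_eq_2)
  qed (auto simp: below_def)
  have A': "relu_layer (state L) M (2 * n * w) ((\<lambda>(k, j). above k j) ` ({..<N} \<times> {..<n}))"
  proof (rule relu_layer_family[OF _ _ _ c, where h = "\<lambda>(k, j) x. (1 - K * real (k + 1) / real N) + K * tpos j x"])
    fix i assume "i \<in> {..<N} \<times> {..<n}"
    then obtain k j where i: "i = (k, j)" "k < N" "j < n" by auto
    have "\<bar>1 - X\<bar> \<le> M" if "0 \<le> X" "X \<le> K" for X using that M(1) by linarith
    then have 1: "affine_over (state L) M 1 (\<lambda>x. 1 - K * real (k + 1) / real N)"
      using bnd[of "k + 1"] i by (intro affine_over_const) auto
    have 2: "affine_over (state L) M 1 (\<lambda>x. K * tpos j x)"
      using i KM by (intro affine_over_member) (auto simp: state_def)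
    from affine_over_add[OF 1 2]
    show "affine_over (state L) M 2 ((\<lambda>(k, j) x. (1 - K * real (k + 1) / real N) + K * tpos j x) i)"
      by (simp add: i numeral_2_eq_2)
  qed (auto simp: above_def)
  have T: "relu_layer (state L) M n (tpos ` {..<n})" by (rule tpos_carry) (auto simp: state_def)
  have "n \<le> n * w" using w1 by simp
  then have "card ?\<Xi> * q * (q + 1) * w + 2 * n * w + 2 * n * w + n \<le> (card ?\<Xi> * q * (q + 1) + 5 * n) * w"
    by (simp add: add_mult_distrib)
  with relu_layer_Un[OF relu_layer_Un[OF relu_layer_Un[OF A B] A'] T] show ?thesis
    unfolding power_layer_def by (auto elim: relu_layer_mono)
qed

text \<open>
  The powers are collected in neurons of their own. Otherwise every cell would have to address all
  ramps, at a total cost of \<open>w * N ^ (n - 1)\<close>.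
\<close>

lemma relu_feature_layer:
  "relu_layer power_layer M ((card (features n L q) * (q + 1) + 3 * n) * w) feature_layer"
proof -
  let ?\<Xi> = "features n L q"
  let ?c = "interp_coeff (\<lambda>s. real s ^ q)"
  have A: "relu_layer power_layer M (card ?\<Xi> * (q + 1) * w) (feat ` ?\<Xi>)"
  proof (rule relu_layer_family[where k = "1 + q * w"])
    fix \<xi> assume \<xi>: "\<xi> \<in> ?\<Xi>"
    have "\<bar>real 0 ^ q\<bar> \<le> 1" by (cases q) auto
    then have 1: "affine_over power_layer M 1 (\<lambda>x. real 0 ^ q)"
      using M1 by (intro affine_over_const) linarith
    have 2: "affine_over power_layer M (card {..<q * w} * 1) (\<lambda>x. \<Sum>v<q * w. ?c v * pramp \<xi> v x)"
    proof (intro affine_over_sum_const affine_over_member)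
      fix v assume v: "v \<in> {..<q * w}"
      then show "pramp \<xi> v \<in> power_layer" using \<xi> by (auto simp: power_layer_def)
      show "\<bar>?c v\<bar> \<le> M" using interp_coeff_power_bound[of v "q * w" q] v M(4) by simp
    qed simp
    from affine_over_add[OF 1 2] show "affine_over power_layer M (1 + q * w)
       (\<lambda>x. real 0 ^ q + (\<Sum>v<q * w. ?c v * pramp \<xi> v x))" by simp
    show "feat \<xi> x = max 0 (real 0 ^ q + (\<Sum>v<q * w. ?c v * pramp \<xi> v x))" for x
      by (simp only: feat_def)
  next
    have "1 + q * w \<le> (q + 1) * w" using w1 by simp
    then show "card ?\<Xi> * (1 + q * w) \<le> card ?\<Xi> * (q + 1) * w"
      unfolding mult.assoc by (rule mult_le_mono2)
  qed (rule finite_features)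
  have B: "relu_layer power_layer M (2 * n * w) ((\<lambda>(k, j). pen k j) ` ({..<N} \<times> {..<n}))"
  proof (rule relu_layer_family[where h = "\<lambda>(k, j) x. 1 * below k j x + 1 * above k j x" and k = 2])
    fix i assume "i \<in> {..<N} \<times> {..<n}"
    then obtain k j where i: "i = (k, j)" "k < N" "j < n" by auto
    have 1: "affine_over power_layer M 1 (\<lambda>x. 1 * below k j x)"
      using i M1 by (intro affine_over_member) (auto simp: power_layer_def)
    have 2: "affine_over power_layer M 1 (\<lambda>x. 1 * above k j x)"
      using i M1 by (intro affine_over_member) (auto simp: power_layer_def)
    from affine_over_add[OF 1 2]
    show "affine_over power_layer M 2 ((\<lambda>(k, j) x. 1 * below k j x + 1 * above k j x) i)"
      by (simp add: i numeral_2_eq_2)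
  qed (use Nw in \<open>auto simp: pen_def\<close>)
  have T: "relu_layer power_layer M n (tpos ` {..<n})" by (rule tpos_carry) (auto simp: power_layer_def)
  have "n \<le> n * w" using w1 by simp
  then have "card ?\<Xi> * (q + 1) * w + 2 * n * w + n \<le> (card ?\<Xi> * (q + 1) + 3 * n) * w"
    by (simp add: add_mult_distrib)
  with relu_layer_Un[OF relu_layer_Un[OF A B] T] show ?thesis
    unfolding feature_layer_def by (auto elim: relu_layer_mono)
qed

lemma finite_targets: "finite targets" by (simp add: targets_def)

lemma card_targets: "card targets = 2 * P * n" by (simp add: targets_def card_cartesian_product)

lemma relu_cell_layer:
  "relu_layer feature_layer M ((2 * P * n * (1 + card (features n L q) + n) + n) * w) cell_layer"
proof -
  let ?\<Xi> = "features n L q"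
  let ?I = "SIGMA g:targets. cells (fst (snd g))"
  have A: "relu_layer feature_layer M (2 * P * n * (1 + card ?\<Xi> + n) * w) ((\<lambda>(g, \<kappa>). cell g \<kappa>) ` ?I)"
  proof (rule relu_layer_family[where k = "1 + card ?\<Xi> + n" and
      h = "\<lambda>(g, \<kappa>) x. C + (\<Sum>\<xi>\<in>?\<Xi>. co g \<kappa> \<xi> * feat \<xi> x) + (\<Sum>j<fst (snd g). (- (2 * C)) * pen (\<kappa> j) j x)"])
    fix i assume "i \<in> ?I"
    then obtain g \<kappa> where i: "i = (g, \<kappa>)" "g \<in> targets" "\<kappa> \<in> cells (fst (snd g))" by auto
    have d: "fst (snd g) < n" using i by (auto simp: targets_def)
    have CM: "C \<le> M" using M(6) C0 by simp
    have 1: "affine_over feature_layer M 1 (\<lambda>x. C)" using C0 CM by (intro affine_over_const) auto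
    have 2: "affine_over feature_layer M (card ?\<Xi> * 1) (\<lambda>x. \<Sum>\<xi>\<in>?\<Xi>. co g \<kappa> \<xi> * feat \<xi> x)"
      using CM order_trans[OF co CM]
      by (intro affine_over_sum_const affine_over_member finite_features) (auto simp: feature_layer_def)
    have 3: "affine_over feature_layer M (card {..<fst (snd g)} * 1) (\<lambda>x. \<Sum>j<fst (snd g). (- (2 * C)) * pen (\<kappa> j) j x)"
    proof (intro affine_over_sum_const affine_over_member)
      fix j assume j: "j \<in> {..<fst (snd g)}"
      then have "\<kappa> j < N" using i(3) by (auto simp: cells_def)
      then show "pen (\<kappa> j) j \<in> feature_layer" using j d by (auto simp: feature_layer_def)
      show "\<bar>- (2 * C)\<bar> \<le> M" using M(6) C0 by simp
    qed simp
    from affine_over_add[OF affine_over_add[OF 1 2] 3]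
    show "affine_over feature_layer M (1 + card ?\<Xi> + n) ((\<lambda>(g, \<kappa>) x. C + (\<Sum>\<xi>\<in>?\<Xi>. co g \<kappa> \<xi> * feat \<xi> x)
         + (\<Sum>j<fst (snd g). (- (2 * C)) * pen (\<kappa> j) j x)) i)"
      using d by (elim affine_over_eqI) (auto simp: i)
  next
    fix i x show "(\<lambda>(g, \<kappa>). cell g \<kappa>) i x = max 0 ((\<lambda>(g, \<kappa>) x. C + (\<Sum>\<xi>\<in>?\<Xi>. co g \<kappa> \<xi> * feat \<xi> x)
         + (\<Sum>j<fst (snd g). (- (2 * C)) * pen (\<kappa> j) j x)) i x)"
      by (simp add: case_prod_unfold cell_def sum_negf)
  next
    have "card ?I = (\<Sum>g\<in>targets. card (cells (fst (snd g))))"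
      using card_cells finite_targets by (intro card_SigmaI) auto
    also have "\<dots> \<le> (\<Sum>g\<in>targets. w)" by (intro sum_mono card_cells) (auto simp: targets_def)
    finally have "card ?I \<le> 2 * P * n * w" by (simp add: card_targets)
    then have "card ?I * (1 + card ?\<Xi> + n) \<le> 2 * P * n * w * (1 + card ?\<Xi> + n)" by (rule mult_le_mono1)
    then show "card ?I * (1 + card ?\<Xi> + n) \<le> 2 * P * n * (1 + card ?\<Xi> + n) * w" by (simp only: mult_ac)
  qed (use finite_targets card_cells in auto)
  have T: "relu_layer feature_layer M n (tpos ` {..<n})" by (rule tpos_carry) (auto simp: feature_layer_def)
  have "n \<le> n * w" using w1 by simp
  then have "2 * P * n * (1 + card ?\<Xi> + n) * w + n \<le> (2 * P * n * (1 + card ?\<Xi> + n) + n) * w"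
    by (simp add: add_mult_distrib)
  with relu_layer_Un[OF A T] show ?thesis
    unfolding cell_layer_def by (auto elim: relu_layer_mono)
qed

lemma strip_affine:
  assumes g: "g \<in> targets" and e: "\<bar>e\<bar> = H"
  shows "affine_over cell_layer M (4 * w) (\<lambda>x. 1 + e / 2 - e * (tpos (fst (snd g)) x - approx g x))"
proof -
  have d: "fst (snd g) < n" using g by (auto simp: targets_def)
  have HM: "\<bar>e\<bar> \<le> M" "\<bar>- e\<bar> \<le> M" 
  proof -
    have "0 \<le> H * C" using H0 C0 by simp
    then show "\<bar>e\<bar> \<le> M" "\<bar>- e\<bar> \<le> M" using e M(5) H0 by linarith+
  qed
  have "\<bar>1 + e / 2 - e * C\<bar> \<le> 1 + \<bar>e / 2\<bar> + \<bar>e * C\<bar>" by linarith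
  also have "\<dots> \<le> M" using e M(5) H0 C0 by (simp add: abs_mult)
  finally have 1: "affine_over cell_layer M 1 (\<lambda>x. 1 + e / 2 - e * C)" by (rule affine_over_const)
  have 2: "affine_over cell_layer M 1 (\<lambda>x. (- e) * tpos (fst (snd g)) x)"
    using d HM by (intro affine_over_member) (auto simp: cell_layer_def)
  have 3: "affine_over cell_layer M (card (cells (fst (snd g))) * 1) (\<lambda>x. \<Sum>\<kappa>\<in>cells (fst (snd g)). e * cell g \<kappa> x)"
    using HM g card_cells by (intro affine_over_sum_const affine_over_member) (auto simp: cell_layer_def image_iff)
  have "1 + 1 + card (cells (fst (snd g))) * 1 \<le> 4 * w" using card_cells(2)[OF d] w1 by simp
  with affine_over_add[OF affine_over_add[OF 1 2] 3] show ?thesis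
    by (rule affine_over_eqI) (simp add: approx_def algebra_simps sum_distrib_left)
qed

lemma relu_strip_layer: "relu_layer cell_layer M (8 * P * n * w) strip_layer"
proof -
  have c: "card ({..<P} \<times> {..<n}) * (4 * w) \<le> 4 * P * n * w" by simp
  have 1: "relu_layer cell_layer M (4 * P * n * w) ((\<lambda>(a, i). low a i) ` ({..<P} \<times> {..<n}))"
  proof (rule relu_layer_family[OF _ _ _ c, where
      h = "\<lambda>(a, i) x. 1 + H / 2 - H * (tpos i x - approx (a, i, False) x)"])
    fix i assume "i \<in> {..<P} \<times> {..<n}"
    then show "affine_over cell_layer M (4 * w) ((\<lambda>(a, i) x. 1 + H / 2 - H * (tpos i x - approx (a, i, False) x)) i)"
      using strip_affine[of "(fst i, snd i, False)" H] H0 by (auto simp: targets_def)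
  qed (auto simp: low_def algebra_simps)
  have 2: "relu_layer cell_layer M (4 * P * n * w) ((\<lambda>(a, i). high a i) ` ({..<P} \<times> {..<n}))"
  proof (rule relu_layer_family[OF _ _ _ c, where
      h = "\<lambda>(a, i) x. 1 + (- H) / 2 - (- H) * (tpos i x - approx (a, i, True) x)"])
    fix i assume "i \<in> {..<P} \<times> {..<n}"
    then show "affine_over cell_layer M (4 * w) ((\<lambda>(a, i) x. 1 + (- H) / 2 - (- H) * (tpos i x - approx (a, i, True) x)) i)"
      using strip_affine[of "(fst i, snd i, True)" "- H"] H0 by (auto simp: targets_def)
  qed (auto simp: high_def algebra_simps)
  show ?thesis unfolding strip_layer_def by (rule relu_layer_mono[OF relu_layer_Un[OF 1 2]]) auto
qed

lemma relu_psi_layer: "relu_layer strip_layer M (P * (1 + 2 * n) * w) (psi ` {..<P})"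
proof (rule relu_layer_family)
  fix a assume a: "a \<in> {..<P}"
  have 1: "affine_over strip_layer M 1 (\<lambda>x. 1)" using M1 by (intro affine_over_const) auto
  have 2: "affine_over strip_layer M (card {..<n} * 2) (\<lambda>x. \<Sum>i<n. (-1) * low a i x + (-1) * high a i x)"
  proof (intro affine_over_sum_const)
    fix i assume i: "i \<in> {..<n}"
    have 1: "affine_over strip_layer M 1 (\<lambda>x. (-1) * low a i x)"
      using a i M1 by (intro affine_over_member) (auto simp: strip_layer_def)
    have 2: "affine_over strip_layer M 1 (\<lambda>x. (-1) * high a i x)"
      using a i M1 by (intro affine_over_member) (auto simp: strip_layer_def)
    from affine_over_add[OF 1 2] show "affine_over strip_layer M 2 (\<lambda>x. (-1) * low a i x + (-1) * high a i x)"
      by (simp add: numeral_2_eq_2)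
  qed simp
  from affine_over_add[OF 1 2]
  show "affine_over strip_layer M (1 + 2 * n) (\<lambda>x. 1 + (\<Sum>i<n. (-1) * low a i x + (-1) * high a i x))"
    by (rule affine_over_eqI) auto
  show "psi a x = max 0 (1 + (\<Sum>i<n. (-1) * low a i x + (-1) * high a i x))" for x
    by (simp add: psi_def sum_subtractf sum.distrib sum_negf)
next
  show "card {..<P} * (1 + 2 * n) \<le> P * (1 + 2 * n) * w" using w1 by simp
qed simp

lemma relu_outside_layer: "relu_layer (psi ` {..<P}) M ((1 + P) * w) {outside}"
proof -
  have "relu_layer (psi ` {..<P}) M ((1 + P) * w) ((\<lambda>_::unit. outside) ` {()})"
  proof (rule relu_layer_family[where k = "1 + P"])
    have 1: "affine_over (psi ` {..<P}) M 1 (\<lambda>x. 1)" using M1 by (intro affine_over_const) auto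
    have 2: "affine_over (psi ` {..<P}) M (card {..<P} * 1) (\<lambda>x. \<Sum>a<P. (-1) * psi a x)"
      using M1 by (intro affine_over_sum_const affine_over_member) auto
    from affine_over_add[OF 1 2] show "affine_over (psi ` {..<P}) M (1 + P) (\<lambda>x. 1 - (\<Sum>a<P. psi a x))"
      by (rule affine_over_eqI) (auto simp: sum_negf)
    have "(1 + P) * 1 \<le> (1 + P) * w" using w1 by (intro mult_le_mono) auto
    then show "card {()} * (1 + P) \<le> (1 + P) * w" by simp
  qed (auto simp: outside_def)
  then show ?thesis by simp
qed

text \<open>
  One summand per kind of layer, in units of \<open>w\<close>. What matters is that it does not depend on \<open>N\<close>.
\<close>

definition net_cost :: nat where
  "net_cost = (2 * n + L * ((15 + 3 * L) * n)) + (card (features n L q) * q * (q + 1) + 5 * n)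
     + (card (features n L q) * (q + 1) + 3 * n) + (2 * P * n * (1 + card (features n L q) + n) + n)
     + 8 * P * n + P * (1 + 2 * n) + (1 + P)"

lemma computes_outside: "computes n M (2 * L + 7) (net_cost * w) {outside}"
proof -
  have step: "computes n M (Suc i) ((c + k) * w) G"
    if "computes n M i (c * w) F" "relu_layer F M (k * w) G" for i c k F G
    using computes_Suc[OF that order_refl] by (simp only: add_mult_distrib)
  have "computes n M (Suc (Suc (Suc (Suc (Suc (Suc (1 + 2 * L))))))) (net_cost * w) {outside}"
    unfolding net_cost_def
    by (rule step[OF step[OF step[OF step[OF step[OF step[OF computes_state[OF order_refl]
        relu_power_layer] relu_feature_layer] relu_cell_layer] relu_strip_layer] relu_psi_layer]
        relu_outside_layer])
  moreover have eq: "Suc (Suc (Suc (Suc (Suc (Suc (1 + 2 * L)))))) = 2 * L + 7" by simp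
  ultimately show ?thesis unfolding eq by blast
qed

lemma net_realization:
  "\<exists>\<Phi>. is_network n 1 \<Phi> \<and> net_depth \<Phi> = 2 * L + 7 \<and> net_size \<Phi> \<le> (net_cost + 2) * w \<and>
    net_max \<Phi> \<le> real ((net_cost + 2) * w) * M \<and> net_fun n \<Phi> = net"
proof -
  have 1: "affine_over {outside} M 1 (\<lambda>x. 1)" using M1 by (intro affine_over_const) auto
  have 2: "affine_over {outside} M 1 (\<lambda>x. (-1) * outside x)" using M1 by (intro affine_over_member) auto
  have "affine_over {outside} M 2 net"
    by (rule affine_over_eqI[OF affine_over_add[OF 1 2]]) (auto simp: net_def)
  then have aff: "affine_over {outside} M (2 * w) net" by (rule affine_over_eqI) (use w1 in auto)
  have "1 \<le> n" "0 \<le> M" "1 \<le> 2 * L + 7" using n M1 by auto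
  from network_of_computes[OF this computes_outside aff] show ?thesis
    unfolding add_mult_distrib[symmetric] .
qed

end


section \<open>Values of the network off the exceptional set\<close>

text \<open>
  Measurability of the network is read off from its layers, since the matrices are no longer
  visible at this point.
\<close>

lemma row_eval_measurable:
  "row_over F M r \<Longrightarrow> (\<And>f. f \<in> F \<Longrightarrow> f \<in> borel_measurable A) \<Longrightarrow> row_eval r \<in> borel_measurable A"
proof (induction r)
  case Nil
  then show ?case by (simp add: row_eval_def[abs_def])
next
  case (Cons a r)
  obtain c f where a: "a = (c, f)" by force
  have r: "row_eval r \<in> borel_measurable A" using Cons by (auto simp: row_over_def)
  have eq: "row_eval (a # r) = (\<lambda>x. c * (case f of None \<Rightarrow> 1 | Some g \<Rightarrow> g x) + row_eval r x)"
    by (simp add: row_eval_def a fun_eq_iff)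
  show ?case
  proof (cases f)
    case None
    then show ?thesis unfolding eq using r by simp
  next
    case (Some g)
    then have "g \<in> borel_measurable A" using Cons.prems by (auto simp: row_over_def a)
    then show ?thesis unfolding eq Some using r by simp
  qed
qed

lemma computes_measurable:
  "computes n M i S F \<Longrightarrow> f \<in> F \<Longrightarrow> f \<in> borel_measurable (leb n)"
proof (induction i arbitrary: S F f)
  case 0
  then obtain j where "f = (\<lambda>x. x j)" "j < n" by auto
  then show ?case using measurable_component_singleton[of j "{..<n}" "\<lambda>_. lborel :: real measure"] by simp
next
  case (Suc i)
  then obtain F' S' s where F': "computes n M i S' F'" "relu_layer F' M s F" by auto
  then obtain h k where h: "affine_over F' M k h" "f = (\<lambda>x. max 0 (h x))"
    using Suc.prems(2) unfolding relu_layer_def by blast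
  then obtain r where r: "row_over F' M r" "h = row_eval r" unfolding affine_over_def by blast
  have "row_eval r \<in> borel_measurable (leb n)"
    using r(1) Suc.IH[OF F'(1)] by (rule row_eval_measurable)
  then show ?case unfolding h(2) r(2) by simp
qed

context relu_construction
begin

lemma net_measurable: "net \<in> borel_measurable (leb n)"
proof -
  have "outside \<in> borel_measurable (leb n)" using computes_measurable[OF computes_outside] by simp
  then show ?thesis unfolding net_def[abs_def] by simp
qed

text \<open>
  This holds at every point, also where intermediate values are meaningless.
\<close>

lemma net_range: "net x \<in> {0..1}"
proof -
  have "0 \<le> (\<Sum>a<P. psi a x)" by (intro sum_nonneg) (simp add: psi_def)
  then show ?thesis by (simp add: net_def outside_def)
qed

definition good :: "(nat \<Rightarrow> real) \<Rightarrow> bool" where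
  "good x \<longleftrightarrow> (\<forall>j<n. off_grid (w ^ L) K (x j + 1/2))"

text \<open>
  The number formed by the first \<open>L\<close> digits of the shifted coordinate.
\<close>

definition truncated :: "(nat \<Rightarrow> real) \<Rightarrow> nat \<Rightarrow> real" where
  "truncated x j = (\<Sum>l<L. zval (Some (l, j)) x / real w ^ Suc l)"

lemma tpos_good: "good x \<Longrightarrow> j < n \<Longrightarrow> tpos j x = x j + 1/2"
  by (auto simp: good_def tpos_def off_grid_def)

lemma dg_good: "good x \<Longrightarrow> j < n \<Longrightarrow> l < L \<Longrightarrow> \<exists>b<w. dg l j x = real b"
  using digit_expansion[OF w1 K0, of L "x j + 1/2" L] by (auto simp: good_def dg_def rm_def)

lemma truncated_good:
  assumes "good x" "j < n"
  shows "0 \<le> truncated x j" "truncated x j \<le> x j + 1/2" "x j + 1/2 - truncated x j \<le> 1 / real w ^ L"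
proof -
  have "x j + 1/2 = (\<Sum>l<L. digit w K (remainder w K l (x j + 1/2)) / real w ^ Suc l)
      + remainder w K L (x j + 1/2) / real w ^ L" "remainder w K L (x j + 1/2) < 1"
    using digit_expansion[OF w1 K0, of L "x j + 1/2" L] assms by (auto simp: good_def)
  then have eq: "x j + 1/2 = truncated x j + rm L j x / real w ^ L" "rm L j x < 1"
    by (simp_all add: truncated_def zval_def dg_def rm_def)
  have wp: "0 < real w ^ L" using w1 by simp
  have r: "0 \<le> rm L j x / real w ^ L" "rm L j x / real w ^ L \<le> 1 / real w ^ L"
    using rm_nonneg[of L j x] eq(2) wp by (auto intro!: divide_right_mono)
  show "0 \<le> truncated x j"
    unfolding truncated_def by (intro sum_nonneg) (simp add: zval_def dg_nonneg)
  show "truncated x j \<le> x j + 1/2" "x j + 1/2 - truncated x j \<le> 1 / real w ^ L"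
    using eq(1) r by linarith+
qed

lemma argsum_good:
  assumes x: "good x" and \<xi>: "\<xi> \<in> features n L q"
  shows "\<exists>s\<le>q * w. argsum \<xi> x = real s"
proof -
  have S: "snd \<xi> \<subseteq> {..<q}" and v: "\<And>i. i \<in> snd \<xi> \<Longrightarrow> fst \<xi> i \<in> digit_vars n L"
    using \<xi> by (auto simp: features_def PiE_def Pi_def)
  have "\<exists>b\<le>w. zval v x = real b" if "v \<in> digit_vars n L" for v
    using that dg_good[OF x] w1 by (force simp: digit_vars_def zval_def intro: less_imp_le)
  then have "\<forall>i\<in>snd \<xi>. \<exists>b. b \<le> w \<and> zval (fst \<xi> i) x = real b" using v by blast
  then obtain b where b: "\<And>i. i \<in> snd \<xi> \<Longrightarrow> b i \<le> w \<and> zval (fst \<xi> i) x = real (b i)"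
    using bchoice by metis
  have "argsum \<xi> x = real (\<Sum>i\<in>snd \<xi>. b i)" using b by (simp add: argsum_def)
  moreover have "(\<Sum>i\<in>snd \<xi>. b i) \<le> (\<Sum>i\<in>snd \<xi>. w)" using b by (intro sum_mono) auto
  moreover have "(\<Sum>i\<in>snd \<xi>. w) \<le> q * w" using card_mono[OF _ S] by simp
  ultimately show ?thesis using order_trans by blast
qed

lemma feat_good:
  assumes "good x" "\<xi> \<in> features n L q"
  shows "feat \<xi> x = argsum \<xi> x ^ q"
proof -
  obtain s where s: "s \<le> q * w" "argsum \<xi> x = real s" using argsum_good[OF assms] by blast
  have "feat \<xi> x = max 0 (real s ^ q)"
    using relu_interpolation[OF s(1), of "\<lambda>s. real s ^ q"] by (simp only: feat_def pramp_def s(2))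
  then show ?thesis by (simp add: s(2))
qed

text \<open>
  The points \<open>k / N\<close> belong to the grid of mesh \<open>1 / w ^ L\<close> because \<open>N\<close> divides \<open>w ^ L\<close>. A good point
  therefore keeps distance \<open>1 / K\<close> from them.
\<close>

lemma pen_good:
  assumes x: "good x" and L: "L \<ge> 1" and k: "k < N" and j: "j < n"
  shows "real k \<le> real N * (x j + 1/2) \<and> real N * (x j + 1/2) < real k + 1 \<Longrightarrow> pen k j x = 0"
    and "\<not> (real k \<le> real N * (x j + 1/2) \<and> real N * (x j + 1/2) < real k + 1) \<Longrightarrow> 1 \<le> pen k j x"
proof -
  define t where "t = x j + 1/2"
  have t: "off_grid (w ^ L) K t" using x j by (simp add: good_def t_def)
  have tp: "tpos j x = t" using tpos_good[OF x j] by (simp add: t_def)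
  have Np: "0 < real N" using N by simp
  have "N dvd w ^ L" unfolding w_eq power_mult[symmetric] using L n by (intro dvd_power) auto
  then obtain W' where W': "w ^ L = N * W'" by (auto simp: dvd_def)
  have "0 < w ^ L" using w1 by simp
  then have W'0: "0 < W'" unfolding W' by simp
  have far: "1 \<le> K * \<bar>t - real u / real N\<bar>" if "u \<le> N" for u
  proof -
    have "u * W' \<le> w ^ L" unfolding W' using that by simp
    then have "1 / K \<le> \<bar>t - real (u * W') / real (w ^ L)\<bar>" using t unfolding off_grid_def by blast
    also have "real (u * W') / real (w ^ L) = real u / real N"
      using W'0 unfolding W' by simp
    finally show ?thesis using K0 by (simp add: divide_le_eq mult.commute)
  qed
  have e1: "below k j x = max 0 (1 - K * (t - real k / real N))"
    by (simp add: below_def tp algebra_simps)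
  have e2: "above k j x = max 0 (1 - K * (real (k + 1) / real N - t))"
    by (simp add: above_def tp algebra_simps)
  {
    assume "real k \<le> real N * (x j + 1/2) \<and> real N * (x j + 1/2) < real k + 1"
    then have "0 \<le> t - real k / real N" "0 \<le> real (k + 1) / real N - t"
      using Np by (auto simp: t_def[symmetric] field_simps)
    then have "1 \<le> K * (t - real k / real N)" "1 \<le> K * (real (k + 1) / real N - t)"
      using far[of k] far[of "k + 1"] k by (auto simp: abs_if split: if_splits)
    then show "pen k j x = 0" by (simp add: pen_def e1 e2)
  next
    assume "\<not> (real k \<le> real N * (x j + 1/2) \<and> real N * (x j + 1/2) < real k + 1)"
    then have "t - real k / real N < 0 \<or> real (k + 1) / real N - t \<le> 0"
      using Np by (auto simp: t_def[symmetric] field_simps)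
    then have "K * (t - real k / real N) \<le> 0 \<or> K * (real (k + 1) / real N - t) \<le> 0"
      using K0 by (auto simp: mult_le_0_iff)
    then have "1 \<le> below k j x \<or> 1 \<le> above k j x" unfolding e1 e2 by auto
    moreover have "0 \<le> below k j x" "0 \<le> above k j x" unfolding e1 e2 by auto
    ultimately show "1 \<le> pen k j x" by (auto simp: pen_def)
  }
qed

definition cell_of :: "nat \<Rightarrow> (nat \<Rightarrow> real) \<Rightarrow> nat \<Rightarrow> nat" where
  "cell_of d x = (\<lambda>j\<in>{..<d}. nat \<lfloor>real N * (x j + 1/2)\<rfloor>)"

text \<open>
  At a good point exactly one cell is switched on.
\<close>

lemma approx_good:
  assumes x: "good x" and L: "L \<ge> 1" and g: "g \<in> targets"
    and p: "\<And>\<kappa>. \<kappa> \<in> cells (fst (snd g)) \<Longrightarrow> \<bar>p \<kappa>\<bar> \<le> C \<and>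
       (\<Sum>\<xi>\<in>features n L q. co g \<kappa> \<xi> * argsum \<xi> x ^ q) = p \<kappa>"
  shows "cell_of (fst (snd g)) x \<in> cells (fst (snd g))"
    and "approx g x = p (cell_of (fst (snd g)) x)"
proof -
  define d where "d = fst (snd g)"
  have d: "d < n" using g by (auto simp: targets_def d_def)
  have t: "0 \<le> x j + 1/2" "x j + 1/2 < 1" if "j < d" for j
    using x that d off_grid_less_1[of "w ^ L" K "x j + 1/2"] K0 w1 by (auto simp: good_def off_grid_def)
  have fl: "real (nat \<lfloor>real N * (x j + 1/2)\<rfloor>) \<le> real N * (x j + 1/2)"
      "real N * (x j + 1/2) < real (nat \<lfloor>real N * (x j + 1/2)\<rfloor>) + 1"
      "nat \<lfloor>real N * (x j + 1/2)\<rfloor> < N" if "j < d" for j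
  proof -
    have 0: "0 \<le> real N * (x j + 1/2)" using t(1)[OF that] by simp
    then show 1: "real (nat \<lfloor>real N * (x j + 1/2)\<rfloor>) \<le> real N * (x j + 1/2)"
      and "real N * (x j + 1/2) < real (nat \<lfloor>real N * (x j + 1/2)\<rfloor>) + 1" by linarith+
    have "real N * (x j + 1/2) < real N * 1" using t(2)[OF that] N by (intro mult_strict_left_mono) auto
    then show "nat \<lfloor>real N * (x j + 1/2)\<rfloor> < N" using 1 by linarith
  qed
  define \<kappa>0 where "\<kappa>0 = cell_of d x"
  have \<kappa>0: "\<kappa>0 \<in> cells d" using fl(3) by (auto simp: \<kappa>0_def cells_def cell_of_def)
  then show "cell_of (fst (snd g)) x \<in> cells (fst (snd g))" by (simp add: \<kappa>0_def d_def)
  have cell: "cell g \<kappa> x = (if \<kappa> = \<kappa>0 then C + p \<kappa>0 else 0)" if \<kappa>: "\<kappa> \<in> cells d" for \<kappa>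
  proof -
    have pk: "\<bar>p \<kappa>\<bar> \<le> C" "(\<Sum>\<xi>\<in>features n L q. co g \<kappa> \<xi> * feat \<xi> x) = p \<kappa>"
      using p[of \<kappa>] \<kappa> by (simp_all add: d_def feat_good[OF x] cong: sum.cong)
    have kN: "\<kappa> j < N" if "j < d" for j using \<kappa> that by (auto simp: cells_def)
    have eq: "cell g \<kappa> x = max 0 (C + p \<kappa> - (\<Sum>j<d. 2 * C * pen (\<kappa> j) j x))"
      by (simp add: cell_def pk(2) d_def)
    show ?thesis
    proof (cases "\<kappa> = \<kappa>0")
      case True
      have "pen (\<kappa> j) j x = 0" if "j < d" for j
        using pen_good(1)[OF x L kN[OF that], of j] that d fl[OF that]
        by (simp add: True \<kappa>0_def cell_of_def)
      then show ?thesis unfolding eq using True pk(1) by simp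
    next
      case False
      then obtain j where j: "j < d" "\<kappa> j \<noteq> \<kappa>0 j"
        using \<kappa> \<kappa>0 unfolding cells_def by (metis PiE_ext lessThan_iff)
      have "1 \<le> pen (\<kappa> j) j x"
      proof (rule pen_good(2)[OF x L kN[OF j(1)]])
        show "j < n" using j d by simp
        show "\<not> (real (\<kappa> j) \<le> real N * (x j + 1/2) \<and> real N * (x j + 1/2) < real (\<kappa> j) + 1)"
        proof
          assume "real (\<kappa> j) \<le> real N * (x j + 1/2) \<and> real N * (x j + 1/2) < real (\<kappa> j) + 1"
          then have "\<kappa> j = nat \<lfloor>real N * (x j + 1/2)\<rfloor>" using fl(1,2)[OF j(1)] by linarith
          then show False using j by (simp add: \<kappa>0_def cell_of_def)
        qed
      qed
      then have "2 * C * 1 \<le> 2 * C * pen (\<kappa> j) j x" using C0 by (intro mult_left_mono) auto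
      also have "\<dots> \<le> (\<Sum>j<d. 2 * C * pen (\<kappa> j) j x)"
        using j C0 by (intro member_le_sum) (auto simp: pen_def)
      finally have "C + p \<kappa> - (\<Sum>j<d. 2 * C * pen (\<kappa> j) j x) \<le> 0" using pk(1) by (simp add: abs_le_iff)
      then show ?thesis unfolding eq using False by simp
    qed
  qed
  have "(\<Sum>\<kappa>\<in>cells d. cell g \<kappa> x) = (\<Sum>\<kappa>\<in>cells d. if \<kappa> = \<kappa>0 then C + p \<kappa>0 else 0)"
    using cell by (intro sum.cong) auto
  also have "\<dots> = C + p \<kappa>0" using \<kappa>0 card_cells(1)[of d] by (simp add: sum.delta)
  finally show "approx g x = p (cell_of (fst (snd g)) x)" by (simp add: approx_def d_def \<kappa>0_def)
qed

text \<open>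
  An error \<open>\<delta>\<close> of the approximations is harmless where \<open>x i\<close> keeps distance \<open>\<delta> + 1 / H\<close> from the
  bounding values: each comparison then gives 0 or at least 1, correctly. The function \<open>psi a\<close>
  is the conjunction of the comparisons, and the last two layers form the disjunction over \<open>a\<close>.
\<close>

lemma net_exact:
  assumes x: "good x"
    and F: "\<And>a i. a < P \<Longrightarrow> i < n \<Longrightarrow> \<bar>approx (a, i, False) x - F a i\<bar> \<le> \<delta> \<and> \<bar>x i - F a i\<bar> \<ge> \<delta> + 1 / H"
    and G: "\<And>a i. a < P \<Longrightarrow> i < n \<Longrightarrow> \<bar>approx (a, i, True) x - G a i\<bar> \<le> \<delta> \<and> \<bar>x i - G a i\<bar> \<ge> \<delta> + 1 / H"
  shows "net x = (if \<exists>a<P. \<forall>i<n. F a i < x i \<and> x i < G a i then 1 else 0)"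
proof -
  have ramp: "(0 < y \<longrightarrow> max 0 (1 - H * z) = 0) \<and> (\<not> 0 < y \<longrightarrow> 1 \<le> max 0 (1 - H * z))"
    if "\<bar>z - y\<bar> \<le> \<delta>" "\<bar>y\<bar> \<ge> \<delta> + 1 / H" for y z
  proof -
    have H1: "0 < 1 / H" using H0 by simp
    have "1 / H \<le> z" if "0 < y" using that \<open>\<bar>z - y\<bar> \<le> \<delta>\<close> \<open>\<bar>y\<bar> \<ge> \<delta> + 1 / H\<close> by linarith
    then have "1 \<le> H * z" if "0 < y" using that H0 by (simp add: divide_le_eq mult.commute)
    moreover have "z \<le> 0" if "\<not> 0 < y" using that \<open>\<bar>z - y\<bar> \<le> \<delta>\<close> \<open>\<bar>y\<bar> \<ge> \<delta> + 1 / H\<close> H1 by linarith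
    then have "H * z \<le> 0" if "\<not> 0 < y" using that H0 by (simp add: mult_le_0_iff)
    ultimately show ?thesis by auto
  qed
  have low: "(F a i < x i \<longrightarrow> low a i x = 0) \<and> (\<not> F a i < x i \<longrightarrow> 1 \<le> low a i x)" if ai: "a < P" "i < n" for a i
    using ramp[of "x i - approx (a, i, False) x" "x i - F a i"] F[OF ai] tpos_good[OF x ai(2)]
    by (simp add: low_def abs_minus_commute)
  have high: "(x i < G a i \<longrightarrow> high a i x = 0) \<and> (\<not> x i < G a i \<longrightarrow> 1 \<le> high a i x)" if ai: "a < P" "i < n" for a i
    using ramp[of "approx (a, i, True) x - x i" "G a i - x i"] G[OF ai] tpos_good[OF x ai(2)]
    by (simp add: high_def abs_minus_commute)
  have nn: "0 \<le> low a i x + high a i x" for a i by (simp add: low_def high_def)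
  have psi: "psi a x = (if \<forall>i<n. F a i < x i \<and> x i < G a i then 1 else 0)" if a: "a < P" for a
  proof (cases "\<forall>i<n. F a i < x i \<and> x i < G a i")
    case True
    then have "(\<Sum>i<n. low a i x + high a i x) = 0" using low[OF a] high[OF a] by (intro sum.neutral) auto
    then show ?thesis using True by (simp add: psi_def)
  next
    case False
    then obtain i where i: "i < n" "\<not> (F a i < x i \<and> x i < G a i)" by blast
    have "1 \<le> low a i x + high a i x"
      using low[OF a i(1)] high[OF a i(1)] i(2) by (auto simp: low_def high_def)
    also have "\<dots> \<le> (\<Sum>i<n. low a i x + high a i x)"
      using i nn by (intro member_le_sum) auto
    finally show ?thesis using False by (simp add: psi_def)
  qed
  show ?thesis
  proof (cases "\<exists>a<P. \<forall>i<n. F a i < x i \<and> x i < G a i")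
    case True
    then obtain a where a: "a < P" "\<forall>i<n. F a i < x i \<and> x i < G a i" by blast
    have "1 = psi a x" using psi[OF a(1)] a(2) by simp
    also have "\<dots> \<le> (\<Sum>a<P. psi a x)" using a by (intro member_le_sum) (auto simp: psi_def)
    finally show ?thesis using True by (simp add: net_def outside_def)
  next
    case False
    then have "(\<Sum>a<P. psi a x) = 0" using psi by (intro sum.neutral) auto
    then show ?thesis using False by (simp add: net_def outside_def)
  qed
qed

end


section \<open>Regions between smooth graphs\<close>

definition network_bounds :: "nat \<Rightarrow> nat \<Rightarrow> nat \<Rightarrow> real \<Rightarrow> network \<Rightarrow> bool" where
  "network_bounds n D S M \<Phi> \<longleftrightarrow> is_network n 1 \<Phi> \<and> net_depth \<Phi> = D \<and> net_size \<Phi> \<le> S \<and> net_max \<Phi> \<le> M \<and>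
     (\<forall>x. net_fun n \<Phi> x \<in> {0..1}) \<and> net_fun n \<Phi> \<in> borel_measurable (leb n)"

definition exact_off_strips ::
    "nat \<Rightarrow> nat \<Rightarrow> real \<Rightarrow> real \<Rightarrow> nat \<Rightarrow> (nat \<Rightarrow> nat \<Rightarrow> rfun) \<Rightarrow> (nat \<Rightarrow> nat \<Rightarrow> rfun) \<Rightarrow> rfun \<Rightarrow> bool" where
  "exact_off_strips n W K \<sigma> P F G u \<longleftrightarrow>
     (\<forall>x\<in>Qn n. (\<forall>j<n. off_grid W K (x j + 1/2)) \<longrightarrow>
        (\<forall>a<P. \<forall>i<n. \<sigma> < \<bar>x i - F a i x\<bar> \<and> \<sigma> < \<bar>x i - G a i x\<bar>) \<longrightarrow>
        u x = (if \<exists>a<P. \<forall>i<n. F a i x < x i \<and> x i < G a i x then 1 else 0))"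

text \<open>
  With slopes \<open>K = w ^ L * N ^ m\<close> and \<open>H = N ^ m\<close>, the Taylor polynomial at the corner of the cell of
  \<open>x\<close> is evaluated at the truncated point \<open>y\<close>, which is within \<open>1 / N ^ m\<close> of \<open>x\<close> and within \<open>2 / N\<close> of
  the corner. The error is \<open>C1 * (2 / N) ^ m\<close> by Taylor plus \<open>C1 / N ^ m\<close> by the Lipschitz
  bound.
\<close>

lemma network_at_scale:
  fixes n m P :: nat and C1 :: real
  assumes n: "n \<ge> 2" and m: "m \<ge> 1" and C1: "C1 \<ge> 1"
    and L: "L \<ge> 1" "m \<le> (n - 1) * L"
  shows "\<exists>c e :: nat. \<forall>N\<ge>1. \<forall>F G.
     (\<forall>a<P. \<forall>i<n. locally_poly i m C1 (F a i) \<and> locally_poly i m C1 (G a i)) \<longrightarrow>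
     (\<exists>\<Phi>. network_bounds n (2 * L + 7) (c * N ^ (n - 1)) (real c * real N ^ e) \<Phi> \<and>
        exact_off_strips n ((N ^ (n - 1)) ^ L) (real ((N ^ (n - 1)) ^ L * N ^ m))
          ((C1 * (1 + 2 ^ m) + 1) / real N ^ m) P F G (net_fun n \<Phi>))"
proof -
  define \<sigma> where "\<sigma> N = (C1 * (1 + 2 ^ m) + 1) / real N ^ m" for N :: nat
  define W where "W N = (N ^ (n - 1)) ^ L" for N :: nat
  define q where "q = m - 1"
  have mq: "m = Suc q" using m by (simp add: q_def)
  define C where "C = C1 * C1"
  have C0: "0 \<le> C" using C1 by (simp add: C_def)
  \<comment> \<open>\<open>M \<le> b * N ^ e0\<close> below bounds the row entries; the further factor \<open>N ^ (n - 1)\<close> in \<open>e\<close> comes from the size\<close>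
  define b where "b = nat \<lceil>5 + real q + 4 * real q ^ q + 3 * C\<rceil>"
  define c where "c = (relu_construction.net_cost n q L P + 2) * b"
  define e0 where "e0 = (n - 1) * (L + q) + m"
  define e where "e = e0 + (n - 1)"
  have b1: "5 + real q + 4 * real q ^ q + 3 * C \<le> real b" by (simp add: b_def of_nat_ceiling)
  have main: "\<exists>\<Phi>. network_bounds n (2 * L + 7) (c * N ^ (n - 1)) (real c * real N ^ e) \<Phi> \<and>
      exact_off_strips n (W N) (real (W N * N ^ m)) (\<sigma> N) P F G (net_fun n \<Phi>)"
    if N: "N \<ge> 1" and lp: "\<forall>a<P. \<forall>i<n. locally_poly i m C1 (F a i) \<and> locally_poly i m C1 (G a i)"
    for N F G
  proof -
    define w where "w = N ^ (n - 1)"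
    define K where "K = real (w ^ L * N ^ m)"
    define H where "H = real N ^ m"
    define M where "M = (K + 1) + real w + real (q * w) + 4 * real (q * w) ^ q + (1 + H + H * C) + 2 * C"
    define T where "T g = (if snd (snd g) then G (fst g) (fst (snd g)) else F (fst g) (fst (snd g)))"
      for g :: "nat \<times> nat \<times> bool"
    have w1: "w \<ge> 1" using N by (simp add: w_def)
    have Np: "0 < real N" using N by simp
    have K0: "0 < K" using N w1 by (simp add: K_def)
    have H0: "0 < H" using N by (simp add: H_def)
    define corner where "corner \<kappa> j = real (\<kappa> j) / real N - 1/2" for \<kappa> :: "nat \<Rightarrow> nat" and j :: nat
    define ok where "ok g \<longleftrightarrow> fst g < P \<and> fst (snd g) < n" for g :: "nat \<times> nat \<times> bool"
    have lpT: "locally_poly (fst (snd g)) m C1 (T g)" if "ok g" for g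
      using lp that by (auto simp: T_def ok_def)
    have corner: "corner \<kappa> \<in> cube d" if "\<kappa> \<in> {..<d} \<rightarrow>\<^sub>E {..<N}" for \<kappa> d
    proof -
      have "\<bar>corner \<kappa> j\<bar> \<le> 1/2" if j: "j < d" for j
      proof -
        have "\<kappa> j < N" using \<open>\<kappa> \<in> _\<close> j by auto
        then have "0 \<le> real (\<kappa> j) / real N" "real (\<kappa> j) / real N \<le> 1" by (auto simp: divide_le_eq)
        then show ?thesis unfolding corner_def by linarith
      qed
      then show ?thesis by (simp add: cube_def)
    qed
    define suits where "suits g \<kappa> ts a \<longleftrightarrow> poly_bounded (fst (snd g)) m C1 ts \<and>
        (\<forall>y\<in>cube (fst (snd g)). \<forall>h\<ge>0. (\<forall>i<fst (snd g). \<bar>y i - corner \<kappa> i\<bar> \<le> h) \<longrightarrow>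
           \<bar>T g y - poly_at ts (\<lambda>i. y i - corner \<kappa> i)\<bar> \<le> C1 * h ^ m) \<and>
        (\<forall>z. z None = 1 \<longrightarrow>
           poly_at ts (\<lambda>j. (\<Sum>l<L. z (Some (l, j)) / real w ^ Suc l) - real (\<kappa> j) / real N) =
           (\<Sum>(\<phi>, S)\<in>features n L q. a (\<phi>, S) * (\<Sum>i\<in>S. z (\<phi> i)) ^ q))"
      for g :: "nat \<times> nat \<times> bool" and \<kappa> :: "nat \<Rightarrow> nat" and ts and a
    have "\<exists>ts a. (\<forall>\<xi>. \<bar>a \<xi>\<bar> \<le> C) \<and> (ok g \<and> \<kappa> \<in> {..<fst (snd g)} \<rightarrow>\<^sub>E {..<N} \<longrightarrow> suits g \<kappa> ts a)" for g \<kappa>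
    proof (cases "ok g \<and> \<kappa> \<in> {..<fst (snd g)} \<rightarrow>\<^sub>E {..<N}")
      case False
      then show ?thesis using C0 by (intro exI[of _ "[]"] exI[of _ "\<lambda>_. 0"]) auto
    next
      case True
      let ?d = "fst (snd g)"
      obtain ts where ts: "poly_bounded ?d m C1 ts"
        "\<forall>y\<in>cube ?d. \<forall>h\<ge>0. (\<forall>i<?d. \<bar>y i - corner \<kappa> i\<bar> \<le> h) \<longrightarrow>
           \<bar>T g y - poly_at ts (\<lambda>i. y i - corner \<kappa> i)\<bar> \<le> C1 * h ^ m"
        using lpT[of g] corner[of \<kappa> ?d] True unfolding locally_poly_def by meson
      \<comment> \<open>cells are extensional, hence the cut-off outside the relevant coordinates\<close>
      define \<tau> where "\<tau> j = (if j < ?d then real (\<kappa> j) / real N else 0)" for j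
      have \<tau>: "\<bar>\<tau> j\<bar> \<le> 1" for j
      proof (cases "j < ?d")
        case j: True
        then have "\<kappa> j < N" using True by auto
        then show ?thesis using j by (simp add: \<tau>_def divide_le_eq)
      qed (simp add: \<tau>_def)
      have dn: "?d \<le> n" using True by (simp add: ok_def)
      have C10: "0 \<le> C1" using C1 by simp
      obtain a where a: "\<forall>\<xi>. \<bar>a \<xi>\<bar> \<le> C" "\<forall>z. z None = 1 \<longrightarrow>
           poly_at ts (\<lambda>j. (\<Sum>l<L. z (Some (l, j)) / real w ^ Suc l) - \<tau> j) =
           (\<Sum>(\<phi>, S)\<in>features n L q. a (\<phi>, S) * (\<Sum>i\<in>S. z (\<phi> i)) ^ q)"
        using poly_features[OF ts(1) mq dn w1, of \<tau> L, OF \<tau> C10] unfolding C_def by blast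
      have same: "poly_at ts (\<lambda>j. u j - \<tau> j) = poly_at ts (\<lambda>j. u j - real (\<kappa> j) / real N)" for u
      proof -
        have "map (\<lambda>j. u j - \<tau> j) wd = map (\<lambda>j. u j - real (\<kappa> j) / real N) wd" if "(c, wd) \<in> set ts" for c wd
        proof -
          have "set wd \<subseteq> {..<?d}" using ts(1) that unfolding poly_bounded_def by blast
          then show ?thesis by (intro map_cong refl) (auto simp: \<tau>_def)
        qed
        then show ?thesis unfolding poly_at_def
          by (intro arg_cong[of _ _ sum_list] map_cong refl) (clarify, simp only:)
      qed
      from ts a show ?thesis unfolding same suits_def by blast
    qed
    then have "\<forall>g\<kappa>. \<exists>ta. (\<forall>\<xi>. \<bar>snd ta \<xi>\<bar> \<le> C) \<and>
        (ok (fst g\<kappa>) \<and> snd g\<kappa> \<in> {..<fst (snd (fst g\<kappa>))} \<rightarrow>\<^sub>E {..<N} \<longrightarrow>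
         suits (fst g\<kappa>) (snd g\<kappa>) (fst ta) (snd ta))"
      by (metis fst_conv snd_conv)
    from choice[OF this] obtain ta where ta: "\<forall>g\<kappa>. (\<forall>\<xi>. \<bar>snd (ta g\<kappa>) \<xi>\<bar> \<le> C) \<and>
        (ok (fst g\<kappa>) \<and> snd g\<kappa> \<in> {..<fst (snd (fst g\<kappa>))} \<rightarrow>\<^sub>E {..<N} \<longrightarrow>
         suits (fst g\<kappa>) (snd g\<kappa>) (fst (ta g\<kappa>)) (snd (ta g\<kappa>)))" by blast
    define ts where "ts g \<kappa> = fst (ta (g, \<kappa>))" for g \<kappa>
    define co where "co g \<kappa> = snd (ta (g, \<kappa>))" for g \<kappa>
    have co: "\<bar>co g \<kappa> \<xi>\<bar> \<le> C" for g \<kappa> \<xi> using ta unfolding co_def by blast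
    have ts: "suits g \<kappa> (ts g \<kappa>) (co g \<kappa>)" if "ok g" "\<kappa> \<in> {..<fst (snd g)} \<rightarrow>\<^sub>E {..<N}" for g \<kappa>
      using ta[rule_format, of "(g, \<kappa>)"] that by (simp add: ts_def co_def)
    have nonneg: "0 \<le> real w" "0 \<le> real (q * w)" "0 \<le> 4 * real (q * w) ^ q" "0 \<le> H * C"
      using H0 C0 by auto
    interpret relu_construction n q L w N P K H C M co
    proof
      show "K + 1 \<le> M" "real w \<le> M" "real (q * w) \<le> M" "4 * real (q * w) ^ q \<le> M"
        "1 + H + H * C \<le> M" "2 * C \<le> M"
        using nonneg K0 H0 C0 unfolding M_def by linarith+
    qed (use n N K0 H0 C0 co in \<open>auto simp: w_def\<close>)
    obtain \<Phi> where \<Phi>: "is_network n 1 \<Phi>" "net_depth \<Phi> = 2 * L + 7" "net_size \<Phi> \<le> (net_cost + 2) * w"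
      "net_max \<Phi> \<le> real ((net_cost + 2) * w) * M" "net_fun n \<Phi> = net"
      using net_realization by blast
    have MN: "M \<le> real b * real N ^ e0"
    proof -
      have pw: "real N ^ i \<le> real N ^ e0" if "i \<le> e0" for i
        using that N by (intro power_increasing) auto
      have "K = real N ^ ((n - 1) * L + m)" by (simp add: K_def w_def power_add power_mult)
      also have "\<dots> \<le> real N ^ e0" by (rule pw) (simp add: e0_def distrib_left)
      finally have k1: "K \<le> real N ^ e0" .
      have k2: "1 \<le> real N ^ e0" using pw[of 0] by simp
      have "n - 1 \<le> (n - 1) * L" using L by simp
      moreover have "e0 = (n - 1) * L + ((n - 1) * q + m)" by (simp add: e0_def distrib_left)
      ultimately have "n - 1 \<le> e0" by linarith
      then have k3: "real w \<le> real N ^ e0" unfolding w_def of_nat_power by (rule pw)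
      have k4: "real (q * w) \<le> real q * real N ^ e0" using k3 by (simp add: mult_left_mono)
      have "real w ^ q = real N ^ ((n - 1) * q)" by (simp add: w_def power_mult)
      also have "\<dots> \<le> real N ^ e0" by (rule pw) (simp add: e0_def distrib_left)
      finally have k5: "real (q * w) ^ q \<le> real q ^ q * real N ^ e0"
        by (simp add: power_mult_distrib mult_left_mono)
      have k6: "H \<le> real N ^ e0" unfolding H_def by (rule pw) (simp add: e0_def)
      have k7: "H * C \<le> C * real N ^ e0" using k6 C0 by (simp add: mult.commute mult_left_mono)
      have k8: "C \<le> C * real N ^ e0" using k2 C0 by (simp add: mult_le_cancel_left1)
      have "M \<le> (5 + real q + 4 * real q ^ q + 3 * C) * real N ^ e0"
        unfolding M_def distrib_right using k1 k2 k3 k4 k5 k6 k7 k8 by linarith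
      also have "\<dots> \<le> real b * real N ^ e0" using b1 by (intro mult_right_mono) auto
      finally show ?thesis .
    qed
    have size: "net_size \<Phi> \<le> c * N ^ (n - 1)"
    proof -
      have "1 \<le> real b" using b1 C0 zero_le_power[of "real q" q] by linarith
      then have "1 \<le> b" by simp
      then have "(net_cost + 2) * 1 \<le> c" unfolding c_def by (intro mult_le_mono2)
      then have "(net_cost + 2) * w \<le> c * w" by (intro mult_le_mono1) simp
      then show ?thesis using \<Phi>(3) by (simp add: w_def)
    qed
    have max: "net_max \<Phi> \<le> real c * real N ^ e"
    proof -
      have "real ((net_cost + 2) * w) * M \<le> real ((net_cost + 2) * w) * (real b * real N ^ e0)"
        using MN by (intro mult_left_mono) auto
      also have "\<dots> = real c * real N ^ e" by (simp add: c_def e_def power_add w_def algebra_simps)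
      finally show ?thesis using \<Phi>(4) by linarith
    qed
    have exact: "net x = (if \<exists>a<P. \<forall>i<n. F a i x < x i \<and> x i < G a i x then 1 else 0)"
      if xQ: "x \<in> Qn n" and og: "\<forall>j<n. off_grid (W N) (real (W N * N ^ m)) (x j + 1/2)"
      and far: "\<forall>a<P. \<forall>i<n. \<sigma> N < \<bar>x i - F a i x\<bar> \<and> \<sigma> N < \<bar>x i - G a i x\<bar>" for x
    proof -
      have WK: "W N = w ^ L" "real (W N * N ^ m) = K" by (simp_all add: W_def K_def w_def)
      have "\<forall>j<n. off_grid (w ^ L) K (x j + 1/2)" using og unfolding WK(2) unfolding WK(1) .
      then have good: "good x" unfolding good_def .
      define y where "y j = truncated x j - 1/2" for j
      have xc: "\<bar>x j\<bar> \<le> 1/2" if "j < n" for j using xQ that by (simp add: Qn_iff)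
      have wN: "1 / real w ^ L \<le> 1 / real N ^ m"
      proof -
        have "real N ^ m \<le> real N ^ ((n - 1) * L)" using L(2) N by (intro power_increasing) auto
        also have "\<dots> = real w ^ L" by (simp add: w_def power_mult)
        finally show ?thesis using Np by (intro divide_left_mono) (auto simp: w_def)
      qed
      have yx: "\<bar>x j - y j\<bar> \<le> 1 / real N ^ m" "\<bar>y j\<bar> \<le> 1/2" if "j < n" for j
        using truncated_good[OF good that] xc[OF that] wN unfolding y_def by linarith+
      have Nm: "1 / real N ^ m \<le> 1 / real N"
      proof -
        have "real N ^ 1 \<le> real N ^ m" using m N by (intro power_increasing) auto
        then show ?thesis using Np by (intro divide_left_mono) auto
      qed
      have app: "\<bar>approx g x - T g x\<bar> \<le> C1 * (1 + 2 ^ m) / real N ^ m" if g: "g \<in> targets" for g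
      proof -
        define d where "d = fst (snd g)"
        have okg: "ok g" and d: "d < n" using g by (auto simp: targets_def ok_def d_def)
        define p where "p \<kappa> = poly_at (ts g \<kappa>) (\<lambda>j. truncated x j - real (\<kappa> j) / real N)" for \<kappa>
        have p: "\<bar>p \<kappa>\<bar> \<le> C \<and> (\<Sum>\<xi>\<in>features n L q. co g \<kappa> \<xi> * argsum \<xi> x ^ q) = p \<kappa>"
          if \<kappa>: "\<kappa> \<in> cells (fst (snd g))" for \<kappa>
        proof
          have \<kappa>': "\<kappa> \<in> {..<fst (snd g)} \<rightarrow>\<^sub>E {..<N}" using \<kappa> by (simp add: cells_def)
          note tsg = ts[OF okg \<kappa>', unfolded suits_def]
          have "\<bar>truncated x j - real (\<kappa> j) / real N\<bar> \<le> 1" if j: "j < fst (snd g)" for j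
          proof -
            have "\<kappa> j < N" using \<kappa>' j by auto
            then have "0 \<le> real (\<kappa> j) / real N" "real (\<kappa> j) / real N \<le> 1" by (auto simp: divide_le_eq)
            moreover have "0 \<le> truncated x j" "truncated x j \<le> 1"
              using truncated_good[OF good, of j] xc[of j] j d by (auto simp: d_def)
            ultimately show ?thesis by linarith
          qed
          then show "\<bar>p \<kappa>\<bar> \<le> C" unfolding p_def C_def using tsg C1
            by (intro poly_at_bound[where d = "fst (snd g)" and m = m]) auto
          have "zval None x = 1" by (simp add: zval_def)
          then show "(\<Sum>\<xi>\<in>features n L q. co g \<kappa> \<xi> * argsum \<xi> x ^ q) = p \<kappa>"
            using tsg[THEN conjunct2, THEN conjunct2, rule_format, of "\<lambda>v. zval v x"]
            unfolding p_def truncated_def by (simp add: argsum_def case_prod_unfold)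
        qed
        note ap = approx_good[OF good L(1) g p]
        define \<kappa> where "\<kappa> = cell_of d x"
        have \<kappa>c: "\<kappa> \<in> {..<fst (snd g)} \<rightarrow>\<^sub>E {..<N}" using ap(1) by (simp add: \<kappa>_def d_def cells_def)
        have eq: "approx g x = poly_at (ts g \<kappa>) (\<lambda>j. y j - corner \<kappa> j)"
          using ap(2) by (simp add: p_def \<kappa>_def d_def y_def corner_def)
        have yc: "\<bar>y j - corner \<kappa> j\<bar> \<le> 2 / real N" if j: "j < d" for j
        proof -
          have jn: "j < n" using j d by simp
          have 0: "0 \<le> real N * (x j + 1/2)" using xc[OF jn] Np by (simp add: abs_le_iff)
          have "real (\<kappa> j) = of_int \<lfloor>real N * (x j + 1/2)\<rfloor>" using 0 j by (simp add: \<kappa>_def cell_of_def)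
          then have "real (\<kappa> j) \<le> real N * (x j + 1/2)" "real N * (x j + 1/2) < real (\<kappa> j) + 1" by linarith+
          then have "real (\<kappa> j) / real N \<le> x j + 1/2" "x j + 1/2 < real (\<kappa> j) / real N + 1 / real N"
            using Np by (simp_all add: field_simps)
          then have "\<bar>x j - corner \<kappa> j\<bar> \<le> 1 / real N" unfolding corner_def by linarith
          then show ?thesis using yx(1)[OF jn] Nm by linarith
        qed
        have ycube: "y \<in> cube d" and xcube: "x \<in> cube d" using yx(2) xc d by (auto simp: cube_def)
        have 1: "\<bar>T g y - approx g x\<bar> \<le> C1 * (2 / real N) ^ m"
          using ts[OF okg \<kappa>c, unfolded suits_def, THEN conjunct2, THEN conjunct1] ycube yc Np unfolding eq d_def by simp
        have 2: "\<bar>T g x - T g y\<bar> \<le> C1 * (1 / real N ^ m)"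
        proof -
          have "\<forall>y0\<in>cube d. \<forall>y\<in>cube d. \<forall>h\<ge>0. (\<forall>i<d. \<bar>y i - y0 i\<bar> \<le> h) \<longrightarrow> \<bar>T g y - T g y0\<bar> \<le> C1 * h"
            using lpT[OF okg] unfolding locally_poly_def d_def by blast
          from this[rule_format, OF ycube xcube, of "1 / real N ^ m"] show ?thesis
            using yx(1) d by simp
        qed
        have "C1 * (1 + 2 ^ m) / real N ^ m = C1 * (2 / real N) ^ m + C1 * (1 / real N ^ m)"
          by (simp add: power_divide distrib_left add_divide_distrib)
        with 1 2 show ?thesis by linarith
      qed
      have \<sigma>: "\<sigma> N = C1 * (1 + 2 ^ m) / real N ^ m + 1 / H"
        by (simp add: \<sigma>_def H_def add_divide_distrib)
      show ?thesis
      proof (rule net_exact[OF good, where \<delta> = "C1 * (1 + 2 ^ m) / real N ^ m"])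
        fix a i assume ai: "a < P" "i < n"
        have g: "(a, i, False) \<in> targets" "(a, i, True) \<in> targets" using ai by (auto simp: targets_def)
        show "\<bar>approx (a, i, False) x - F a i x\<bar> \<le> C1 * (1 + 2 ^ m) / real N ^ m \<and>
          C1 * (1 + 2 ^ m) / real N ^ m + 1 / H \<le> \<bar>x i - F a i x\<bar>"
          using app[OF g(1)] far ai unfolding \<sigma> by (auto simp: T_def less_imp_le)
        show "\<bar>approx (a, i, True) x - G a i x\<bar> \<le> C1 * (1 + 2 ^ m) / real N ^ m \<and>
          C1 * (1 + 2 ^ m) / real N ^ m + 1 / H \<le> \<bar>x i - G a i x\<bar>"
          using app[OF g(2)] far ai unfolding \<sigma> by (auto simp: T_def less_imp_le)
      qed
    qed
    have "network_bounds n (2 * L + 7) (c * N ^ (n - 1)) (real c * real N ^ e) \<Phi>"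
      unfolding network_bounds_def using \<Phi>(1,2) size max net_range net_measurable by (simp add: \<Phi>(5))
    moreover have "exact_off_strips n (W N) (real (W N * N ^ m)) (\<sigma> N) P F G (net_fun n \<Phi>)"
      unfolding exact_off_strips_def \<Phi>(5) by (intro ballI impI) (rule exact)
    ultimately show ?thesis by blast
  qed
  show ?thesis
    by (rule exI[of _ c], rule exI[of _ e], intro allI, rule impI, rule allI, rule allI, rule impI,
        rule main[unfolded W_def \<sigma>_def])
qed


section \<open>Slices of traceable sets\<close>

text \<open>
  Since \<open>f\<close> does not depend on the coordinate \<open>i\<close>, every line in direction \<open>i\<close> meets a strip around
  the graph of \<open>f\<close> in an interval of the same length.
\<close>

definition admissible :: "nat \<Rightarrow> nat \<Rightarrow> real \<Rightarrow> nat \<Rightarrow> ((nat \<Rightarrow> real) \<Rightarrow> real) \<Rightarrow> bool" where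
  "admissible n m C i f \<longleftrightarrow> locally_poly i m C f \<and> f \<in> borel_measurable (leb n) \<and>
     (\<forall>x t. f (x(i := t)) = f x)"

lemma admissible_zero: "1 \<le> C \<Longrightarrow> admissible n m C i (\<lambda>_. 0)"
  unfolding admissible_def locally_poly_def poly_bounded_def
  by (auto intro!: exI[of _ "[]"] simp: poly_at_def)

lemma admissible_slice:
  assumes F: "Cm_open m (k + i) (Rn (k + i)) F" and m: "m \<ge> 1"
    and norm: "Wm_inf_norm m (k + i) F \<le> ereal B" and a: "a \<in> Qn k" and i: "i < n"
  shows "admissible n m (real (n * m ^ n) * (B + 1)) i (\<lambda>y. F (append_pt k i a y))"
  unfolding admissible_def
proof (intro conjI allI)
  show "locally_poly i m (real (n * m ^ n) * (B + 1)) (\<lambda>y. F (append_pt k i a y))"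
    using assms by (rule locally_poly_slice)
  show "(\<lambda>y. F (append_pt k i a y)) \<in> borel_measurable (leb n)"
  proof (rule continuous_on_Rn_measurable[OF Cm_open_continuous[OF F]])
    fix j assume j: "j < k + i"
    show "(\<lambda>y. append_pt k i a y j) \<in> borel_measurable (leb n)"
    proof (cases "j < k")
      case True
      then show ?thesis by (simp add: append_pt_def)
    next
      case False
      then have "j - k < n" using i j by simp
      then show ?thesis using False j
          measurable_component_singleton[of "j - k" "{..<n}" "\<lambda>_. lborel :: real measure"]
        by (simp add: append_pt_def)
    qed
  qed (auto simp: append_pt_def Rn_def)
  show "F (append_pt k i a (x(i := t))) = F (append_pt k i a x)" for x t
    by (rule arg_cong[of _ _ F]) (auto simp: append_pt_def fun_eq_iff restrict_def)
qed

text \<open>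
  The surjectivity \<open>\<pi>\<^sub>i(A\<^sub>i) = A\<^sub>i\<^sub>-\<^sub>1\<close>, iterated from the top.
\<close>

lemma traceable_truncate:
  assumes tr: "traceable_by m D A As f g" and D: "D \<ge> 1" and z: "z \<in> A" and j: "j \<le> D"
  shows "restrict z {..<j} \<in> As j"
  using j
proof (induction rule: inc_induct)
  case base
  have "As D = A" "As D \<subseteq> Rn D" using tr D by (auto simp: traceable_by_def)
  then have "restrict z {..<D} = z" using z by (auto simp: Rn_def PiE_def extensional_restrict)
  then show ?case using z \<open>As D = A\<close> by simp
next
  case (step j)
  have "Suc j \<in> {1..D}" using step by simp
  from tr[unfolded traceable_by_def, THEN conjunct2, THEN conjunct2, rule_format, OF this]
  have im: "(\<lambda>x. restrict x {..<j}) ` As (Suc j) = As j" unfolding diff_Suc_1 by blast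
  have "restrict (restrict z {..<Suc j}) {..<j} \<in> As j"
    unfolding im[symmetric] by (rule imageI[OF step.IH])
  also have "restrict (restrict z {..<Suc j}) {..<j} = restrict z {..<j}"
    by (auto simp: fun_eq_iff)
  finally show ?case .
qed

text \<open>
  Null sets are covered by taking both bounds equal, so that no point satisfies the inequalities.
\<close>

definition bounded_by_graphs ::
    "nat \<Rightarrow> nat \<Rightarrow> real \<Rightarrow> (nat \<Rightarrow> real) set \<Rightarrow> (nat \<Rightarrow> rfun) \<Rightarrow> (nat \<Rightarrow> rfun) \<Rightarrow> (nat \<Rightarrow> real) set \<Rightarrow> bool" where
  "bounded_by_graphs n m C S F G Z \<longleftrightarrow>
     (\<forall>i<n. admissible n m C i (F i) \<and> admissible n m C i (G i)) \<and> Z \<in> null_sets (leb n) \<and>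
     (\<forall>y\<in>Qn n. y \<notin> Z \<longrightarrow> (y \<in> S \<longleftrightarrow> (\<forall>i<n. F i y < y i \<and> y i < G i y)))"

lemma null_bounded_by_graphs:
  assumes C: "1 \<le> C" and n: "n \<ge> 1" and Z: "Z \<in> null_sets (leb n)" "S \<inter> Qn n \<subseteq> Z"
  shows "bounded_by_graphs n m C S (\<lambda>_ _. 0) (\<lambda>_ _. 0) Z"
  unfolding bounded_by_graphs_def using admissible_zero[OF C] Z n by force

text \<open>
  If some level is a graph, then the slice lies in a strip of width 0. If all levels are of the
  form \<open>(f, g)\<close>, then membership is decided level by level; the extensions may replace \<open>f\<close> and \<open>g\<close>
  because the truncations of a point that satisfies the first \<open>i\<close> pairs of inequalities lie in the
  sets \<open>As\<close>, where extension and map agree. A nonempty slice forces \<open>a\<close> into the cube, which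
  the derivative bounds need.
\<close>

lemma slice_dichotomy:
  assumes A: "A \<in> K_class m (k + n) B" and m: "m \<ge> 1" and B: "B > 0" and n: "n \<ge> 1"
    and a: "a \<in> Rn k"
  defines "C \<equiv> real (n * m ^ n) * (B + 1)"
  shows "\<exists>F G Z. bounded_by_graphs n m C (slice k n A a) F G Z"
proof -
  have "1 \<le> n * m ^ n" using n m by (simp add: Suc_le_eq)
  then have "1 \<le> real (n * m ^ n)" by (simp only: of_nat_le_iff[of 1, simplified])
  then have C1: "1 \<le> C" unfolding C_def using B mult_mono[of 1 "real (n * m ^ n)" 1 "B + 1"] by simp
  have trivial: ?thesis if "Z \<in> null_sets (leb n)" "slice k n A a \<inter> Qn n \<subseteq> Z" for Z
    using null_bounded_by_graphs[OF C1 n that] by blast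
  show ?thesis
  proof (cases "slice k n A a \<inter> Qn n = {}")
    case True
    then show ?thesis using trivial[of "{}"] by simp
  next
    case False
    then obtain y0 where y0: "y0 \<in> slice k n A a" by blast
    have AQ: "A \<subseteq> Qn (k + n)" using A by (simp add: K_class_def)
    obtain As f g where tr: "traceable_by m (k + n) A As f g"
      and ext: "\<forall>i\<in>{1..k + n}. \<exists>F G.
             Cm_open m (i - 1) (Rn (i - 1)) F \<and> Cm_open m (i - 1) (Rn (i - 1)) G \<and>
             (\<forall>x\<in>As (i - 1). F x = f i x) \<and> (\<forall>x\<in>As (i - 1). G x = g i x) \<and>
             Wm_inf_norm m (i - 1) F \<le> ereal B \<and> Wm_inf_norm m (i - 1) G \<le> ereal B"
      using A unfolding K_class_def by blast
    from bchoice[OF ext] obtain Fx where "\<forall>i\<in>{1..k + n}. \<exists>G.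
             Cm_open m (i - 1) (Rn (i - 1)) (Fx i) \<and> Cm_open m (i - 1) (Rn (i - 1)) G \<and>
             (\<forall>x\<in>As (i - 1). (Fx i) x = f i x) \<and> (\<forall>x\<in>As (i - 1). G x = g i x) \<and>
             Wm_inf_norm m (i - 1) (Fx i) \<le> ereal B \<and> Wm_inf_norm m (i - 1) G \<le> ereal B" by blast
    from bchoice[OF this] obtain Gx where ext: "\<And>i. i \<in> {1..k + n} \<Longrightarrow>
             Cm_open m (i - 1) (Rn (i - 1)) (Fx i) \<and> Cm_open m (i - 1) (Rn (i - 1)) (Gx i) \<and>
             (\<forall>x\<in>As (i - 1). (Fx i) x = f i x) \<and> (\<forall>x\<in>As (i - 1). (Gx i) x = g i x) \<and>
             Wm_inf_norm m (i - 1) (Fx i) \<le> ereal B \<and> Wm_inf_norm m (i - 1) (Gx i) \<le> ereal B" by blast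
    define p where "p i y = append_pt k i a y" for i y
    have p_restrict: "restrict (p n y) {..<k + i} = p i y" if "i \<le> n" for i y
      using that by (auto simp: p_def append_pt_def fun_eq_iff)
    have p_Suc: "p (Suc i) y = (p i y)(k + i := y i)" for i y
      by (auto simp: p_def append_pt_def fun_eq_iff)
    have p_0: "p 0 y = a" for y
      using a by (auto simp: p_def append_pt_def fun_eq_iff Rn_def PiE_def extensional_def)
    have sl: "y \<in> slice k n A a \<longleftrightarrow> p n y \<in> A" if "y \<in> Qn n" for y
      using that Qn_subset_Rn by (auto simp: slice_def p_def)
    have in_As: "p i y \<in> As (k + i)" if "p n y \<in> A" "i \<le> n" for i y
      using traceable_truncate[OF tr _ that(1), of "k + i"] that(2) n by (simp add: p_restrict)
    have pA0: "p n y0 \<in> A" using y0 by (simp add: slice_def p_def)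
    have aAs: "a \<in> As k" using in_As[OF pA0, of 0] by (simp add: p_0)
    have aQ: "a \<in> Qn k"
    proof -
      have "p n y0 \<in> Qn (k + n)" using pA0 AQ by blast
      then have "restrict (p n y0) {..<k + 0} \<in> Qn k" by (auto simp: Qn_iff)
      then show ?thesis using p_restrict[of 0 y0] by (simp add: p_0)
    qed
    have lev: "As (Suc (k + i)) \<subseteq> Rn (Suc (k + i))"
      "(\<forall>x\<in>As (k + i). f (Suc (k + i)) x < g (Suc (k + i)) x) \<and>
         As (Suc (k + i)) = between (k + i) (As (k + i)) (f (Suc (k + i))) (g (Suc (k + i))) \<or>
       (\<forall>x\<in>As (k + i). f (Suc (k + i)) x = g (Suc (k + i)) x) \<and>
         As (Suc (k + i)) = graph_over (k + i) (As (k + i)) (f (Suc (k + i)))" if "i < n" for i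
    proof -
      have "Suc (k + i) \<in> {1..k + n}" using that by simp
      from tr[unfolded traceable_by_def, THEN conjunct2, THEN conjunct2, rule_format, OF this]
      show "As (Suc (k + i)) \<subseteq> Rn (Suc (k + i))"
        "(\<forall>x\<in>As (k + i). f (Suc (k + i)) x < g (Suc (k + i)) x) \<and>
         As (Suc (k + i)) = between (k + i) (As (k + i)) (f (Suc (k + i))) (g (Suc (k + i))) \<or>
       (\<forall>x\<in>As (k + i). f (Suc (k + i)) x = g (Suc (k + i)) x) \<and>
         As (Suc (k + i)) = graph_over (k + i) (As (k + i)) (f (Suc (k + i)))"
        unfolding diff_Suc_1 by blast+
    qed
    define F where "F i y = Fx (Suc (k + i)) (p i y)" for i y
    define G where "G i y = Gx (Suc (k + i)) (p i y)" for i y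
    have FG: "F i y = f (Suc (k + i)) (p i y)" "G i y = g (Suc (k + i)) (p i y)"
      if "i < n" "p i y \<in> As (k + i)" for i y
      using ext[of "Suc (k + i)"] that by (simp_all add: F_def G_def)
    have adm: "admissible n m C i (F i)" "admissible n m C i (G i)" if i: "i < n" for i
    proof -
      have e: "Cm_open m (k + i) (Rn (k + i)) (Fx (Suc (k + i)))" "Wm_inf_norm m (k + i) (Fx (Suc (k + i))) \<le> ereal B"
        "Cm_open m (k + i) (Rn (k + i)) (Gx (Suc (k + i)))" "Wm_inf_norm m (k + i) (Gx (Suc (k + i))) \<le> ereal B"
        using ext[of "Suc (k + i)"] i by simp_all
      show "admissible n m C i (F i)" unfolding F_def[abs_def] p_def C_def
        by (rule admissible_slice[OF e(1) m e(2) aQ i])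
      show "admissible n m C i (G i)" unfolding G_def[abs_def] p_def C_def
        by (rule admissible_slice[OF e(3) m e(4) aQ i])
    qed
    have upd_eq: "x = p i y \<and> t = y i" if "p (Suc i) y = x(k + i := t)" "x \<in> As (k + i)" "i < n" for x t i y
    proof
      show "t = y i" using fun_cong[OF that(1), of "k + i"] by (simp add: p_Suc)
      have "k + i \<le> k + n" "0 < k + i \<or> k + i = 0" using that by auto
      then have "As (k + i) \<subseteq> Rn (k + i)" using tr unfolding traceable_by_def by fastforce
      then have xR: "x \<in> Rn (k + i)" using that(2) by blast
      show "x = p i y"
      proof
        fix j show "x j = p i y j"
        proof (cases "j = k + i")
          case True
          then show ?thesis using xR by (simp add: Rn_def PiE_def extensional_def p_def append_pt_def)
        next
          case False
          then show ?thesis using fun_cong[OF that(1), of j] by (simp add: p_Suc)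
        qed
      qed
    qed
    show ?thesis
    proof (cases "\<forall>i<n. As (Suc (k + i)) = between (k + i) (As (k + i)) (f (Suc (k + i))) (g (Suc (k + i)))")
      case True
      have "p n y \<in> A \<longleftrightarrow> (\<forall>i<n. F i y < y i \<and> y i < G i y)" for y
      proof
        assume pA: "p n y \<in> A"
        show "\<forall>i<n. F i y < y i \<and> y i < G i y"
        proof (intro allI impI)
          fix i assume i: "i < n"
          have "p (Suc i) y \<in> between (k + i) (As (k + i)) (f (Suc (k + i))) (g (Suc (k + i)))"
            using in_As[OF pA, of "Suc i"] i True by simp
          then obtain x t where x: "p (Suc i) y = x(k + i := t)" "x \<in> As (k + i)"
            "f (Suc (k + i)) x < t" "t < g (Suc (k + i)) x" unfolding between_def by blast
          have "x = p i y" "t = y i" using upd_eq[OF x(1,2) i] by auto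
          then show "F i y < y i \<and> y i < G i y" using x FG[OF i, of y] by simp
        qed
      next
        assume FGy: "\<forall>i<n. F i y < y i \<and> y i < G i y"
        have "i \<le> n \<Longrightarrow> p i y \<in> As (k + i)" for i
        proof (induction i)
          case 0
          then show ?case using aAs by (simp add: p_0)
        next
          case (Suc i)
          then have i: "i < n" and pi: "p i y \<in> As (k + i)" by auto
          have "f (Suc (k + i)) (p i y) < y i \<and> y i < g (Suc (k + i)) (p i y)"
            using FGy[rule_format, OF i] unfolding FG[OF i pi] .
          then have "(p i y)(k + i := y i) \<in> between (k + i) (As (k + i)) (f (Suc (k + i))) (g (Suc (k + i)))"
            using pi unfolding between_def by blast
          moreover have "As (Suc (k + i)) = between (k + i) (As (k + i)) (f (Suc (k + i))) (g (Suc (k + i)))"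
            using True i by blast
          ultimately show ?case unfolding add_Suc_right p_Suc by (simp only:)
        qed
        from this[of n] show "p n y \<in> A" using tr by (simp add: traceable_by_def)
      qed
      then have "\<forall>y\<in>Qn n. y \<notin> {} \<longrightarrow> (y \<in> slice k n A a \<longleftrightarrow> (\<forall>i<n. F i y < y i \<and> y i < G i y))"
        using sl by blast
      then have "bounded_by_graphs n m C (slice k n A a) F G {}"
        unfolding bounded_by_graphs_def using adm by simp
      then show ?thesis by blast
    next
      case False
      then obtain i where i: "i < n"
        and gr: "As (Suc (k + i)) = graph_over (k + i) (As (k + i)) (f (Suc (k + i)))"
        using lev(2) by blast
      let ?S = "{y \<in> Rn n. \<bar>y i - F i y\<bar> \<le> 0}"
      have Fi: "F i \<in> borel_measurable (leb n)" "\<And>x t. F i (x(i := t)) = F i x"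
        using adm(1)[OF i] by (auto simp: admissible_def)
      have S: "?S \<in> sets (leb n)" "emeasure (leb n) (?S \<inter> Qn n) \<le> ennreal (2 * 0)"
        using graph_strip_measure[OF i Fi(1) order_refl Fi(2)] by auto
      have "?S \<inter> Qn n \<in> null_sets (leb n)" using S by (auto simp: null_sets_def)
      moreover have "slice k n A a \<inter> Qn n \<subseteq> ?S \<inter> Qn n"
      proof
        fix y assume y: "y \<in> slice k n A a \<inter> Qn n"
        then have pA: "p n y \<in> A" using sl by blast
        have "p (Suc i) y \<in> graph_over (k + i) (As (k + i)) (f (Suc (k + i)))"
          using in_As[OF pA, of "Suc i"] i gr by simp
        then obtain x where x: "p (Suc i) y = x(k + i := f (Suc (k + i)) x)" "x \<in> As (k + i)"
          unfolding graph_over_def by blast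
        have "x = p i y" "f (Suc (k + i)) x = y i" using upd_eq[OF x i] by auto
        then have "F i y = y i" using FG(1)[OF i, of y] x(2) by simp
        then show "y \<in> ?S \<inter> Qn n" using y Qn_subset_Rn by auto
      qed
      ultimately show ?thesis by (rule trivial)
    qed
  qed
qed

lemma strips_measure:
  assumes I: "finite I" and pos: "\<And>i. i \<in> I \<Longrightarrow> pos i < n"
    and F: "\<And>i. i \<in> I \<Longrightarrow> F i \<in> borel_measurable (leb n)"
    and indep: "\<And>i x t. i \<in> I \<Longrightarrow> F i (x(pos i := t)) = F i x"
    and r: "\<And>i. i \<in> I \<Longrightarrow> 0 \<le> r i"
  shows "(\<Union>i\<in>I. {x \<in> Rn n. \<bar>x (pos i) - F i x\<bar> \<le> r i}) \<in> sets (leb n)"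
    and "emeasure (leb n) ((\<Union>i\<in>I. {x \<in> Rn n. \<bar>x (pos i) - F i x\<bar> \<le> r i}) \<inter> Qn n)
      \<le> ennreal (\<Sum>i\<in>I. 2 * r i)"
proof -
  let ?S = "\<lambda>i. {x \<in> Rn n. \<bar>x (pos i) - F i x\<bar> \<le> r i}"
  have S: "?S i \<in> sets (leb n)" "emeasure (leb n) (?S i \<inter> Qn n) \<le> ennreal (2 * r i)" if "i \<in> I" for i
    using graph_strip_measure[OF pos[OF that] F[OF that] r[OF that] indep[OF that]] by auto
  show "(\<Union>i\<in>I. ?S i) \<in> sets (leb n)" using I S(1) by (intro sets.finite_UN) auto
  have "emeasure (leb n) ((\<Union>i\<in>I. ?S i) \<inter> Qn n) = emeasure (leb n) (\<Union>i\<in>I. ?S i \<inter> Qn n)"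
    by (rule arg_cong[of _ _ "emeasure (leb n)"]) blast
  also have "\<dots> \<le> (\<Sum>i\<in>I. emeasure (leb n) (?S i \<inter> Qn n))"
    using I S(1) by (intro emeasure_subadditive_finite) auto
  also have "\<dots> \<le> (\<Sum>i\<in>I. ennreal (2 * r i))" using S(2) by (intro sum_mono) auto
  also have "\<dots> = ennreal (\<Sum>i\<in>I. 2 * r i)" using r by (intro sum_ennreal) auto
  finally show "emeasure (leb n) ((\<Union>i\<in>I. ?S i) \<inter> Qn n) \<le> ennreal (\<Sum>i\<in>I. 2 * r i)" .
qed

text \<open>
  This is where completeness of the measure is used: the part of \<open>S\<close> inside \<open>Z\<close> is arbitrary.
\<close>

lemma indicator_leb_Qn_measurable:
  assumes U: "U \<in> sets (leb n)" and Z: "Z \<in> null_sets (leb n)"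
    and eq: "\<And>y. y \<in> Qn n \<Longrightarrow> y \<notin> Z \<Longrightarrow> y \<in> S \<longleftrightarrow> y \<in> U"
  shows "indicat_real S \<in> borel_measurable (leb_Qn n)"
proof -
  have "S \<inter> Qn n = (U \<inter> Qn n - Z) \<union> (S \<inter> Qn n \<inter> Z)" using eq by blast
  moreover have "U \<inter> Qn n - Z \<in> sets (completion (leb n))"
    using U Z by (intro sets_completionI_sets) auto
  moreover have "S \<inter> Qn n \<inter> Z \<in> sets (completion (leb n))"
    using Z by (intro sets_completionI_sub[of Z]) auto
  ultimately have "S \<inter> Qn n \<in> sets (completion (leb n))" by (metis sets.Un)
  then show ?thesis by (simp add: borel_measurable_indicator_iff space_leb_Qn sets_leb_Qn_iff)
qed


section \<open>Choice of the scale\<close>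

text \<open>
  The least \<open>L\<close> with \<open>m \<le> (n - 1) * L\<close>; the estimate uses \<open>n \<le> 2 * (n - 1)\<close>.
\<close>

lemma depth_parameter:
  fixes n m :: nat
  assumes "n \<ge> 2" "m \<ge> 1"
  obtains L :: nat where "L \<ge> 1" "m \<le> (n - 1) * L" "real L \<le> 2 * real m / real n + 1"
proof
  define d where "d = n - 1"
  define L where "L = (m + d - 1) div d"
  have d: "d \<ge> 1" "n = d + 1" using assms by (auto simp: d_def)
  have "d div d \<le> L" unfolding L_def using assms by (intro div_le_mono) simp
  then show "L \<ge> 1" using d by simp
  have "m + d - 1 = d * L + (m + d - 1) mod d" by (simp add: L_def)
  moreover have "(m + d - 1) mod d < d" using d by (intro mod_less_divisor) simp
  ultimately show "m \<le> (n - 1) * L" unfolding d_def[symmetric] by linarith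
  have "d * L \<le> m + d" by (simp add: L_def order.trans[OF times_div_less_eq_dividend])
  then have "real d * real L \<le> real m + real d" by (metis of_nat_add of_nat_le_iff of_nat_mult)
  then have "real L \<le> (real m + real d) / real d" using d by (simp add: le_divide_eq mult.commute)
  also have "\<dots> = real m / real d + 1" using d by (simp add: add_divide_distrib)
  also have "real m / real d \<le> 2 * real m / real n"
  proof -
    have "real m * real n \<le> real m * (2 * real d)" using d by (intro mult_left_mono) auto
    then show ?thesis using d by (simp add: divide_simps mult_ac)
  qed
  finally show "real L \<le> 2 * real m / real n + 1" by simp
qed

lemma depth_bound:
  fixes n m l L :: nat
  assumes "n \<ge> 2" "m \<ge> 1" and L: "real L \<le> 2 * real m / real n + 1"
  shows "real (2 * L + 7) \<le> real_of_int \<lceil>log 2 (real ((l + 1) * n))\<rceil> +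
    (3 + real_of_int \<lceil>log 2 (real m)\<rceil>) * (14 + 2 * real m / real n)"
proof -
  have "1 \<le> (l + 1) * n" using assms by simp
  then have "1 \<le> real ((l + 1) * n)" by (metis of_nat_1 of_nat_le_iff)
  then have "0 \<le> log 2 (real ((l + 1) * n))" by (subst zero_le_log_cancel_iff) linarith+
  then have 1: "0 \<le> real_of_int \<lceil>log 2 (real ((l + 1) * n))\<rceil>" by linarith
  have "0 \<le> log 2 (real m)" using assms by simp
  then have 2: "0 \<le> real_of_int \<lceil>log 2 (real m)\<rceil>" by linarith
  have q: "0 \<le> 2 * real m / real n" by simp
  have 3: "3 * (14 + 2 * real m / real n) \<le> (3 + real_of_int \<lceil>log 2 (real m)\<rceil>) * (14 + 2 * real m / real n)"
    using 2 q by (intro mult_right_mono) auto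
  have "2 * real L + 7 \<le> 3 * (14 + t)" if "real L \<le> t + 1" "0 \<le> t" for t using that by simp
  from this[OF L q] have "2 * real L + 7 \<le> 3 * (14 + 2 * real m / real n)" .
  then have "real (2 * L + 7) \<le> 3 * (14 + 2 * real m / real n)" by simp
  from add_increasing[OF 1 order_trans[OF this 3]] show ?thesis .
qed

lemma scale_for_accuracy:
  fixes D \<epsilon> p :: real and m :: nat
  assumes D: "D \<ge> 0" and \<epsilon>: "0 < \<epsilon>" "\<epsilon> < 1" and p: "p \<ge> 1" and m: "m \<ge> 1"
  obtains N :: nat where "N \<ge> 1" "D / real N ^ m < \<epsilon> powr p"
    "real N \<le> 2 * (D + 1) powr (1 / real m) * \<epsilon> powr (- (p / real m))"
proof
  define X where "X = (D + 1) powr (1 / real m) * \<epsilon> powr (- (p / real m))"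
  have a: "1 \<le> (D + 1) powr (1 / real m)" using D by (intro ge_one_powr_ge_zero) auto
  have b: "1 \<le> \<epsilon> powr (- (p / real m))"
  proof -
    have "\<epsilon> powr 0 \<le> \<epsilon> powr (- (p / real m))" using \<epsilon> p by (intro powr_mono') auto
    then show ?thesis using \<epsilon> by simp
  qed
  have X1: "1 \<le> X" unfolding X_def using mult_mono[OF a b] by simp
  define N where "N = nat \<lceil>X\<rceil>"
  have N: "X \<le> real N" "real N \<le> X + 1" using X1 unfolding N_def by linarith+
  show "N \<ge> 1" using N X1 by linarith
  have "X ^ m = X powr real m" using X1 by (simp add: powr_realpow)
  also have "\<dots> = (D + 1) * \<epsilon> powr (- p)"
    unfolding X_def using D m \<epsilon> by (simp add: powr_mult powr_powr)
  finally have Xm: "X ^ m = (D + 1) * \<epsilon> powr (- p)" .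
  have "X ^ m \<le> real N ^ m" using N X1 by (intro power_mono) auto
  then have "(D + 1) * \<epsilon> powr (- p) \<le> real N ^ m" unfolding Xm .
  then have "(D + 1) * \<epsilon> powr (- p) * \<epsilon> powr p \<le> real N ^ m * \<epsilon> powr p" by (intro mult_right_mono) auto
  then have "D + 1 \<le> real N ^ m * \<epsilon> powr p" using \<epsilon> by (simp add: mult.assoc powr_add[symmetric])
  moreover have "0 < real N ^ m" using N X1 by simp
  ultimately show "D / real N ^ m < \<epsilon> powr p" by (simp add: divide_less_eq mult.commute)
  have "real N \<le> 2 * X" using N X1 by simp
  then show "real N \<le> 2 * (D + 1) powr (1 / real m) * \<epsilon> powr (- (p / real m))" by (simp add: X_def)
qed

theorem corollary3p4:
  fixes m n l :: nat and p B :: real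
  assumes "m \<ge> 1" and "p \<ge> 1" and "n \<ge> 2" and "B > 0"
  shows "\<exists>c s :: real. c > 0 \<and> s > 0 \<and>
    (\<forall>k::nat. k \<ge> 1 \<longrightarrow>
      (\<forall>\<Omega> \<in> K_union_class m (k + n) B l. \<forall>\<epsilon>::real. 0 < \<epsilon> \<and> \<epsilon> < 1 / 2 \<longrightarrow>
        (\<forall>a \<in> Rn k. \<exists>\<Phi>.
           is_network n 1 \<Phi> \<and>
           (\<forall>x \<in> Rn n. net_fun n \<Phi> x \<in> {0..1}) \<and>
           net_max \<Phi> \<le> \<epsilon> powr (- s) \<and>
           real (net_depth \<Phi>) \<le>
             real_of_int \<lceil>log 2 (real ((l + 1) * n))\<rceil> +
             (3 + real_of_int \<lceil>log 2 (real m)\<rceil>) * (14 + 2 * real m / real n) \<and>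
           real (net_size \<Phi>) \<le> c * \<epsilon> powr (- (p * (real n - 1) / real m)) \<and>
           Lp_norm p (leb_Qn n) (\<lambda>x. net_fun n \<Phi> x - indicat_real (slice k n \<Omega> a) x)
             < ereal \<epsilon>)))"
proof -
  note m = assms(1) and p = assms(2) and n = assms(3) and B = assms(4)
  define C1 where "C1 = real (n * m ^ n) * (B + 1)"
  have "1 \<le> n * m ^ n" using n m by (simp add: Suc_le_eq)
  then have "1 \<le> real (n * m ^ n)" by (simp only: of_nat_le_iff[of 1, simplified])
  then have C1: "1 \<le> C1" unfolding C1_def using B mult_mono[of 1 "real (n * m ^ n)" 1 "B + 1"] by simp
  obtain L where L: "L \<ge> 1" "m \<le> (n - 1) * L" "real L \<le> 2 * real m / real n + 1"
    using depth_parameter[OF n m] .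
  define S where "S = C1 * (1 + 2 ^ m) + 1"
  have S0: "0 \<le> S" using C1 by (simp add: S_def)
  define W where "W N = (N ^ (n - 1)) ^ L" for N :: nat
  obtain c0 e where scale: "\<And>N F G. N \<ge> 1 \<Longrightarrow>
     \<forall>a<l. \<forall>i<n. locally_poly i m C1 (F a i) \<and> locally_poly i m C1 (G a i) \<Longrightarrow>
     \<exists>\<Phi>. network_bounds n (2 * L + 7) (c0 * N ^ (n - 1)) (real c0 * real N ^ e) \<Phi> \<and>
        exact_off_strips n (W N) (real (W N * N ^ m)) (S / real N ^ m) l F G (net_fun n \<Phi>)"
    unfolding W_def S_def using network_at_scale[OF n m C1 L(1,2), of l] by blast
  \<comment> \<open>\<open>D / N ^ m\<close> bounds the measure of the exceptional set\<close>
  define D where "D = 4 * real n + 4 * real (l * n) * S"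
  have D0: "0 \<le> D" using S0 by (simp add: D_def)
  define A where "A = 2 * (D + 1) powr (1 / real m)"
  have A2: "2 \<le> A"
  proof -
    have "1 \<le> (D + 1) powr (1 / real m)" using D0 by (intro ge_one_powr_ge_zero) auto
    then show ?thesis by (simp add: A_def)
  qed
  define c where "c = (real c0 + 1) * A ^ (n - 1)"
  \<comment> \<open>the logarithm absorbs the constant factor, since \<open>2 \<le> 1 / \<epsilon>\<close>\<close>
  define s where "s = p / real m * real e + log 2 ((real c0 + 1) * A ^ e) + 1"
  have Ae: "1 \<le> (real c0 + 1) * A ^ e"
    using A2 mult_mono[of 1 "real c0 + 1" 1 "A ^ e"] one_le_power[of A e] by simp
  have c: "c > 0" using A2 by (simp add: c_def)
  have "0 \<le> p / real m * real e" using p by simp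
  moreover have "0 \<le> log 2 ((real c0 + 1) * A ^ e)" using Ae by simp
  ultimately have s: "s > 0" unfolding s_def by linarith
  have main: "\<exists>\<Phi>. is_network n 1 \<Phi> \<and>
           (\<forall>x \<in> Rn n. net_fun n \<Phi> x \<in> {0..1}) \<and>
           net_max \<Phi> \<le> \<epsilon> powr (- s) \<and>
           real (net_depth \<Phi>) \<le>
             real_of_int \<lceil>log 2 (real ((l + 1) * n))\<rceil> +
             (3 + real_of_int \<lceil>log 2 (real m)\<rceil>) * (14 + 2 * real m / real n) \<and>
           real (net_size \<Phi>) \<le> c * \<epsilon> powr (- (p * (real n - 1) / real m)) \<and>
           Lp_norm p (leb_Qn n) (\<lambda>x. net_fun n \<Phi> x - indicat_real (slice k n \<Omega> a) x) < ereal \<epsilon>"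
    if \<Omega>: "\<Omega> \<in> K_union_class m (k + n) B l" and \<epsilon>: "0 < \<epsilon>" "\<epsilon> < 1 / 2" and a: "a \<in> Rn k"
    for k \<Omega> \<epsilon> a
  proof -
    obtain l' Ap where Ap: "l' \<le> l" "\<forall>i\<in>{1..l'}. Ap i \<in> K_class m (k + n) B" "\<Omega> = (\<Union>i\<in>{1..l'}. Ap i)"
      using \<Omega> unfolding K_union_class_def by blast
    \<comment> \<open>pieces that are absent, when \<open>\<Omega>\<close> has fewer than \<open>l\<close> of them, are replaced by empty ones\<close>
    define piece where "piece b = (if b < l' then slice k n (Ap (Suc b)) a else {})" for b
    have n1: "n \<ge> 1" using n by simp
    have "\<exists>F G Z. bounded_by_graphs n m C1 (piece b) F G Z" for b
    proof (cases "b < l'")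
      case True
      then have "Ap (Suc b) \<in> K_class m (k + n) B" using Ap(2) by simp
      from slice_dichotomy[OF this m B n1 a] show ?thesis using True by (simp add: piece_def C1_def)
    next
      case False
      then have "piece b \<inter> Qn n \<subseteq> {}" by (simp add: piece_def)
      from null_bounded_by_graphs[OF C1 n1 _ this] show ?thesis by blast
    qed
    then obtain F G Z0 where FGZ: "\<And>b. bounded_by_graphs n m C1 (piece b) (F b) (G b) (Z0 b)" by metis
    define Z where "Z = (\<Union>b<l. Z0 b)"
    have adF: "admissible n m C1 i (F b i)" and adG: "admissible n m C1 i (G b i)" if "i < n" for b i
      using FGZ[of b] that by (auto simp: bounded_by_graphs_def)
    have Znull: "Z \<in> null_sets (leb n)" unfolding Z_def using FGZ by (intro null_sets_UN') (auto simp: bounded_by_graphs_def)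
    have sl: "y \<in> slice k n \<Omega> a \<longleftrightarrow> (\<exists>b<l. \<forall>i<n. F b i y < y i \<and> y i < G b i y)"
      if y: "y \<in> Qn n" "y \<notin> Z" for y
    proof -
      have "y \<in> slice k n \<Omega> a \<longleftrightarrow> (\<exists>i\<in>{1..l'}. y \<in> slice k n (Ap i) a)"
        unfolding Ap(3) slice_def by blast
      also have "{1..l'} = Suc ` {..<l'}" by (simp add: image_Suc_lessThan)
      also have "(\<exists>i\<in>Suc ` {..<l'}. y \<in> slice k n (Ap i) a) \<longleftrightarrow> (\<exists>b<l. y \<in> piece b)"
        by (auto simp: piece_def dest: less_le_trans[OF _ Ap(1)] split: if_splits)
      also have "\<dots> \<longleftrightarrow> (\<exists>b<l. \<forall>i<n. F b i y < y i \<and> y i < G b i y)"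
      proof (rule ex_cong1, rule conj_cong[OF refl])
        fix b assume "b < l"
        then have "y \<notin> Z0 b" using y(2) by (auto simp: Z_def)
        then show "(y \<in> piece b) = (\<forall>i<n. F b i y < y i \<and> y i < G b i y)"
          using FGZ[of b] y(1) unfolding bounded_by_graphs_def by blast
      qed
      finally show ?thesis .
    qed
    have \<epsilon>1: "\<epsilon> < 1" using \<epsilon> by simp
    obtain N where N: "N \<ge> 1" "D / real N ^ m < \<epsilon> powr p" "real N \<le> A * \<epsilon> powr (- (p / real m))"
      by (rule scale_for_accuracy[OF D0 \<epsilon>(1) \<epsilon>1 p m, folded A_def]) (rule that)
    have lp: "\<forall>b<l. \<forall>i<n. locally_poly i m C1 (F b i) \<and> locally_poly i m C1 (G b i)"
      using adF adG unfolding admissible_def by blast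
    from scale[OF N(1) lp] obtain \<Phi> where bounds: "network_bounds n (2 * L + 7) (c0 * N ^ (n - 1)) (real c0 * real N ^ e) \<Phi>"
      and exact: "exact_off_strips n (W N) (real (W N * N ^ m)) (S / real N ^ m) l F G (net_fun n \<Phi>)" by blast
    have \<Phi>: "is_network n 1 \<Phi>" "net_depth \<Phi> = 2 * L + 7" "net_size \<Phi> \<le> c0 * N ^ (n - 1)"
        "net_max \<Phi> \<le> real c0 * real N ^ e" "\<forall>x. net_fun n \<Phi> x \<in> {0..1}"
        "net_fun n \<Phi> \<in> borel_measurable (leb n)"
      using bounds unfolding network_bounds_def by blast+
    define V where "V = W N"
    define K where "K = real (V * N ^ m)"
    define \<sigma> where "\<sigma> = S / real N ^ m"
    have V: "1 \<le> V" using N by (simp add: V_def W_def)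
    have Nm: "0 < real N ^ m" using N by simp
    have K: "0 < K" using N V by (simp add: K_def)
    have \<sigma>0: "0 \<le> \<sigma>" using S0 Nm by (simp add: \<sigma>_def)
    let ?strip = "\<lambda>j f r. {x \<in> Rn n. \<bar>x j - f x\<bar> \<le> r}"
    \<comment> \<open>\<open>B1\<close> is the neighbourhood of the grid, \<open>B2\<close> and \<open>B3\<close> those of the lower and upper graphs\<close>
    define B1 where "B1 = (\<Union>i\<in>{..<n} \<times> {..V}. ?strip (fst i) (\<lambda>x. real (snd i) / real V - 1/2) (1 / K))"
    define B2 where "B2 = (\<Union>i\<in>{..<l} \<times> {..<n}. ?strip (snd i) (F (fst i) (snd i)) \<sigma>)"
    define B3 where "B3 = (\<Union>i\<in>{..<l} \<times> {..<n}. ?strip (snd i) (G (fst i) (snd i)) \<sigma>)"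
    have K10: "0 \<le> 1 / K" using K by simp
    note strips1 = strips_measure[where I = "{..<n} \<times> {..V}" and pos = fst and n = n and
        F = "\<lambda>i x. real (snd i) / real V - 1/2" and r = "\<lambda>_. 1 / K", folded B1_def]
    have b1: "B1 \<in> sets (leb n)"
      by (rule strips1(1)) (use K10 in auto)
    have b1': "emeasure (leb n) (B1 \<inter> Qn n) \<le> ennreal (\<Sum>i\<in>{..<n} \<times> {..V}. 2 * (1 / K))"
      by (rule strips1(2)) (use K10 in auto)
    note strips2 = strips_measure[where I = "{..<l} \<times> {..<n}" and pos = snd and n = n and
        F = "\<lambda>i. F (fst i) (snd i)" and r = "\<lambda>_. \<sigma>", folded B2_def]
    have b2: "B2 \<in> sets (leb n)"
      by (rule strips2(1)) (use \<sigma>0 adF in \<open>auto simp: admissible_def\<close>)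
    have b2': "emeasure (leb n) (B2 \<inter> Qn n) \<le> ennreal (\<Sum>i\<in>{..<l} \<times> {..<n}. 2 * \<sigma>)"
      by (rule strips2(2)) (use \<sigma>0 adF in \<open>auto simp: admissible_def\<close>)
    note strips3 = strips_measure[where I = "{..<l} \<times> {..<n}" and pos = snd and n = n and
        F = "\<lambda>i. G (fst i) (snd i)" and r = "\<lambda>_. \<sigma>", folded B3_def]
    have b3: "B3 \<in> sets (leb n)"
      by (rule strips3(1)) (use \<sigma>0 adG in \<open>auto simp: admissible_def\<close>)
    have b3': "emeasure (leb n) (B3 \<inter> Qn n) \<le> ennreal (\<Sum>i\<in>{..<l} \<times> {..<n}. 2 * \<sigma>)"
      by (rule strips3(2)) (use \<sigma>0 adG in \<open>auto simp: admissible_def\<close>)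
    define Bad where "Bad = B1 \<union> B2 \<union> B3"
    have Bad: "Bad \<in> sets (leb n)" using b1 b2 b3 by (simp add: Bad_def)
    have s1: "(\<Sum>i\<in>{..<n} \<times> {..V}. 2 * (1 / K)) \<le> 4 * real n / real N ^ m"
    proof -
      have "(\<Sum>i\<in>{..<n} \<times> {..V}. 2 * (1 / K)) = real n * (real V + 1) * 2 / K"
        by (simp add: card_cartesian_product algebra_simps add_divide_distrib)
      also have "\<dots> \<le> real n * (2 * real V) * 2 / K"
        using V K by (intro divide_right_mono mult_right_mono mult_left_mono) auto
      also have "\<dots> = 4 * real n / real N ^ m" using V Nm by (simp add: K_def)
      finally show ?thesis .
    qed
    have s2: "(\<Sum>i\<in>{..<l} \<times> {..<n}. 2 * \<sigma>) = 2 * real (l * n) * S / real N ^ m"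
      by (simp add: card_cartesian_product \<sigma>_def)
    have "emeasure (leb n) (Bad \<inter> Qn n) = emeasure (leb n) ((B1 \<inter> Qn n) \<union> (B2 \<inter> Qn n) \<union> (B3 \<inter> Qn n))"
      by (rule arg_cong[of _ _ "emeasure (leb n)"]) (auto simp: Bad_def)
    also have "\<dots> \<le> emeasure (leb n) ((B1 \<inter> Qn n) \<union> (B2 \<inter> Qn n)) + emeasure (leb n) (B3 \<inter> Qn n)"
      using b1 b2 b3 by (intro emeasure_subadditive) auto
    also have "\<dots> \<le> emeasure (leb n) (B1 \<inter> Qn n) + emeasure (leb n) (B2 \<inter> Qn n) + emeasure (leb n) (B3 \<inter> Qn n)"
      using b1 b2 by (intro add_right_mono emeasure_subadditive) auto
    also have "\<dots> \<le> ennreal (4 * real n / real N ^ m) + ennreal (2 * real (l * n) * S / real N ^ m)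
        + ennreal (2 * real (l * n) * S / real N ^ m)"
      using b2' b3' order_trans[OF b1' ennreal_leI[OF s1]] unfolding s2 by (intro add_mono)
    also have "\<dots> = ennreal (D / real N ^ m)"
    proof -
      have "0 \<le> 4 * real n / real N ^ m" "0 \<le> 2 * real (l * n) * S / real N ^ m" using S0 Nm by auto
      then have "ennreal (4 * real n / real N ^ m) + ennreal (2 * real (l * n) * S / real N ^ m)
        + ennreal (2 * real (l * n) * S / real N ^ m) =
        ennreal (4 * real n / real N ^ m + 2 * real (l * n) * S / real N ^ m + 2 * real (l * n) * S / real N ^ m)"
        by (simp only: ennreal_plus add_nonneg_nonneg)
      also have "4 * real n / real N ^ m + 2 * real (l * n) * S / real N ^ m + 2 * real (l * n) * S / real N ^ m
        = D / real N ^ m"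
        unfolding add_divide_distrib[symmetric] by (rule arg_cong[of _ _ "\<lambda>t. t / real N ^ m"]) (simp add: D_def)
      finally show ?thesis .
    qed
    finally have Bad_measure: "emeasure (leb n) (Bad \<inter> Qn n) \<le> ennreal (D / real N ^ m)" .
    define E where "E b i = {y \<in> space (leb n). F b i y < y i \<and> y i < G b i y}" for b i
    have E: "E b i \<in> sets (leb n)" if i: "i < n" for b i
    proof -
      have [measurable]: "F b i \<in> borel_measurable (leb n)" "G b i \<in> borel_measurable (leb n)"
        using adF[OF i] adG[OF i] by (auto simp: admissible_def)
      have [measurable]: "(\<lambda>y. y i) \<in> borel_measurable (leb n)"
        using i measurable_component_singleton[of i "{..<n}" "\<lambda>_. lborel :: real measure"] by simp
      show ?thesis unfolding E_def by measurable
    qed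
    define U where "U = (\<Union>b\<in>{..<l}. \<Inter>i\<in>{..<n}. E b i)"
    have U: "U \<in> sets (leb n)"
      unfolding U_def using E n by (intro sets.finite_UN sets.finite_INT) (auto simp: lessThan_empty_iff)
    have U_iff: "y \<in> U \<longleftrightarrow> (\<exists>b<l. \<forall>i<n. F b i y < y i \<and> y i < G b i y)" if "y \<in> Qn n" for y
      using that Qn_subset_Rn by (auto simp: U_def E_def space_leb)
    have ind: "indicat_real (slice k n \<Omega> a) \<in> borel_measurable (leb_Qn n)"
      by (rule indicator_leb_Qn_measurable[OF U Znull]) (simp add: sl U_iff)
    let ?h = "\<lambda>x. net_fun n \<Phi> x - indicat_real (slice k n \<Omega> a) x"
    have Lp: "Lp_norm p (leb_Qn n) ?h < ereal \<epsilon>"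
    proof (rule Lp_norm_less_of_bad_set[OF _ _ Bad Bad_measure Znull _ p \<epsilon>(1) _ N(2)])
      show "?h \<in> borel_measurable (leb_Qn n)"
        using measurable_leb_Qn[OF \<Phi>(6)] ind by (rule borel_measurable_diff)
      show "\<bar>?h x\<bar> \<le> 1" for x
      proof -
        have "0 \<le> net_fun n \<Phi> x" "net_fun n \<Phi> x \<le> 1" using \<Phi>(5) by auto
        moreover have "0 \<le> indicat_real (slice k n \<Omega> a) x" "indicat_real (slice k n \<Omega> a) x \<le> 1"
          by (auto simp: indicator_def)
        ultimately show ?thesis by linarith
      qed
      show "0 \<le> D / real N ^ m" using D0 Nm by simp
    next
      fix x assume x: "x \<in> Qn n" "x \<notin> Bad" "x \<notin> Z"
      have xR: "x \<in> Rn n" using x Qn_subset_Rn by blast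
      have og: "\<forall>j<n. off_grid (W N) (real (W N * N ^ m)) (x j + 1/2)"
        unfolding V_def[symmetric] K_def[symmetric] off_grid_def
      proof (intro allI impI conjI)
        fix j assume j: "j < n"
        have "\<bar>x j\<bar> \<le> 1/2" using x(1) j by (simp add: Qn_iff)
        then show "0 \<le> x j + 1/2" "x j + 1/2 \<le> 1" by linarith+
        fix u assume u: "u \<le> V"
        have "x \<notin> ?strip (fst (j, u)) (\<lambda>x. real (snd (j, u)) / real V - 1/2) (1 / K)"
          using x(2) j u unfolding Bad_def B1_def by blast
        then have "1 / K < \<bar>x j - (real u / real V - 1/2)\<bar>" using xR by simp
        then show "1 / K \<le> \<bar>x j + 1/2 - real u / real V\<bar>" by (simp add: algebra_simps)
      qed
      have far: "\<forall>b<l. \<forall>i<n. \<sigma> < \<bar>x i - F b i x\<bar> \<and> \<sigma> < \<bar>x i - G b i x\<bar>"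
      proof (intro allI impI)
        fix b i assume bi: "b < l" "i < n"
        have "x \<notin> ?strip (snd (b, i)) (F (fst (b, i)) (snd (b, i))) \<sigma>"
          "x \<notin> ?strip (snd (b, i)) (G (fst (b, i)) (snd (b, i))) \<sigma>"
          using x(2) bi unfolding Bad_def B2_def B3_def by blast+
        then show "\<sigma> < \<bar>x i - F b i x\<bar> \<and> \<sigma> < \<bar>x i - G b i x\<bar>" using xR by simp
      qed
      have "net_fun n \<Phi> x = (if \<exists>b<l. \<forall>i<n. F b i x < x i \<and> x i < G b i x then 1 else 0)"
        using exact x(1) og far unfolding \<sigma>_def exact_off_strips_def by blast
      then show "?h x = 0" unfolding sl[OF x(1,3), symmetric] by (simp add: indicator_def)
    qed
    define a0 where "a0 = \<epsilon> powr (- (p / real m))"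
    have a0: "0 < a0" using \<epsilon> by (simp add: a0_def)
    have a0_pow: "a0 ^ i = \<epsilon> powr (- (p / real m) * real i)" for i
    proof -
      have "a0 ^ i = a0 powr real i" using a0 by (simp add: powr_realpow)
      then show ?thesis by (simp add: a0_def powr_powr)
    qed
    have N_pow: "real N ^ i \<le> A ^ i * a0 ^ i" for i
    proof -
      have "real N ^ i \<le> (A * a0) ^ i" using N(3) by (intro power_mono) (auto simp: a0_def)
      then show ?thesis by (simp add: power_mult_distrib)
    qed
    have size: "real (net_size \<Phi>) \<le> c * \<epsilon> powr (- (p * (real n - 1) / real m))"
    proof -
      have "real (net_size \<Phi>) \<le> real (c0 * N ^ (n - 1))" using \<Phi>(3) by (simp only: of_nat_le_iff)
      also have "\<dots> = real c0 * real N ^ (n - 1)" by simp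
      also have "\<dots> \<le> (real c0 + 1) * (A ^ (n - 1) * a0 ^ (n - 1))"
        using N_pow A2 by (intro mult_mono) auto
      also have "\<dots> = c * a0 ^ (n - 1)" by (simp add: c_def)
      also have "a0 ^ (n - 1) = \<epsilon> powr (- (p * (real n - 1) / real m))"
      proof -
        have "- (p / real m) * real (n - 1) = - (p * (real n - 1) / real m)"
          using n by (simp add: of_nat_diff)
        then show ?thesis by (simp only: a0_pow)
      qed
      finally show ?thesis .
    qed
    have max: "net_max \<Phi> \<le> \<epsilon> powr (- s)"
    proof -
      define g where "g = log 2 ((real c0 + 1) * A ^ e)"
      have g0: "0 \<le> g" using Ae by (simp add: g_def)
      have "net_max \<Phi> \<le> real c0 * real N ^ e" by (rule \<Phi>(4))
      also have "\<dots> \<le> (real c0 + 1) * (A ^ e * a0 ^ e)"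
        using N_pow A2 by (intro mult_mono) auto
      also have "\<dots> = 2 powr g * a0 ^ e" using Ae by (simp add: g_def)
      also have "\<dots> \<le> (1 / \<epsilon>) powr g * a0 ^ e"
        using g0 \<epsilon> a0 by (intro mult_right_mono powr_mono2) (auto simp: le_divide_eq)
      also have "\<dots> = \<epsilon> powr (- g) * a0 ^ e" using \<epsilon> by (simp add: powr_minus_divide powr_divide)
      also have "\<dots> = \<epsilon> powr (- g + - (p / real m) * real e)"
        by (simp only: a0_pow powr_add)
      also have "\<dots> \<le> \<epsilon> powr (- s)"
        using \<epsilon> by (intro powr_mono') (auto simp: s_def g_def)
      finally show ?thesis .
    qed
    show ?thesis
    proof (intro exI[of _ \<Phi>] conjI)
      show "real (net_depth \<Phi>) \<le> real_of_int \<lceil>log 2 (real ((l + 1) * n))\<rceil> +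
             (3 + real_of_int \<lceil>log 2 (real m)\<rceil>) * (14 + 2 * real m / real n)"
        unfolding \<Phi>(2) by (rule depth_bound[OF n m L(3)])
      show "\<forall>x\<in>Rn n. net_fun n \<Phi> x \<in> {0..1}" using \<Phi>(5) by blast
    qed (fact \<Phi>(1) max size Lp)+
  qed
  show ?thesis using c s main by blast
qed

end
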